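(* Let $k$ be a field. Let $\mathcal D$ be a full subcategory of the biset category $k\mathcal C$. Let $G$ and $H$ be two groups of $\mathcal D$. The following are equivalent. 1. $H\vdash_kG$. 2. There exists $n\in\mathbb N^*$ such that $Y_H$ is a direct summand of $(Y_G)^n$ in the category $\mathcal F_{\mathcal D,k}$.
   Context: For finite groups $G,H$, a $G$-$H$-biset is a finite set with commuting left $G$-action and right $H$-action. $B(G,H)$ is the Grothendieck group (for disjoint union) of finite $G$-$H$-bisets and $kB(G,H)=k\otimes_{\mathbb Z}B(G,H)$. For a $G$-$H$-biset $U$ and an $H$-$K$-biset $W$, $U\times_H W$ is the quotient of $U\times W$ by the relation $(uh,w)\sim(u,hw)$; this extends to a bilinear map $kB(G,H)\times kB(H,K)\to kB(G,K)$. The biset category $k\mathcal C$ has the finite groups as objects, $\mathrm{Hom}_{k\mathcal C}(G,H)=kB(H,G)$, composition $\times_H$, and the identity of $G$ is the class of the biset $G$. $\mathcal F_{\mathcal D,k}$ is the category of $k$-linear functors $\mathcal D\to k\text{-}\mathrm{Mod}$. For $G\in\mathcal D$, $Y_G=\mathrm{Hom}_{\mathcal D}(G,-)=kB(-,G)$ is the representable (Yoneda) functor. $kB(H,G)B(G,H)$ denotes the set of linear combinations of elements $U\times_GW$ with $U\in kB(H,G)$, $W\in kB(G,H)$. The notation $H\vdash_kG$ ($H$ is $k$-generated by $G$) means $kB(H,G)B(G,H)=kB(H,H)$. *)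

theory Defs
  imports "HOL-Algebra.Free_Abelian_Groups" "HOL-Algebra.Module"
begin

section \<open>Bisets\<close>

text \<open>The actions are total functions, constrained only on the carriers. The library's
  \<open>group_action\<close> is not used because it asks for extensional actions.\<close>

record ('u, 'g, 'h) biset = "'u partial_object" +
  lact :: "'g \<Rightarrow> 'u \<Rightarrow> 'u"
  ract :: "'u \<Rightarrow> 'h \<Rightarrow> 'u"

definition is_biset :: "'g monoid \<Rightarrow> 'h monoid \<Rightarrow> ('u, 'g, 'h) biset \<Rightarrow> bool" where
  "is_biset G H U \<longleftrightarrow>
     finite (carrier U) \<and>
     (\<forall>g\<in>carrier G. \<forall>u\<in>carrier U. lact U g u \<in> carrier U) \<and>
     (\<forall>h\<in>carrier H. \<forall>u\<in>carrier U. ract U u h \<in> carrier U) \<and>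
     (\<forall>u\<in>carrier U. lact U \<one>\<^bsub>G\<^esub> u = u \<and> ract U u \<one>\<^bsub>H\<^esub> = u) \<and>
     (\<forall>g\<in>carrier G. \<forall>g'\<in>carrier G. \<forall>u\<in>carrier U.
        lact U (g \<otimes>\<^bsub>G\<^esub> g') u = lact U g (lact U g' u)) \<and>
     (\<forall>h\<in>carrier H. \<forall>h'\<in>carrier H. \<forall>u\<in>carrier U.
        ract U u (h \<otimes>\<^bsub>H\<^esub> h') = ract U (ract U u h) h') \<and>
     (\<forall>g\<in>carrier G. \<forall>h\<in>carrier H. \<forall>u\<in>carrier U.
        ract U (lact U g u) h = lact U g (ract U u h))"

definition biset_isomorphic ::
  "'g monoid \<Rightarrow> 'h monoid \<Rightarrow> ('u, 'g, 'h) biset \<Rightarrow> ('v, 'g, 'h) biset \<Rightarrow> bool" where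
  "biset_isomorphic G H U V \<longleftrightarrow>
     (\<exists>f. bij_betw f (carrier U) (carrier V) \<and>
        (\<forall>g\<in>carrier G. \<forall>u\<in>carrier U. f (lact U g u) = lact V g (f u)) \<and>
        (\<forall>h\<in>carrier H. \<forall>u\<in>carrier U. f (ract U u h) = ract V (f u) h))"

definition disjoint_union ::
  "('u, 'g, 'h) biset \<Rightarrow> ('v, 'g, 'h) biset \<Rightarrow> ('u + 'v, 'g, 'h) biset" where
  "disjoint_union U V =
     \<lparr>carrier = carrier U <+> carrier V,
      lact = (\<lambda>g. map_sum (lact U g) (lact V g)),
      ract = (\<lambda>x h. map_sum (\<lambda>u. ract U u h) (\<lambda>v. ract V v h) x)\<rparr>"

definition group_biset :: "'g monoid \<Rightarrow> ('g, 'g, 'g) biset" where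
  "group_biset G =
     \<lparr>carrier = carrier G, lact = (\<lambda>g x. g \<otimes>\<^bsub>G\<^esub> x), ract = (\<lambda>x g. x \<otimes>\<^bsub>G\<^esub> g)\<rparr>"

text \<open>The relation \<open>(uh, w) \<sim> (u, hw)\<close>; since \<open>H\<close> is a group it is already an equivalence
  relation on the product of the carriers. The image of a class under a translation is again a
  class, so images give the actions on the quotient.\<close>

definition tensor_rel ::
  "'h monoid \<Rightarrow> ('u, 'g, 'h) biset \<Rightarrow> ('w, 'h, 'k) biset \<Rightarrow> (('u \<times> 'w) \<times> ('u \<times> 'w)) set" where
  "tensor_rel H U W =
     {((ract U u h, w), (u, lact W h w)) | u h w.
        u \<in> carrier U \<and> h \<in> carrier H \<and> w \<in> carrier W}"

definition biset_tensor ::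
  "'h monoid \<Rightarrow> ('u, 'g, 'h) biset \<Rightarrow> ('w, 'h, 'k) biset \<Rightarrow> (('u \<times> 'w) set, 'g, 'k) biset" where
  "biset_tensor H U W =
     \<lparr>carrier = (carrier U \<times> carrier W) // tensor_rel H U W,
      lact = (\<lambda>g X. (\<lambda>(u, w). (lact U g u, w)) ` X),
      ract = (\<lambda>X x. (\<lambda>(u, w). (u, ract W w x)) ` X)\<rparr>"


section \<open>The Grothendieck group and its scalar extension\<close>

text \<open>Every finite biset has a copy with points in \<^typ>\<open>nat\<close>, so isomorphism classes are
  represented by sets of bisets on \<^typ>\<open>nat\<close>. The biset whose class is taken may live on any
  type.\<close>

definition biset_class ::
  "'g monoid \<Rightarrow> 'h monoid \<Rightarrow> ('u, 'g, 'h) biset \<Rightarrow> (nat, 'g, 'h) biset set" where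
  "biset_class G H U = {V. is_biset G H V \<and> biset_isomorphic G H U V}"

type_synonym ('g, 'h) burnside_elt = "((nat, 'g, 'h) biset set \<Rightarrow>\<^sub>0 int) set"

definition biset_free :: "'g monoid \<Rightarrow> 'h monoid \<Rightarrow> ((nat, 'g, 'h) biset set \<Rightarrow>\<^sub>0 int) monoid" where
  "biset_free G H = free_Abelian_group (biset_class G H ` {U :: (nat, 'g, 'h) biset. is_biset G H U})"

definition union_relations :: "'g monoid \<Rightarrow> 'h monoid \<Rightarrow> ((nat, 'g, 'h) biset set \<Rightarrow>\<^sub>0 int) set" where
  "union_relations G H = generate (biset_free G H)
     {frag_of (biset_class G H (disjoint_union U V))
        - frag_of (biset_class G H U) - frag_of (biset_class G H V) |
       (U :: (nat, 'g, 'h) biset) (V :: (nat, 'g, 'h) biset).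
      is_biset G H U \<and> is_biset G H V}"

text \<open>\<open>B(G, H)\<close>, written multiplicatively as all groups in the library.\<close>

definition burnside :: "'g monoid \<Rightarrow> 'h monoid \<Rightarrow> ('g, 'h) burnside_elt monoid" where
  "burnside G H = biset_free G H Mod union_relations G H"

definition burnside_class ::
  "'g monoid \<Rightarrow> 'h monoid \<Rightarrow> ('u, 'g, 'h) biset \<Rightarrow> ('g, 'h) burnside_elt" where
  "burnside_class G H U =
     union_relations G H #>\<^bsub>biset_free G H\<^esub> frag_of (biset_class G H U)"

text \<open>The tensor product \<open>k \<otimes>\<^sub>\<int> A\<close> of the ring \<open>k\<close> with an abelian group \<open>A\<close> (multiplicative
  notation) as a \<open>k\<close>-module. Biadditivity implies that integers can be moved across. The fields
  \<open>mult\<close> and \<open>one\<close> of the record play no role in a module.\<close>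

definition tensor_free :: "'k ring \<Rightarrow> 'b monoid \<Rightarrow> ('k \<times> 'b \<Rightarrow>\<^sub>0 int) monoid" where
  "tensor_free k A = free_Abelian_group (carrier k \<times> carrier A)"

definition tensor_relations :: "'k ring \<Rightarrow> 'b monoid \<Rightarrow> ('k \<times> 'b \<Rightarrow>\<^sub>0 int) set" where
  "tensor_relations k A = generate (tensor_free k A)
     ({frag_of (r \<oplus>\<^bsub>k\<^esub> s, a) - frag_of (r, a) - frag_of (s, a) | r s a.
         r \<in> carrier k \<and> s \<in> carrier k \<and> a \<in> carrier A} \<union>
      {frag_of (r, a \<otimes>\<^bsub>A\<^esub> b) - frag_of (r, a) - frag_of (r, b) | r a b.
         r \<in> carrier k \<and> a \<in> carrier A \<and> b \<in> carrier A})"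

definition pure_tensor :: "'k ring \<Rightarrow> 'b monoid \<Rightarrow> 'k \<Rightarrow> 'b \<Rightarrow> ('k \<times> 'b \<Rightarrow>\<^sub>0 int) set" where
  "pure_tensor k A r a = tensor_relations k A #>\<^bsub>tensor_free k A\<^esub> frag_of (r, a)"

definition scalar_extension :: "'k ring \<Rightarrow> 'b monoid \<Rightarrow> ('k, ('k \<times> 'b \<Rightarrow>\<^sub>0 int) set) module" where
  "scalar_extension k A =
     (let Q = tensor_free k A Mod tensor_relations k A in
      \<lparr>carrier = carrier Q, mult = undefined, one = undefined,
       zero = \<one>\<^bsub>Q\<^esub>, add = mult Q,
       smult = (\<lambda>r X. \<Union>x\<in>X. tensor_relations k A #>\<^bsub>tensor_free k A\<^esub>
                  frag_extend (\<lambda>(s, a). frag_of (r \<otimes>\<^bsub>k\<^esub> s, a)) x)\<rparr>)"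

type_synonym ('k, 'g, 'h) kB_elt = "('k \<times> ('g, 'h) burnside_elt \<Rightarrow>\<^sub>0 int) set"

definition kB :: "'k ring \<Rightarrow> 'g monoid \<Rightarrow> 'h monoid \<Rightarrow> ('k, ('k, 'g, 'h) kB_elt) module" where
  "kB k G H = scalar_extension k (burnside G H)"

definition kB_class ::
  "'k ring \<Rightarrow> 'g monoid \<Rightarrow> 'h monoid \<Rightarrow> ('u, 'g, 'h) biset \<Rightarrow> ('k, 'g, 'h) kB_elt" where
  "kB_class k G H U = pure_tensor k (burnside G H) \<one>\<^bsub>k\<^esub> (burnside_class G H U)"

definition linear_maps :: "'k ring \<Rightarrow> ('k, 'v) module \<Rightarrow> ('k, 'w) module \<Rightarrow> ('v \<Rightarrow> 'w) set" where
  "linear_maps k M N = {f. f \<in> carrier M \<rightarrow> carrier N \<and>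
     (\<forall>x\<in>carrier M. \<forall>y\<in>carrier M. f (x \<oplus>\<^bsub>M\<^esub> y) = f x \<oplus>\<^bsub>N\<^esub> f y) \<and>
     (\<forall>r\<in>carrier k. \<forall>x\<in>carrier M. f (r \<odot>\<^bsub>M\<^esub> x) = r \<odot>\<^bsub>N\<^esub> f x)}"

definition bilinear_maps ::
  "'k ring \<Rightarrow> ('k, 'u) module \<Rightarrow> ('k, 'v) module \<Rightarrow> ('k, 'w) module \<Rightarrow> ('u \<times> 'v \<Rightarrow> 'w) set" where
  "bilinear_maps k M N P =
     {f \<in> extensional (carrier M \<times> carrier N).
       (\<forall>y\<in>carrier N. (\<lambda>x. f (x, y)) \<in> linear_maps k M P) \<and>
       (\<forall>x\<in>carrier M. (\<lambda>y. f (x, y)) \<in> linear_maps k N P)}"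

text \<open>The bilinear extension of \<open>(U, W) \<mapsto> U \<times>\<^sub>H W\<close>. It exists because \<open>\<times>\<^sub>H\<close> respects
  isomorphisms and disjoint unions, and it is unique because classes of bisets span \<open>kB\<close>.\<close>

definition kB_comp :: "'k ring \<Rightarrow> 'g monoid \<Rightarrow> 'h monoid \<Rightarrow> 'l monoid \<Rightarrow>
    ('k, 'g, 'h) kB_elt \<times> ('k, 'h, 'l) kB_elt \<Rightarrow> ('k, 'g, 'l) kB_elt" where
  "kB_comp k G H L =
     (THE f. f \<in> bilinear_maps k (kB k G H) (kB k H L) (kB k G L) \<and>
        (\<forall>(U :: (nat, 'g, 'h) biset) (W :: (nat, 'h, 'l) biset).
           is_biset G H U \<longrightarrow> is_biset H L W \<longrightarrow>
           f (kB_class k G H U, kB_class k H L W) = kB_class k G L (biset_tensor H U W)))"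


section \<open>Linear categories and functors\<close>

text \<open>\<open>Comp C X Y Z g f\<close> is the composite of \<open>f : X \<rightarrow> Y\<close> followed by \<open>g : Y \<rightarrow> Z\<close>.\<close>

record ('o, 'k, 'm) lin_cat =
  Ob :: "'o set"
  Hom :: "'o \<Rightarrow> 'o \<Rightarrow> ('k, 'm) module"
  Comp :: "'o \<Rightarrow> 'o \<Rightarrow> 'o \<Rightarrow> 'm \<Rightarrow> 'm \<Rightarrow> 'm"
  Ident :: "'o \<Rightarrow> 'm"

text \<open>The direction is reversed: morphisms from \<open>G\<close> to \<open>H\<close> are the elements of \<open>kB(H, G)\<close>.\<close>

definition biset_category :: "'k ring \<Rightarrow> ('a monoid, 'k, ('k, 'a, 'a) kB_elt) lin_cat" where
  "biset_category k =
     \<lparr>Ob = {G. group G \<and> finite (carrier G)},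
      Hom = (\<lambda>G H. kB k H G),
      Comp = (\<lambda>X Y Z \<beta> \<alpha>. kB_comp k Z Y X (\<beta>, \<alpha>)),
      Ident = (\<lambda>G. kB_class k G G (group_biset G))\<rparr>"

definition full_subcategory :: "('o, 'k, 'm) lin_cat \<Rightarrow> ('o, 'k, 'm) lin_cat \<Rightarrow> bool" where
  "full_subcategory D C \<longleftrightarrow> Ob D \<subseteq> Ob C \<and>
     (\<forall>X\<in>Ob D. \<forall>Y\<in>Ob D. Hom D X Y = Hom C X Y) \<and>
     (\<forall>X\<in>Ob D. \<forall>Y\<in>Ob D. \<forall>Z\<in>Ob D. Comp D X Y Z = Comp C X Y Z) \<and>
     (\<forall>X\<in>Ob D. Ident D X = Ident C X)"

record ('o, 'k, 'm, 'v) lin_functor =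
  FOb :: "'o \<Rightarrow> ('k, 'v) module"
  FArr :: "'o \<Rightarrow> 'o \<Rightarrow> 'm \<Rightarrow> 'v \<Rightarrow> 'v"

text \<open>Objects of \<open>\<F>\<^sub>D\<^sub>,\<^sub>k\<close>: the \<open>k\<close>-linear functors from \<open>D\<close> to \<open>k\<close>-modules.\<close>

definition linear_functor ::
  "'k ring \<Rightarrow> ('o, 'k, 'm) lin_cat \<Rightarrow> ('o, 'k, 'm, 'v) lin_functor \<Rightarrow> bool" where
  "linear_functor k D F \<longleftrightarrow>
     (\<forall>X\<in>Ob D. module k (FOb F X)) \<and>
     (\<forall>X\<in>Ob D. \<forall>Y\<in>Ob D. \<forall>f\<in>carrier (Hom D X Y).
        FArr F X Y f \<in> linear_maps k (FOb F X) (FOb F Y)) \<and>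
     (\<forall>X\<in>Ob D. \<forall>Y\<in>Ob D. \<forall>f\<in>carrier (Hom D X Y). \<forall>g\<in>carrier (Hom D X Y). \<forall>x\<in>carrier (FOb F X).
        FArr F X Y (f \<oplus>\<^bsub>Hom D X Y\<^esub> g) x = FArr F X Y f x \<oplus>\<^bsub>FOb F Y\<^esub> FArr F X Y g x) \<and>
     (\<forall>X\<in>Ob D. \<forall>Y\<in>Ob D. \<forall>r\<in>carrier k. \<forall>f\<in>carrier (Hom D X Y). \<forall>x\<in>carrier (FOb F X).
        FArr F X Y (r \<odot>\<^bsub>Hom D X Y\<^esub> f) x = r \<odot>\<^bsub>FOb F Y\<^esub> FArr F X Y f x) \<and>
     (\<forall>X\<in>Ob D. \<forall>x\<in>carrier (FOb F X). FArr F X X (Ident D X) x = x) \<and>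
     (\<forall>X\<in>Ob D. \<forall>Y\<in>Ob D. \<forall>Z\<in>Ob D. \<forall>f\<in>carrier (Hom D X Y). \<forall>g\<in>carrier (Hom D Y Z).
        \<forall>x\<in>carrier (FOb F X). FArr F X Z (Comp D X Y Z g f) x = FArr F Y Z g (FArr F X Y f x))"

definition natural_transformations ::
  "'k ring \<Rightarrow> ('o, 'k, 'm) lin_cat \<Rightarrow> ('o, 'k, 'm, 'v) lin_functor \<Rightarrow>
   ('o, 'k, 'm, 'w) lin_functor \<Rightarrow> ('o \<Rightarrow> 'v \<Rightarrow> 'w) set" where
  "natural_transformations k D F E =
     {\<eta>. (\<forall>X\<in>Ob D. \<eta> X \<in> linear_maps k (FOb F X) (FOb E X)) \<and>
        (\<forall>X\<in>Ob D. \<forall>Y\<in>Ob D. \<forall>f\<in>carrier (Hom D X Y). \<forall>x\<in>carrier (FOb F X).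
           \<eta> Y (FArr F X Y f x) = FArr E X Y f (\<eta> X x))}"

definition functor_isomorphic ::
  "'k ring \<Rightarrow> ('o, 'k, 'm) lin_cat \<Rightarrow> ('o, 'k, 'm, 'v) lin_functor \<Rightarrow>
   ('o, 'k, 'm, 'w) lin_functor \<Rightarrow> bool" where
  "functor_isomorphic k D F E \<longleftrightarrow>
     (\<exists>\<eta>\<in>natural_transformations k D F E. \<exists>\<theta>\<in>natural_transformations k D E F.
        \<forall>X\<in>Ob D. (\<forall>x\<in>carrier (FOb F X). \<theta> X (\<eta> X x) = x) \<and>
                 (\<forall>y\<in>carrier (FOb E X). \<eta> X (\<theta> X y) = y))"

definition module_sum :: "('k, 'v) module \<Rightarrow> ('k, 'w) module \<Rightarrow> ('k, 'v \<times> 'w) module" where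
  "module_sum M N =
     \<lparr>carrier = carrier M \<times> carrier N, mult = undefined, one = undefined,
      zero = (\<zero>\<^bsub>M\<^esub>, \<zero>\<^bsub>N\<^esub>),
      add = (\<lambda>(x, y) (x', y'). (x \<oplus>\<^bsub>M\<^esub> x', y \<oplus>\<^bsub>N\<^esub> y')),
      smult = (\<lambda>r (x, y). (r \<odot>\<^bsub>M\<^esub> x, r \<odot>\<^bsub>N\<^esub> y))\<rparr>"

definition module_power :: "('k, 'v) module \<Rightarrow> nat \<Rightarrow> ('k, nat \<Rightarrow> 'v) module" where
  "module_power M n =
     \<lparr>carrier = {..<n} \<rightarrow>\<^sub>E carrier M, mult = undefined, one = undefined,
      zero = (\<lambda>i\<in>{..<n}. \<zero>\<^bsub>M\<^esub>),
      add = (\<lambda>x y. \<lambda>i\<in>{..<n}. x i \<oplus>\<^bsub>M\<^esub> y i),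
      smult = (\<lambda>r x. \<lambda>i\<in>{..<n}. r \<odot>\<^bsub>M\<^esub> x i)\<rparr>"

definition functor_sum ::
  "('o, 'k, 'm, 'v) lin_functor \<Rightarrow> ('o, 'k, 'm, 'w) lin_functor \<Rightarrow>
   ('o, 'k, 'm, 'v \<times> 'w) lin_functor" where
  "functor_sum F E =
     \<lparr>FOb = (\<lambda>X. module_sum (FOb F X) (FOb E X)),
      FArr = (\<lambda>X Y f. map_prod (FArr F X Y f) (FArr E X Y f))\<rparr>"

definition functor_power ::
  "('o, 'k, 'm, 'v) lin_functor \<Rightarrow> nat \<Rightarrow> ('o, 'k, 'm, nat \<Rightarrow> 'v) lin_functor" where
  "functor_power F n =
     \<lparr>FOb = (\<lambda>X. module_power (FOb F X) n),
      FArr = (\<lambda>X Y f x. \<lambda>i\<in>{..<n}. FArr F X Y f (x i))\<rparr>"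

text \<open>A complement of \<open>F\<close> in \<open>E\<close> is isomorphic to a subfunctor of \<open>E\<close>, so it is no restriction
  that its modules have elements of the same type as those of \<open>E\<close>.\<close>

definition direct_summand ::
  "'k ring \<Rightarrow> ('o, 'k, 'm) lin_cat \<Rightarrow> ('o, 'k, 'm, 'v) lin_functor \<Rightarrow>
   ('o, 'k, 'm, 'w) lin_functor \<Rightarrow> bool" where
  "direct_summand k D F E \<longleftrightarrow>
     (\<exists>C :: ('o, 'k, 'm, 'w) lin_functor.
        linear_functor k D C \<and> functor_isomorphic k D E (functor_sum F C))"

definition yoneda :: "('o, 'k, 'm) lin_cat \<Rightarrow> 'o \<Rightarrow> ('o, 'k, 'm, 'm) lin_functor" where
  "yoneda D G = \<lparr>FOb = (\<lambda>X. Hom D G X), FArr = (\<lambda>X Y f x. Comp D G X Y f x)\<rparr>"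


section \<open>Generation of a group by another one\<close>

definition linear_combinations :: "'k ring \<Rightarrow> ('k, 'v) module \<Rightarrow> 'v set \<Rightarrow> 'v set" where
  "linear_combinations k M S =
     {finsum M (\<lambda>i. c i \<odot>\<^bsub>M\<^esub> x i) {..<n} | (n :: nat) c x.
        c \<in> {..<n} \<rightarrow> carrier k \<and> x \<in> {..<n} \<rightarrow> S}"

text \<open>The relation \<open>H \<turnstile>\<^sub>k G\<close>.\<close>

definition k_generated :: "'k ring \<Rightarrow> 'h monoid \<Rightarrow> 'g monoid \<Rightarrow> bool" where
  "k_generated k H G \<longleftrightarrow>
     linear_combinations k (kB k H H)
       {kB_comp k H G H (U, W) | U W. U \<in> carrier (kB k H G) \<and> W \<in> carrier (kB k G H)}
     = carrier (kB k H H)"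

end

(*
The evaluation of a natural transformation at identities (Yoneda) turns a retraction of
Y_H off (Y_G)^n into a decomposition id_H = U_1 W_1 + ... + U_n W_n with U_i in kB(H,G) and
W_i in kB(G,H). Such a decomposition says exactly that the two-sided ideal
kB(H,G)B(G,H) of kB(H,H) contains the identity, i.e. is everything; conversely
x |-> (x U_i)_i and (y_i)_i |-> y_1 W_1 + ... + y_n W_n exhibit Y_H as a retract of (Y_G)^n,
and a retract is a direct summand because the kernel of the retraction is a complement.
This argument holds in every k-linear category; the rest of the work is that kC is one,
i.e. that the bilinear extension of the tensor product of bisets exists and is associative
and unital.
*)

theory Submission
  imports Defs
begin

section \<open>Linear maps and sums of modules\<close>

text \<open>Composition in the biset category is given by a definite description, so nothing is
  known about \<open>kB_comp\<close> until a bilinear map with the prescribed values on classes of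
  bisets is shown to exist and to be unique. Both rest on one principle: a function on bisets that
  is invariant under isomorphism and turns disjoint unions into sums extends to a linear map on
  \<open>kB k G H\<close> (\<open>kB_universal\<close>), and linear maps agree once they agree on
  classes of bisets (\<open>kB_linear_eqI\<close>). Laws in several variables are reached one
  variable at a time, so that associativity and the unit laws come down to isomorphisms of bisets. A
  second obstacle is types. Disjoint unions and tensor products of bisets on \<open>nat\<close> live
  on sum types and on sets of pairs, whereas classes consist of bisets on \<open>nat\<close>.
  Isomorphism is therefore a relation between bisets on different types, and statements about
  classes are transported to copies on \<open>nat\<close>. In the abstract part the scalars of a
  linear combination are absorbed into the left factors, and a zero term is appended to reach a
  positive exponent.\<close>

lemma linear_mapsI:
  assumes "\<And>x. x \<in> carrier M \<Longrightarrow> f x \<in> carrier N"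
    and "\<And>x y. x \<in> carrier M \<Longrightarrow> y \<in> carrier M \<Longrightarrow> f (x \<oplus>\<^bsub>M\<^esub> y) = f x \<oplus>\<^bsub>N\<^esub> f y"
    and "\<And>r x. r \<in> carrier k \<Longrightarrow> x \<in> carrier M \<Longrightarrow> f (r \<odot>\<^bsub>M\<^esub> x) = r \<odot>\<^bsub>N\<^esub> f x"
  shows "f \<in> linear_maps k M N"
  using assms by (auto simp: linear_maps_def)

lemma linear_mapsD:
  assumes "f \<in> linear_maps k M N"
  shows "x \<in> carrier M \<Longrightarrow> f x \<in> carrier N"
    and "x \<in> carrier M \<Longrightarrow> y \<in> carrier M \<Longrightarrow> f (x \<oplus>\<^bsub>M\<^esub> y) = f x \<oplus>\<^bsub>N\<^esub> f y"
    and "r \<in> carrier k \<Longrightarrow> x \<in> carrier M \<Longrightarrow> f (r \<odot>\<^bsub>M\<^esub> x) = r \<odot>\<^bsub>N\<^esub> f x"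
  using assms by (auto simp: linear_maps_def)

text \<open>Comes from homogeneity with the scalar zero.\<close>

lemma linear_maps_zero:
  assumes "f \<in> linear_maps k M N" "module k M" "module k N"
  shows "f \<zero>\<^bsub>M\<^esub> = \<zero>\<^bsub>N\<^esub>"
proof -
  interpret M: module k M by fact
  interpret N: module k N by fact
  have "f (\<zero>\<^bsub>k\<^esub> \<odot>\<^bsub>M\<^esub> \<zero>\<^bsub>M\<^esub>) = \<zero>\<^bsub>k\<^esub> \<odot>\<^bsub>N\<^esub> f \<zero>\<^bsub>M\<^esub>"
    by (rule linear_mapsD(3)[OF assms(1)]) auto
  then show ?thesis
    using linear_mapsD(1)[OF assms(1)] by simp
qed

lemma linear_maps_minus:
  assumes "f \<in> linear_maps k M N" "module k M" "module k N" "x \<in> carrier M"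
  shows "f (\<ominus>\<^bsub>M\<^esub> x) = \<ominus>\<^bsub>N\<^esub> f x"
proof -
  interpret M: module k M by fact
  interpret N: module k N by fact
  have "f (\<ominus>\<^bsub>M\<^esub> x) \<oplus>\<^bsub>N\<^esub> f x = \<zero>\<^bsub>N\<^esub>"
    using linear_mapsD(2)[OF assms(1), of "\<ominus>\<^bsub>M\<^esub> x" x] assms(4)
    by (simp add: M.l_neg linear_maps_zero[OF assms(1-3)])
  then show ?thesis
    using N.minus_equality linear_mapsD(1)[OF assms(1)] assms(4) by (metis M.a_inv_closed)
qed

lemma linear_maps_finsum:
  assumes "f \<in> linear_maps k M N" "module k M" "module k N" "finite A" "g \<in> A \<rightarrow> carrier M"
  shows "f (finsum M g A) = finsum N (\<lambda>i. f (g i)) A"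
proof -
  interpret M: module k M by fact
  interpret N: module k N by fact
  show ?thesis
    using assms(4,5)
  proof (induction A)
    case empty
    then show ?case by (simp add: linear_maps_zero[OF assms(1-3)])
  next
    case (insert a A)
    then have "(\<lambda>i. f (g i)) \<in> A \<rightarrow> carrier N" "f (g a) \<in> carrier N"
      using linear_mapsD(1)[OF assms(1)] by auto
    then show ?case
      using insert linear_mapsD(2)[OF assms(1)] by (simp add: Pi_def)
  qed
qed

lemma linear_maps_compose:
  assumes "f \<in> linear_maps k M N" "g \<in> linear_maps k N P"
  shows "(\<lambda>x. g (f x)) \<in> linear_maps k M P"
  by (intro linear_mapsI) (simp_all add: linear_mapsD[OF assms(1)] linear_mapsD[OF assms(2)])

text \<open>Membership in \<open>linear_maps\<close> concerns values on the carrier only, and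
  closure of \<open>M\<close> under its operations makes every argument in the laws an element of
  the carrier.\<close>

lemma linear_maps_cong:
  assumes "f \<in> linear_maps k M N" "module k M" "\<And>x. x \<in> carrier M \<Longrightarrow> g x = f x"
  shows "g \<in> linear_maps k M N"
proof -
  interpret M: module k M by fact
  show ?thesis
    by (intro linear_mapsI) (simp_all add: assms(3) linear_mapsD[OF assms(1)])
qed

text \<open>Sums and scalar multiples of linear maps serve later to state additivity and homogeneity
  in one variable of the composition as equations between linear maps in the other variable.\<close>

lemma linear_maps_add:
  assumes "f \<in> linear_maps k M N" "g \<in> linear_maps k M N" "module k N"
  shows "(\<lambda>x. f x \<oplus>\<^bsub>N\<^esub> g x) \<in> linear_maps k M N"
proof -
  interpret N: module k N by fact
  show ?thesis
    using linear_mapsD[OF assms(1)] linear_mapsD[OF assms(2)]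
    by (intro linear_mapsI) (auto simp: N.smult_r_distr N.a_ac)
qed

text \<open>Commutativity of \<open>k\<close> enters here: \<open>r\<close> and the scalar of the
  argument have to change places.\<close>

lemma linear_maps_smult:
  assumes "f \<in> linear_maps k M N" "module k N" "r \<in> carrier k"
  shows "(\<lambda>x. r \<odot>\<^bsub>N\<^esub> f x) \<in> linear_maps k M N"
proof -
  interpret N: module k N by fact
  show ?thesis
    using linear_mapsD[OF assms(1)] \<open>r \<in> carrier k\<close>
    by (intro linear_mapsI) (auto simp: N.smult_r_distr N.smult_assoc1[symmetric] N.R.m_comm)
qed

lemma linear_maps_finsum_pointwise:
  assumes "module k M" "module k N" "finite A" "\<And>i. i \<in> A \<Longrightarrow> f i \<in> linear_maps k M N"
  shows "(\<lambda>x. finsum N (\<lambda>i. f i x) A) \<in> linear_maps k M N"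
  using assms(3,4)
proof (induction A)
  interpret M: module k M by fact
  interpret N: module k N by fact
  {
    case empty
    then show ?case by (intro linear_mapsI) auto
  next
    case (insert a A)
    have "(\<lambda>x. f a x \<oplus>\<^bsub>N\<^esub> finsum N (\<lambda>i. f i x) A) \<in> linear_maps k M N"
      using insert by (intro linear_maps_add assms(2)) auto
    then show ?case
    proof (rule linear_maps_cong[OF _ assms(1)])
      fix x assume "x \<in> carrier M"
      with insert linear_mapsD(1)[OF insert.prems]
      show "finsum N (\<lambda>i. f i x) (insert a A) = f a x \<oplus>\<^bsub>N\<^esub> finsum N (\<lambda>i. f i x) A"
        by (intro N.finsum_insert) auto
    qed
  }
qed

section \<open>Finite powers of a module\<close>

lemma module_power_simps:
  "carrier (module_power M n) = {..<n} \<rightarrow>\<^sub>E carrier M"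
  "i < n \<Longrightarrow> \<zero>\<^bsub>module_power M n\<^esub> i = \<zero>\<^bsub>M\<^esub>"
  "i < n \<Longrightarrow> (x \<oplus>\<^bsub>module_power M n\<^esub> y) i = x i \<oplus>\<^bsub>M\<^esub> y i"
  "i < n \<Longrightarrow> (r \<odot>\<^bsub>module_power M n\<^esub> x) i = r \<odot>\<^bsub>M\<^esub> x i"
  by (simp_all add: module_power_def)

lemma module_power_mem:
  "x \<in> carrier (module_power M n) \<Longrightarrow> i < n \<Longrightarrow> x i \<in> carrier M"
  by (auto simp: module_power_simps)

text \<open>Elements of the power are extensional functions, so the coordinates below
  \<open>n\<close> determine them. This reduces every law of the power to a law of
  \<open>M\<close>.\<close>

lemma module_power_eqI:
  assumes "x \<in> carrier (module_power M n)" "y \<in> carrier (module_power M n)"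
    and "\<And>i. i < n \<Longrightarrow> x i = y i"
  shows "x = y"
  using assms by (auto simp: module_power_simps intro: PiE_ext)

lemma module_module_power:
  assumes "module k M"
  shows "module k (module_power M n)"
proof -
  interpret M: module k M by fact
  let ?P = "module_power M n"
  note mem = module_power_mem[of _ M n]
  have closed [intro]: "\<zero>\<^bsub>?P\<^esub> \<in> carrier ?P"
      "x \<in> carrier ?P \<Longrightarrow> y \<in> carrier ?P \<Longrightarrow> x \<oplus>\<^bsub>?P\<^esub> y \<in> carrier ?P"
      "r \<in> carrier k \<Longrightarrow> x \<in> carrier ?P \<Longrightarrow> r \<odot>\<^bsub>?P\<^esub> x \<in> carrier ?P" for r x y
    by (auto simp: module_power_def)
  show ?thesis
  proof (intro moduleI abelian_groupI)
    fix x assume x: "x \<in> carrier ?P"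
    define y where "y = (\<lambda>i\<in>{..<n}. \<ominus>\<^bsub>M\<^esub> x i)"
    have y: "y \<in> carrier ?P"
      using x by (auto simp: module_power_simps y_def)
    have "y \<oplus>\<^bsub>?P\<^esub> x = \<zero>\<^bsub>?P\<^esub>"
      using x y by (intro module_power_eqI closed)
        (auto simp: module_power_simps(2-) y_def M.l_neg mem)
    with y show "\<exists>y\<in>carrier ?P. y \<oplus>\<^bsub>?P\<^esub> x = \<zero>\<^bsub>?P\<^esub>" by blast
  next
    show "cring k" by (rule module.axioms(1)[OF assms])
  qed (auto intro!: module_power_eqI simp: module_power_simps(2-) mem M.a_ac M.smult_l_distr
      M.smult_r_distr M.smult_assoc1)
qed

section \<open>Direct summands of linear functors\<close>

lemma linear_functorD:
  assumes "linear_functor k D F" "X \<in> Ob D"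
  shows "module k (FOb F X)"
    and "Y \<in> Ob D \<Longrightarrow> f \<in> carrier (Hom D X Y) \<Longrightarrow> FArr F X Y f \<in> linear_maps k (FOb F X) (FOb F Y)"
    and "Y \<in> Ob D \<Longrightarrow> f \<in> carrier (Hom D X Y) \<Longrightarrow> g \<in> carrier (Hom D X Y) \<Longrightarrow> x \<in> carrier (FOb F X) \<Longrightarrow>
      FArr F X Y (f \<oplus>\<^bsub>Hom D X Y\<^esub> g) x = FArr F X Y f x \<oplus>\<^bsub>FOb F Y\<^esub> FArr F X Y g x"
    and "Y \<in> Ob D \<Longrightarrow> r \<in> carrier k \<Longrightarrow> f \<in> carrier (Hom D X Y) \<Longrightarrow> x \<in> carrier (FOb F X) \<Longrightarrow>
      FArr F X Y (r \<odot>\<^bsub>Hom D X Y\<^esub> f) x = r \<odot>\<^bsub>FOb F Y\<^esub> FArr F X Y f x"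
    and "x \<in> carrier (FOb F X) \<Longrightarrow> FArr F X X (Ident D X) x = x"
    and "Y \<in> Ob D \<Longrightarrow> Z \<in> Ob D \<Longrightarrow> f \<in> carrier (Hom D X Y) \<Longrightarrow> g \<in> carrier (Hom D Y Z) \<Longrightarrow>
      x \<in> carrier (FOb F X) \<Longrightarrow> FArr F X Z (Comp D X Y Z g f) x = FArr F Y Z g (FArr F X Y f x)"
  using assms unfolding linear_functor_def by simp_all

lemma natural_transformationsD:
  assumes "\<eta> \<in> natural_transformations k D F E" "X \<in> Ob D"
  shows "\<eta> X \<in> linear_maps k (FOb F X) (FOb E X)"
    and "Y \<in> Ob D \<Longrightarrow> f \<in> carrier (Hom D X Y) \<Longrightarrow> x \<in> carrier (FOb F X) \<Longrightarrow>
      \<eta> Y (FArr F X Y f x) = FArr E X Y f (\<eta> X x)"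
  using assms unfolding natural_transformations_def by simp_all

lemma module_sum_simps:
  "carrier (module_sum M N) = carrier M \<times> carrier N"
  "\<zero>\<^bsub>module_sum M N\<^esub> = (\<zero>\<^bsub>M\<^esub>, \<zero>\<^bsub>N\<^esub>)"
  "(x, y) \<oplus>\<^bsub>module_sum M N\<^esub> (x', y') = (x \<oplus>\<^bsub>M\<^esub> x', y \<oplus>\<^bsub>N\<^esub> y')"
  "r \<odot>\<^bsub>module_sum M N\<^esub> (x, y) = (r \<odot>\<^bsub>M\<^esub> x, r \<odot>\<^bsub>N\<^esub> y)"
  by (simp_all add: module_sum_def)

lemma submodule_linear_kernel:
  assumes "f \<in> linear_maps k M N" "module k M" "module k N"
  shows "submodule {x \<in> carrier M. f x = \<zero>\<^bsub>N\<^esub>} k M"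
proof -
  interpret M: module k M by fact
  interpret N: module k N by fact
  show ?thesis
    using linear_mapsD[OF assms(1)]
    by (intro M.submoduleI)
      (auto simp: linear_maps_zero[OF assms] linear_maps_minus[OF assms])
qed

text \<open>Every \<open>e\<close> splits as \<open>\<sigma> (\<pi> e)\<close> plus a remainder
  killed by \<open>\<pi>\<close>, and \<open>\<sigma> x + c\<close> with \<open>c\<close> in the
  kernel has the parts \<open>x\<close> and \<open>c\<close> because
  \<open>\<pi> (\<sigma> x) = x\<close>.\<close>

lemma direct_summandI:
  fixes F :: "('o, 'k, 'm, 'v) lin_functor" and E :: "('o, 'k, 'm, 'w) lin_functor"
  assumes F: "linear_functor k D F" and E: "linear_functor k D E"
    and \<sigma>: "\<sigma> \<in> natural_transformations k D F E"
    and \<pi>: "\<pi> \<in> natural_transformations k D E F"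
    and id: "\<And>X x. X \<in> Ob D \<Longrightarrow> x \<in> carrier (FOb F X) \<Longrightarrow> \<pi> X (\<sigma> X x) = x"
  shows "direct_summand k D F E"
proof -
  note Fm = linear_functorD(1)[OF F] and Em = linear_functorD(1)[OF E]
  note \<sigma>l = natural_transformationsD(1)[OF \<sigma>] and \<pi>l = natural_transformationsD(1)[OF \<pi>]
  note \<sigma>n = natural_transformationsD(2)[OF \<sigma>] and \<pi>n = natural_transformationsD(2)[OF \<pi>]
  note \<sigma>D = linear_mapsD[OF \<sigma>l] and \<pi>D = linear_mapsD[OF \<pi>l]
  note EA = linear_functorD(2)[OF E]
  define K where "K X = {x \<in> carrier (FOb E X). \<pi> X x = \<zero>\<^bsub>FOb F X\<^esub>}" for X
  \<comment> \<open>Only the carrier is cut down, so sums, scalars and arrows are those of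
    \<open>E\<close>. In particular the complement keeps the element type of \<open>E\<close> that
    \<open>direct_summand\<close> prescribes.\<close>
  define C where "C = \<lparr>FOb = (\<lambda>X. (FOb E X)\<lparr>carrier := K X\<rparr>), FArr = FArr E\<rparr>"
  have C_simps: "carrier (FOb C X) = K X" "add (FOb C X) = add (FOb E X)"
    "smult (FOb C X) = smult (FOb E X)" "FArr C = FArr E" for X
    by (simp_all add: C_def)
  have Cm: "module k (FOb C X)" if "X \<in> Ob D" for X
    using submodule.submodule_is_module[OF submodule_linear_kernel[OF \<pi>l[OF that] Em Fm] Em] that
    by (simp add: C_def K_def)
  have KE: "x \<in> carrier (FOb E X)" if "x \<in> K X" for x X
    using that by (simp add: K_def)
  \<comment> \<open>Naturality of \<open>\<pi>\<close>, together with the arrows of \<open>F\<close>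
    preserving zero, makes the kernels stable under arrows.\<close>
  have KA: "FArr E X Y f x \<in> K Y"
    if "X \<in> Ob D" "Y \<in> Ob D" "f \<in> carrier (Hom D X Y)" "x \<in> K X" for X Y f x
    using that linear_mapsD(1)[OF EA[of X Y f]] \<pi>n[of X Y f x]
      linear_maps_zero[OF linear_functorD(2)[OF F, of X Y f] Fm Fm]
    by (simp add: K_def)
  have C: "linear_functor k D C"
    unfolding linear_functor_def C_simps
    by (auto simp: Cm KA KE C_simps linear_functorD[OF E] linear_mapsD(2,3)[OF EA] intro!: linear_mapsI)
  define \<eta> where "\<eta> X e = (\<pi> X e, e \<ominus>\<^bsub>FOb E X\<^esub> \<sigma> X (\<pi> X e))" for X e
  define \<theta> where "\<theta> X = (\<lambda>(x, c). \<sigma> X x \<oplus>\<^bsub>FOb E X\<^esub> c)" for X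
  have \<eta>l: "\<eta> X \<in> linear_maps k (FOb E X) (FOb (functor_sum F C) X)" if X: "X \<in> Ob D" for X
  proof -
    interpret EX: module k "FOb E X" using Em X .
    interpret FX: module k "FOb F X" using Fm X .
    have neg: "\<sigma> X (\<ominus>\<^bsub>FOb F X\<^esub> x) = \<ominus>\<^bsub>FOb E X\<^esub> \<sigma> X x" if "x \<in> carrier (FOb F X)" for x
      using linear_maps_minus[OF \<sigma>l[OF X] Fm[OF X] Em[OF X] that] .
    have negp: "\<pi> X (\<ominus>\<^bsub>FOb E X\<^esub> x) = \<ominus>\<^bsub>FOb F X\<^esub> \<pi> X x" if "x \<in> carrier (FOb E X)" for x
      using linear_maps_minus[OF \<pi>l[OF X] Em[OF X] Fm[OF X] that] .
    show ?thesis
    proof (rule linear_mapsI)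
      fix x assume "x \<in> carrier (FOb E X)"
      \<comment> \<open>The second component lies in the kernel: \<open>\<pi>\<close> maps it to
        \<open>\<pi> x - \<pi> (\<sigma> (\<pi> x))\<close>, which is zero by
        \<open>id\<close>.\<close>
      then show "\<eta> X x \<in> carrier (FOb (functor_sum F C) X)"
        by (auto simp: functor_sum_def module_sum_simps \<eta>_def C_simps K_def EX.minus_eq X
            \<sigma>D \<pi>D negp id FX.r_neg)
    next
      fix x y assume "x \<in> carrier (FOb E X)" "y \<in> carrier (FOb E X)"
      then show "\<eta> X (x \<oplus>\<^bsub>FOb E X\<^esub> y) = \<eta> X x \<oplus>\<^bsub>FOb (functor_sum F C) X\<^esub> \<eta> X y"
        by (simp add: functor_sum_def module_sum_simps \<eta>_def C_simps EX.minus_eq X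
            \<sigma>D \<pi>D EX.minus_add EX.a_ac)
    next
      fix r x assume "r \<in> carrier k" "x \<in> carrier (FOb E X)"
      then show "\<eta> X (r \<odot>\<^bsub>FOb E X\<^esub> x) = r \<odot>\<^bsub>FOb (functor_sum F C) X\<^esub> \<eta> X x"
        by (simp add: functor_sum_def module_sum_simps \<eta>_def C_simps EX.minus_eq X
            \<sigma>D \<pi>D EX.smult_r_minus EX.smult_r_distr)
    qed
  qed
  have \<theta>l: "\<theta> X \<in> linear_maps k (FOb (functor_sum F C) X) (FOb E X)" if X: "X \<in> Ob D" for X
  proof -
    interpret EX: module k "FOb E X" using Em X .
    show ?thesis
      by (rule linear_mapsI)
        (auto simp: functor_sum_def module_sum_simps C_simps \<theta>_def X \<sigma>D KE EX.a_ac EX.smult_r_distr)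
  qed
  have \<eta>: "\<eta> \<in> natural_transformations k D E (functor_sum F C)"
    unfolding natural_transformations_def
  proof (intro CollectI conjI ballI \<eta>l)
    fix X Y f e assume *: "X \<in> Ob D" "Y \<in> Ob D" "f \<in> carrier (Hom D X Y)" "e \<in> carrier (FOb E X)"
    interpret EX: module k "FOb E X" using Em * by blast
    interpret EY: module k "FOb E Y" using Em * by blast
    note fE = EA[OF *(1-3)]
    have p: "\<pi> X e \<in> carrier (FOb F X)" "\<sigma> X (\<pi> X e) \<in> carrier (FOb E X)"
      using * by (simp_all add: \<pi>D \<sigma>D)
    have "FArr E X Y f (e \<ominus>\<^bsub>FOb E X\<^esub> \<sigma> X (\<pi> X e)) =
       FArr E X Y f e \<ominus>\<^bsub>FOb E Y\<^esub> FArr E X Y f (\<sigma> X (\<pi> X e))"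
      using * p linear_maps_minus[OF fE EX.module_axioms EY.module_axioms p(2)]
      by (simp add: EX.minus_eq EY.minus_eq linear_mapsD(2)[OF fE])
    then show "\<eta> Y (FArr E X Y f e) = FArr (functor_sum F C) X Y f (\<eta> X e)"
      using * p by (simp add: \<eta>_def functor_sum_def C_simps \<pi>n \<sigma>n)
  qed
  have \<theta>: "\<theta> \<in> natural_transformations k D (functor_sum F C) E"
    unfolding natural_transformations_def
  proof (intro CollectI conjI ballI \<theta>l)
    fix X Y f x assume *: "X \<in> Ob D" "Y \<in> Ob D" "f \<in> carrier (Hom D X Y)"
      "x \<in> carrier (FOb (functor_sum F C) X)"
    obtain a c where x: "x = (a, c)" by fastforce
    with * have "a \<in> carrier (FOb F X)" "c \<in> K X"
      by (auto simp: functor_sum_def module_sum_simps C_simps)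
    then show "\<theta> Y (FArr (functor_sum F C) X Y f x) = FArr E X Y f (\<theta> X x)"
      using * by (simp add: x functor_sum_def \<theta>_def C_simps \<sigma>n KE \<sigma>D(1) linear_mapsD(2)[OF EA])
  qed
  have "functor_isomorphic k D E (functor_sum F C)"
    unfolding functor_isomorphic_def
  proof (intro bexI[OF _ \<eta>] bexI[OF _ \<theta>] ballI conjI)
    fix X e assume X: "X \<in> Ob D" and e: "e \<in> carrier (FOb E X)"
    interpret EX: module k "FOb E X" using Em X .
    from X e show "\<theta> X (\<eta> X e) = e"
      by (simp add: \<theta>_def \<eta>_def EX.minus_eq \<sigma>D \<pi>D EX.a_ac EX.r_neg)
  next
    fix X x assume X: "X \<in> Ob D" and mem: "x \<in> carrier (FOb (functor_sum F C) X)"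
    interpret EX: module k "FOb E X" using Em X .
    interpret FX: module k "FOb F X" using Fm X .
    obtain a c where x: "x = (a, c)" by fastforce
    with X mem have *: "a \<in> carrier (FOb F X)" "c \<in> carrier (FOb E X)" "\<pi> X c = \<zero>\<^bsub>FOb F X\<^esub>"
      by (auto simp: functor_sum_def module_sum_simps C_simps K_def)
    then have "\<pi> X (\<sigma> X a \<oplus>\<^bsub>FOb E X\<^esub> c) = a"
      using X by (simp add: \<pi>D \<sigma>D id)
    with * X show "\<eta> X (\<theta> X x) = x"
      by (simp add: x \<theta>_def \<eta>_def EX.minus_eq \<sigma>D EX.a_ac EX.r_neg)
  qed
  with C show ?thesis
    unfolding direct_summand_def by blast
qed

text \<open>The section is the inclusion of the first factor followed by the isomorphism
  \<open>\<theta>\<close> onto \<open>E\<close>; the retraction is \<open>\<eta>\<close> followed by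
  the first projection.\<close>

lemma direct_summandD:
  fixes F :: "('o, 'k, 'm, 'v) lin_functor" and E :: "('o, 'k, 'm, 'w) lin_functor"
  assumes "direct_summand k D F E" "linear_functor k D F"
  obtains \<sigma> \<pi> where "\<sigma> \<in> natural_transformations k D F E" "\<pi> \<in> natural_transformations k D E F"
    "\<And>X x. X \<in> Ob D \<Longrightarrow> x \<in> carrier (FOb F X) \<Longrightarrow> \<pi> X (\<sigma> X x) = x"
proof -
  from assms(1) obtain C :: "('o, 'k, 'm, 'w) lin_functor"
    where C: "linear_functor k D C" and "functor_isomorphic k D E (functor_sum F C)"
    unfolding direct_summand_def by blast
  then obtain \<eta> \<theta> where \<eta>: "\<eta> \<in> natural_transformations k D E (functor_sum F C)"
    and \<theta>: "\<theta> \<in> natural_transformations k D (functor_sum F C) E"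
    and inv: "\<And>X y. X \<in> Ob D \<Longrightarrow> y \<in> carrier (FOb (functor_sum F C) X) \<Longrightarrow> \<eta> X (\<theta> X y) = y"
    unfolding functor_isomorphic_def by metis
  note Fm = linear_functorD(1)[OF assms(2)] and Cm = linear_functorD(1)[OF C]
  have mem: "(x, \<zero>\<^bsub>FOb C X\<^esub>) \<in> carrier (FOb (functor_sum F C) X)"
    if "X \<in> Ob D" "x \<in> carrier (FOb F X)" for X x
  proof -
    interpret CX: module k "FOb C X" using Cm that(1) .
    show ?thesis using that by (simp add: functor_sum_def module_sum_simps)
  qed
  show thesis
  proof
    show "(\<lambda>X x. \<theta> X (x, \<zero>\<^bsub>FOb C X\<^esub>)) \<in> natural_transformations k D F E"
      unfolding natural_transformations_def
    proof (intro CollectI conjI ballI)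
      fix X assume X: "X \<in> Ob D"
      interpret CX: module k "FOb C X" using Cm X .
      have "(\<lambda>x. (x, \<zero>\<^bsub>FOb C X\<^esub>)) \<in> linear_maps k (FOb F X) (FOb (functor_sum F C) X)"
        using X mem by (intro linear_mapsI) (auto simp: functor_sum_def module_sum_simps)
      then show "(\<lambda>x. \<theta> X (x, \<zero>\<^bsub>FOb C X\<^esub>)) \<in> linear_maps k (FOb F X) (FOb E X)"
        using natural_transformationsD(1)[OF \<theta> X] by (rule linear_maps_compose)
    next
      fix X Y f x assume *: "X \<in> Ob D" "Y \<in> Ob D" "f \<in> carrier (Hom D X Y)" "x \<in> carrier (FOb F X)"
      \<comment> \<open>Arrows of \<open>C\<close> are linear and so preserve zero, which makes the
        inclusion of the first factor natural.\<close>
      have "FArr C X Y f \<zero>\<^bsub>FOb C X\<^esub> = \<zero>\<^bsub>FOb C Y\<^esub>"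
        using linear_maps_zero[OF linear_functorD(2)[OF C *(1-3)] Cm Cm] * by blast
      then show "\<theta> Y (FArr F X Y f x, \<zero>\<^bsub>FOb C Y\<^esub>) = FArr E X Y f (\<theta> X (x, \<zero>\<^bsub>FOb C X\<^esub>))"
        using natural_transformationsD(2)[OF \<theta> *(1-3) mem[OF *(1,4)]] by (simp add: functor_sum_def)
    qed
    show "(\<lambda>X e. fst (\<eta> X e)) \<in> natural_transformations k D E F"
      unfolding natural_transformations_def
    proof (intro CollectI conjI ballI)
      fix X assume X: "X \<in> Ob D"
      have "fst \<in> linear_maps k (FOb (functor_sum F C) X) (FOb F X)"
        by (intro linear_mapsI) (auto simp: functor_sum_def module_sum_simps)
      then show "(\<lambda>e. fst (\<eta> X e)) \<in> linear_maps k (FOb E X) (FOb F X)"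
        using linear_maps_compose[OF natural_transformationsD(1)[OF \<eta> X]] by blast
    next
      fix X Y f x assume *: "X \<in> Ob D" "Y \<in> Ob D" "f \<in> carrier (Hom D X Y)" "x \<in> carrier (FOb E X)"
      then show "fst (\<eta> Y (FArr E X Y f x)) = FArr F X Y f (fst (\<eta> X x))"
        by (simp add: natural_transformationsD(2)[OF \<eta>]) (simp add: functor_sum_def)
    qed
    show "fst (\<eta> X (\<theta> X (x, \<zero>\<^bsub>FOb C X\<^esub>))) = x" if "X \<in> Ob D" "x \<in> carrier (FOb F X)" for X x
      using that inv mem by simp
  qed
qed

section \<open>Linear categories\<close>

lemma linear_combinationsE:
  assumes "v \<in> linear_combinations k M S"
  obtains n :: nat and c x where "v = finsum M (\<lambda>i. c i \<odot>\<^bsub>M\<^esub> x i) {..<n}"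
    "c \<in> {..<n} \<rightarrow> carrier k" "x \<in> {..<n} \<rightarrow> S"
  using assms unfolding linear_combinations_def by blast

text \<open>\<open>lin_cat\<close> is bare data; these laws make it a \<open>k\<close>-linear
  category. The Yoneda argument is carried out at this level, where no biset occurs.\<close>

locale linear_category =
  fixes k :: "'k ring" and D :: "('o, 'k, 'm) lin_cat"
  assumes Hom_module: "X \<in> Ob D \<Longrightarrow> Y \<in> Ob D \<Longrightarrow> module k (Hom D X Y)"
    and Comp_linear_right: "X \<in> Ob D \<Longrightarrow> Y \<in> Ob D \<Longrightarrow> Z \<in> Ob D \<Longrightarrow> g \<in> carrier (Hom D Y Z) \<Longrightarrow>
      Comp D X Y Z g \<in> linear_maps k (Hom D X Y) (Hom D X Z)"
    and Comp_linear_left: "X \<in> Ob D \<Longrightarrow> Y \<in> Ob D \<Longrightarrow> Z \<in> Ob D \<Longrightarrow> f \<in> carrier (Hom D X Y) \<Longrightarrow>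
      (\<lambda>g. Comp D X Y Z g f) \<in> linear_maps k (Hom D Y Z) (Hom D X Z)"
    and Comp_assoc: "X \<in> Ob D \<Longrightarrow> Y \<in> Ob D \<Longrightarrow> Z \<in> Ob D \<Longrightarrow> W \<in> Ob D \<Longrightarrow>
      f \<in> carrier (Hom D X Y) \<Longrightarrow> g \<in> carrier (Hom D Y Z) \<Longrightarrow> h \<in> carrier (Hom D Z W) \<Longrightarrow>
      Comp D X Y W (Comp D Y Z W h g) f = Comp D X Z W h (Comp D X Y Z g f)"
    and Ident_closed: "X \<in> Ob D \<Longrightarrow> Ident D X \<in> carrier (Hom D X X)"
    and Ident_left: "X \<in> Ob D \<Longrightarrow> Y \<in> Ob D \<Longrightarrow> f \<in> carrier (Hom D X Y) \<Longrightarrow> Comp D X Y Y (Ident D Y) f = f"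
    and Ident_right: "X \<in> Ob D \<Longrightarrow> Y \<in> Ob D \<Longrightarrow> f \<in> carrier (Hom D X Y) \<Longrightarrow> Comp D X X Y f (Ident D X) = f"
begin

lemma Comp_closed:
  "X \<in> Ob D \<Longrightarrow> Y \<in> Ob D \<Longrightarrow> Z \<in> Ob D \<Longrightarrow> f \<in> carrier (Hom D X Y) \<Longrightarrow> g \<in> carrier (Hom D Y Z) \<Longrightarrow>
    Comp D X Y Z g f \<in> carrier (Hom D X Z)"
  using linear_mapsD(1)[OF Comp_linear_right] .

text \<open>Functoriality is associativity together with the left unit law; linearity in the arrow
  is \<open>Comp_linear_left\<close>.\<close>

lemma linear_functor_yoneda:
  assumes "G \<in> Ob D"
  shows "linear_functor k D (yoneda D G)"
  using assms unfolding linear_functor_def yoneda_def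
  by (auto simp: Hom_module Comp_linear_right linear_mapsD(2,3)[OF Comp_linear_left] Ident_left
      Comp_assoc)

lemma linear_functor_power:
  assumes F: "linear_functor k D F"
  shows "linear_functor k D (functor_power F n)"
proof -
  note FA = linear_mapsD[OF linear_functorD(2)[OF F]]
  let ?P = "functor_power F n"
  have P_simps: "FOb ?P X = module_power (FOb F X) n" for X
    by (simp add: functor_power_def)
  have P_arr: "FArr ?P X Y f x i = FArr F X Y f (x i)" if "i < n" for X Y f x i
    using that by (simp add: functor_power_def)
  have P_closed: "FArr ?P X Y f x \<in> carrier (FOb ?P Y)"
    if "X \<in> Ob D" "Y \<in> Ob D" "f \<in> carrier (Hom D X Y)" "x \<in> carrier (FOb ?P X)" for X Y f x
    using that FA(1) by (auto simp: functor_power_def module_power_simps PiE_iff)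
  have Pm: "module k (FOb ?P X)" if "X \<in> Ob D" for X
    unfolding P_simps by (intro module_module_power linear_functorD(1)[OF F] that)
  have add: "x \<oplus>\<^bsub>FOb ?P X\<^esub> y \<in> carrier (FOb ?P X)"
    if "X \<in> Ob D" "x \<in> carrier (FOb ?P X)" "y \<in> carrier (FOb ?P X)" for X x y
  proof -
    interpret P: module k "FOb ?P X" using Pm that(1) .
    show ?thesis using that by blast
  qed
  have smult: "r \<odot>\<^bsub>FOb ?P X\<^esub> x \<in> carrier (FOb ?P X)"
    if "X \<in> Ob D" "x \<in> carrier (FOb ?P X)" "r \<in> carrier k" for X x r
  proof -
    interpret P: module k "FOb ?P X" using Pm that(1) .
    show ?thesis using that by blast
  qed
  \<comment> \<open>The facts on module powers are restated for \<open>FOb ?P\<close>, so that each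
    law below becomes a law of \<open>F\<close> in one coordinate.\<close>
  note eqI = module_power_eqI[of _ "FOb F Y" n for Y, folded P_simps]
  note mem = module_power_mem[of _ "FOb F Y" n for Y, folded P_simps]
  note ops = module_power_simps(2-)[of _ n "FOb F Y" for Y, folded P_simps]
  have lin: "FArr ?P X Y f \<in> linear_maps k (FOb ?P X) (FOb ?P Y)"
    if "X \<in> Ob D" "Y \<in> Ob D" "f \<in> carrier (Hom D X Y)" for X Y f
    using that by (intro linear_mapsI eqI) (auto simp: P_arr ops FA mem intro!: P_closed add smult)
  show ?thesis
    unfolding linear_functor_def
  proof (intro conjI ballI Pm lin)
    fix X Y f g x assume *: "X \<in> Ob D" "Y \<in> Ob D" "f \<in> carrier (Hom D X Y)"
      "g \<in> carrier (Hom D X Y)" "x \<in> carrier (FOb ?P X)"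
    interpret H: module k "Hom D X Y" using Hom_module * by blast
    show "FArr ?P X Y (f \<oplus>\<^bsub>Hom D X Y\<^esub> g) x = FArr ?P X Y f x \<oplus>\<^bsub>FOb ?P Y\<^esub> FArr ?P X Y g x"
      using * by (intro eqI) (auto simp: P_arr ops mem linear_functorD(3)[OF F] intro!: P_closed add)
  next
    fix X Y r f x assume *: "X \<in> Ob D" "Y \<in> Ob D" "r \<in> carrier k" "f \<in> carrier (Hom D X Y)"
      "x \<in> carrier (FOb ?P X)"
    interpret H: module k "Hom D X Y" using Hom_module * by blast
    show "FArr ?P X Y (r \<odot>\<^bsub>Hom D X Y\<^esub> f) x = r \<odot>\<^bsub>FOb ?P Y\<^esub> FArr ?P X Y f x"
      using * by (intro eqI) (auto simp: P_arr ops mem linear_functorD(4)[OF F] intro!: P_closed smult)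
  next
    fix X x assume *: "X \<in> Ob D" "x \<in> carrier (FOb ?P X)"
    then show "FArr ?P X X (Ident D X) x = x"
      by (intro eqI) (auto simp: P_arr mem linear_functorD(5)[OF F] Ident_closed intro!: P_closed)
  next
    fix X Y Z f g x assume *: "X \<in> Ob D" "Y \<in> Ob D" "Z \<in> Ob D" "f \<in> carrier (Hom D X Y)"
      "g \<in> carrier (Hom D Y Z)" "x \<in> carrier (FOb ?P X)"
    then show "FArr ?P X Z (Comp D X Y Z g f) x = FArr ?P Y Z g (FArr ?P X Y f x)"
      by (intro eqI) (auto simp: P_arr mem linear_functorD(6)[OF F] Comp_closed intro!: P_closed)
  qed
qed

text \<open>The common ground of the two sides of the equivalence. The length \<open>n\<close> is an
  argument because it becomes the exponent of the power of \<open>yoneda D G\<close>. Length 0 is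
  allowed and means that the identity of \<open>H\<close> is zero.\<close>

definition identity_factors :: "'o \<Rightarrow> 'o \<Rightarrow> nat \<Rightarrow> (nat \<Rightarrow> 'm) \<Rightarrow> (nat \<Rightarrow> 'm) \<Rightarrow> bool" where
  "identity_factors H G n U W \<longleftrightarrow> U \<in> {..<n} \<rightarrow> carrier (Hom D G H) \<and> W \<in> {..<n} \<rightarrow> carrier (Hom D H G) \<and>
     finsum (Hom D H H) (\<lambda>i. Comp D H G H (U i) (W i)) {..<n} = Ident D H"

text \<open>By associativity and linearity, \<open>\<pi>\<close> after \<open>\<sigma>\<close> is
  precomposition with the sum of all \<open>Comp D H G H (U i) (W i)\<close>, that is, with the
  identity of \<open>H\<close>.\<close>

lemma direct_summand_if_identity_factors:
  assumes G: "G \<in> Ob D" and H: "H \<in> Ob D" and "identity_factors H G n U W"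
  shows "direct_summand k D (yoneda D H) (functor_power (yoneda D G) n)"
proof -
  let ?F = "yoneda D H" and ?E = "functor_power (yoneda D G) n"
  have U: "U i \<in> carrier (Hom D G H)" and W: "W i \<in> carrier (Hom D H G)" if "i < n" for i
    using assms(3) that unfolding identity_factors_def by auto
  have E_simps: "carrier (FOb ?E X) = {..<n} \<rightarrow>\<^sub>E carrier (Hom D G X)" for X
    by (simp add: functor_power_def yoneda_def module_power_simps)
  have Em: "module k (FOb ?E X)" if "X \<in> Ob D" for X
    using linear_functorD(1)[OF linear_functor_power[OF linear_functor_yoneda[OF G]] that] .
  define \<sigma> where "\<sigma> X x = (\<lambda>i\<in>{..<n}. Comp D G H X x (U i))" for X x
  define \<pi> where "\<pi> X y = finsum (Hom D H X) (\<lambda>i. Comp D H G X (y i) (W i)) {..<n}" for X y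
  \<comment> \<open>A finite sum of linear maps, each a coordinate projection followed by
    precomposition with \<open>W i\<close>.\<close>
  have \<pi>l: "\<pi> X \<in> linear_maps k (FOb ?E X) (Hom D H X)" if X: "X \<in> Ob D" for X
    unfolding \<pi>_def
  proof (intro linear_maps_finsum_pointwise Em X Hom_module H)
    fix i assume "i \<in> {..<n}"
    then have "(\<lambda>y. y i) \<in> linear_maps k (FOb ?E X) (Hom D G X)"
      by (intro linear_mapsI) (auto simp: functor_power_def yoneda_def module_power_simps)
    then show "(\<lambda>y. Comp D H G X (y i) (W i)) \<in> linear_maps k (FOb ?E X) (Hom D H X)"
      using \<open>i \<in> {..<n}\<close> G H X by (intro linear_maps_compose[OF _ Comp_linear_left] W) auto
  qed auto
  show ?thesis
  proof (rule direct_summandI)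
    show "\<sigma> \<in> natural_transformations k D ?F ?E"
      unfolding natural_transformations_def
    proof (intro CollectI conjI ballI)
      fix X assume X: "X \<in> Ob D"
      interpret E: module k "FOb ?E X" using Em X .
      have \<sigma>_mem: "\<sigma> X x \<in> carrier (FOb ?E X)" if "x \<in> carrier (Hom D H X)" for x
        using that G H X by (auto simp: E_simps \<sigma>_def Comp_closed U)
      have Y: "FOb (yoneda D G) X = Hom D G X" "FOb ?F X = Hom D H X" "FOb ?E X = module_power (Hom D G X) n"
        by (simp_all add: yoneda_def functor_power_def)
      interpret HX: module k "Hom D H X" using Hom_module H X .
      have \<sigma>_i: "\<sigma> X x i = Comp D G H X x (U i)" if "i < n" for x i
        using that by (simp add: \<sigma>_def)
      note L = linear_mapsD[OF Comp_linear_left[OF G H X U]]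
      show "\<sigma> X \<in> linear_maps k (FOb ?F X) (FOb ?E X)"
      proof (rule linear_mapsI)
        fix x y assume "x \<in> carrier (FOb ?F X)" "y \<in> carrier (FOb ?F X)"
        then show "\<sigma> X (x \<oplus>\<^bsub>FOb ?F X\<^esub> y) = \<sigma> X x \<oplus>\<^bsub>FOb ?E X\<^esub> \<sigma> X y"
          using E.add.m_closed[OF \<sigma>_mem \<sigma>_mem] \<sigma>_mem[of "x \<oplus>\<^bsub>FOb ?F X\<^esub> y"] unfolding Y
          by (intro module_power_eqI) (auto simp: \<sigma>_i module_power_simps(2-) L)
      next
        fix r x assume "r \<in> carrier k" "x \<in> carrier (FOb ?F X)"
        then show "\<sigma> X (r \<odot>\<^bsub>FOb ?F X\<^esub> x) = r \<odot>\<^bsub>FOb ?E X\<^esub> \<sigma> X x"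
          using E.smult_closed[OF _ \<sigma>_mem] \<sigma>_mem[of "r \<odot>\<^bsub>FOb ?F X\<^esub> x"] unfolding Y
          by (intro module_power_eqI) (auto simp: \<sigma>_i module_power_simps(2-) L)
      qed (use \<sigma>_mem in \<open>simp add: Y\<close>)
    next
      fix X Y f x assume *: "X \<in> Ob D" "Y \<in> Ob D" "f \<in> carrier (Hom D X Y)" "x \<in> carrier (FOb ?F X)"
      then show "\<sigma> Y (FArr ?F X Y f x) = FArr ?E X Y f (\<sigma> X x)"
        using G H by (auto simp: \<sigma>_def functor_power_def yoneda_def Comp_assoc U intro!: restrict_ext)
    qed
    show "\<pi> \<in> natural_transformations k D ?E ?F"
      unfolding natural_transformations_def
    proof (intro CollectI conjI ballI)
      show "\<pi> X \<in> linear_maps k (FOb ?E X) (FOb ?F X)" if "X \<in> Ob D" for X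
        using \<pi>l[OF that] by (simp add: yoneda_def)
      fix X Y f y assume *: "X \<in> Ob D" "Y \<in> Ob D" "f \<in> carrier (Hom D X Y)" "y \<in> carrier (FOb ?E X)"
      interpret HY: module k "Hom D H Y" using Hom_module H *(2) .
      have y: "y i \<in> carrier (Hom D G X)" if "i < n" for i
        using *(4) that by (auto simp: E_simps)
      \<comment> \<open>For naturality, \<open>f\<close> enters the sum by linearity and then
        reaches \<open>y i\<close> by associativity.\<close>
      have "Comp D H X Y f (\<pi> X y) = finsum (Hom D H Y) (\<lambda>i. Comp D H X Y f (Comp D H G X (y i) (W i))) {..<n}"
        unfolding \<pi>_def using * G H W y
        by (intro linear_maps_finsum[OF Comp_linear_right] Hom_module) (auto intro!: Comp_closed)
      also have "\<dots> = finsum (Hom D H Y) (\<lambda>i. Comp D H G Y (Comp D G X Y f (y i)) (W i)) {..<n}"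
        using * G H W y by (intro HY.finsum_cong') (auto simp: Comp_assoc intro!: Comp_closed)
      also have "\<dots> = \<pi> Y (FArr ?E X Y f y)"
        unfolding \<pi>_def using * G H W y
        by (intro HY.finsum_cong') (auto simp: functor_power_def yoneda_def intro!: Comp_closed)
      finally show "\<pi> Y (FArr ?E X Y f y) = FArr ?F X Y f (\<pi> X y)"
        by (simp add: yoneda_def)
    qed
    fix X x assume X: "X \<in> Ob D" and "x \<in> carrier (FOb ?F X)"
    then have x: "x \<in> carrier (Hom D H X)" by (simp add: yoneda_def)
    interpret HX: module k "Hom D H X" using Hom_module H X .
    have "\<pi> X (\<sigma> X x) = finsum (Hom D H X) (\<lambda>i. Comp D H H X x (Comp D H G H (U i) (W i))) {..<n}"
      unfolding \<pi>_def \<sigma>_def using X x G H U W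
      by (intro HX.finsum_cong') (auto simp: Comp_assoc intro!: Comp_closed)
    also have "\<dots> = Comp D H H X x (finsum (Hom D H H) (\<lambda>i. Comp D H G H (U i) (W i)) {..<n})"
      using x X G H U W
      by (intro linear_maps_finsum[OF Comp_linear_right, symmetric] Hom_module) (auto intro!: Comp_closed)
    also have "\<dots> = x"
      using assms(3) X H x by (simp add: identity_factors_def Ident_right)
    finally show "\<pi> X (\<sigma> X x) = x" .
  qed (intro linear_functor_power linear_functor_yoneda G H)+
qed

text \<open>By naturality a transformation out of \<open>Y\<^sub>G\<^sup>n\<close> is determined by the images of the \<open>n\<close>
  copies of the identity of \<open>G\<close>.\<close>

lemma natural_transformation_power_yoneda:
  assumes G: "G \<in> Ob D" and H: "H \<in> Ob D" and X: "X \<in> Ob D"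
    and \<pi>: "\<pi> \<in> natural_transformations k D (functor_power (yoneda D G) n) (yoneda D H)"
    and y: "y \<in> {..<n} \<rightarrow>\<^sub>E carrier (Hom D G X)"
  defines "W \<equiv> \<lambda>i. \<pi> G (\<lambda>j\<in>{..<n}. if j = i then Ident D G else \<zero>\<^bsub>Hom D G G\<^esub>)"
  shows "W \<in> {..<n} \<rightarrow> carrier (Hom D H G)"
    and "\<pi> X y = finsum (Hom D H X) (\<lambda>i. Comp D H G X (y i) (W i)) {..<n}"
proof -
  let ?P = "functor_power (yoneda D G) n"
  interpret GG: module k "Hom D G G" using Hom_module G G .
  interpret GX: module k "Hom D G X" using Hom_module G X .
  interpret HX: module k "Hom D H X" using Hom_module H X .
  have P_simps: "FOb ?P X = module_power (Hom D G X) n" for X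
    by (simp add: functor_power_def yoneda_def)
  have Y_simps: "FOb (yoneda D H) X = Hom D H X" for X
    by (simp add: yoneda_def)
  note \<pi>l = natural_transformationsD(1)[OF \<pi>, unfolded P_simps Y_simps]
  have unit: "(\<lambda>j\<in>{..<n}. if j = i then Ident D G else \<zero>\<^bsub>Hom D G G\<^esub>) \<in> carrier (FOb ?P G)" for i
    by (auto simp: P_simps module_power_simps Ident_closed G)
  show W: "W \<in> {..<n} \<rightarrow> carrier (Hom D H G)"
    using linear_mapsD(1)[OF \<pi>l[OF G]] unit unfolding W_def P_simps by blast
  have y_mem: "y i \<in> carrier (Hom D G X)" if "i < n" for i
    using y that by auto
  define single where "single i = (\<lambda>j\<in>{..<n}. if j = i then y i else \<zero>\<^bsub>Hom D G X\<^esub>)" for i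
  have single_mem: "single i \<in> carrier (module_power (Hom D G X) n)" if "i < n" for i
    using y_mem[OF that] by (auto simp: single_def module_power_simps)
  have \<pi>_single: "\<pi> X (single i) = Comp D H G X (y i) (W i)" if i: "i < n" for i
  proof -
    \<comment> \<open>Composing \<open>y i\<close> with the identity gives \<open>y i\<close>, and
      with zero gives zero. So \<open>single i\<close> is the image of a unit vector under the arrow
      \<open>y i\<close>, and naturality computes \<open>\<pi>\<close> on it.\<close>
    have "single i = FArr ?P G X (y i) (\<lambda>j\<in>{..<n}. if j = i then Ident D G else \<zero>\<^bsub>Hom D G G\<^esub>)"
      using y_mem[OF i] G X linear_maps_zero[OF Comp_linear_right[OF G G X y_mem[OF i]] Hom_module Hom_module]
      by (auto simp: single_def functor_power_def yoneda_def fun_eq_iff Ident_right)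
    then show ?thesis
      using natural_transformationsD(2)[OF \<pi> G X _ unit] y_mem[OF i]
      by (simp add: W_def yoneda_def)
  qed
  \<comment> \<open>Induction on the number \<open>m\<close> of coordinates of \<open>y\<close> that
    are kept; the step from \<open>m\<close> to \<open>Suc m\<close> adds \<open>single m\<close>.
    For \<open>m = n\<close> the truncation is \<open>y\<close> itself.\<close>
  have "\<pi> X (\<lambda>i\<in>{..<n}. if i < m then y i else \<zero>\<^bsub>Hom D G X\<^esub>) =
      finsum (Hom D H X) (\<lambda>i. Comp D H G X (y i) (W i)) {..<m}" if "m \<le> n" for m
    using that
  proof (induction m)
    case 0
    have "(\<lambda>i\<in>{..<n}. if i < 0 then y i else \<zero>\<^bsub>Hom D G X\<^esub>) = \<zero>\<^bsub>module_power (Hom D G X) n\<^esub>"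
      by (auto simp: module_power_def)
    then show ?case
      using linear_maps_zero[OF \<pi>l[OF X] module_module_power[OF Hom_module[OF G X]] Hom_module[OF H X]]
      by simp
  next
    case (Suc m)
    let ?t = "\<lambda>m. \<lambda>i\<in>{..<n}. if i < m then y i else \<zero>\<^bsub>Hom D G X\<^esub>"
    have "?t (Suc m) = single m \<oplus>\<^bsub>module_power (Hom D G X) n\<^esub> ?t m"
      using y_mem Suc.prems by (auto simp: module_power_def single_def fun_eq_iff less_Suc_eq)
    moreover have "?t m \<in> carrier (module_power (Hom D G X) n)"
      using y_mem by (auto simp: module_power_simps)
    ultimately have "\<pi> X (?t (Suc m)) = Comp D H G X (y m) (W m) \<oplus>\<^bsub>Hom D H X\<^esub> \<pi> X (?t m)"
      using linear_mapsD(2)[OF \<pi>l[OF X]] single_mem[of m] Suc.prems by (simp add: \<pi>_single)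
    moreover have "finsum (Hom D H X) (\<lambda>i. Comp D H G X (y i) (W i)) (insert m {..<m}) =
        Comp D H G X (y m) (W m) \<oplus>\<^bsub>Hom D H X\<^esub> finsum (Hom D H X) (\<lambda>i. Comp D H G X (y i) (W i)) {..<m}"
      using Suc.prems W y_mem G H X by (intro HX.finsum_insert) (auto intro!: Comp_closed)
    moreover note Suc.IH[OF Suc_leD[OF Suc.prems]]
    ultimately show ?case
      unfolding lessThan_Suc by (simp only:)
  qed
  from this[of n] show "\<pi> X y = finsum (Hom D H X) (\<lambda>i. Comp D H G X (y i) (W i)) {..<n}"
    using y by (simp add: PiE_restrict cong: restrict_cong)
qed

text \<open>The equation between retraction and section is evaluated at the identity of
  \<open>H\<close>. Its image under \<open>\<sigma>\<close> has the \<open>U i\<close> as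
  coordinates, and the images of unit vectors under \<open>\<pi>\<close> are the
  \<open>W i\<close>.\<close>

lemma identity_factors_if_direct_summand:
  assumes G: "G \<in> Ob D" and H: "H \<in> Ob D"
    and "direct_summand k D (yoneda D H) (functor_power (yoneda D G) n)"
  obtains U W where "identity_factors H G n U W"
proof -
  obtain \<sigma> \<pi> where \<sigma>: "\<sigma> \<in> natural_transformations k D (yoneda D H) (functor_power (yoneda D G) n)"
    and \<pi>: "\<pi> \<in> natural_transformations k D (functor_power (yoneda D G) n) (yoneda D H)"
    and id: "\<And>X x. X \<in> Ob D \<Longrightarrow> x \<in> carrier (FOb (yoneda D H) X) \<Longrightarrow> \<pi> X (\<sigma> X x) = x"
    using direct_summandD[OF assms(3) linear_functor_yoneda[OF H]] by blast
  have I: "Ident D H \<in> carrier (FOb (yoneda D H) H)"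
    using H by (simp add: yoneda_def Ident_closed)
  define U where "U = \<sigma> H (Ident D H)"
  have U: "U \<in> {..<n} \<rightarrow>\<^sub>E carrier (Hom D G H)"
    using linear_mapsD(1)[OF natural_transformationsD(1)[OF \<sigma> H] I]
    by (simp add: U_def functor_power_def yoneda_def module_power_simps)
  note * = natural_transformation_power_yoneda[OF G H H \<pi> U]
  have "\<pi> H U = Ident D H"
    using id[OF H I] by (simp add: U_def)
  with * U show thesis
    by (intro that) (auto simp: identity_factors_def PiE_def)
qed

text \<open>Composites through \<open>G\<close> are stable under scalars and under composition with
  any \<open>x\<close> on the left. The former lets coefficients disappear; the latter spreads a
  factorisation of the identity to all of \<open>Hom D H H\<close>.\<close>

lemma linear_combinations_eq_Hom_iff:
  assumes G: "G \<in> Ob D" and H: "H \<in> Ob D"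
  shows "linear_combinations k (Hom D H H)
      {Comp D H G H U W | U W. U \<in> carrier (Hom D G H) \<and> W \<in> carrier (Hom D H G)} = carrier (Hom D H H)
    \<longleftrightarrow> (\<exists>n U W. identity_factors H G n U W)"
proof -
  define S where "S = {Comp D H G H U W | U W. U \<in> carrier (Hom D G H) \<and> W \<in> carrier (Hom D H G)}"
  interpret HH: module k "Hom D H H" using Hom_module H H .
  interpret GH: module k "Hom D G H" using Hom_module G H .
  have S: "S \<subseteq> carrier (Hom D H H)"
    using G H by (auto simp: S_def intro: Comp_closed)
  \<comment> \<open>Each coefficient is moved into the left factor:
    \<open>c (U W) = (c U) W\<close>.\<close>
  have comb: "(\<exists>U W. U \<in> {..<n} \<rightarrow> carrier (Hom D G H) \<and> W \<in> {..<n} \<rightarrow> carrier (Hom D H G) \<and>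
      finsum (Hom D H H) (\<lambda>i. c i \<odot>\<^bsub>Hom D H H\<^esub> x i) {..<n} =
      finsum (Hom D H H) (\<lambda>i. Comp D H G H (U i) (W i)) {..<n})"
    if c: "c \<in> {..<n} \<rightarrow> carrier k" and x: "x \<in> {..<n} \<rightarrow> S" for n and c :: "nat \<Rightarrow> 'k" and x
  proof -
    have "\<forall>i\<in>{..<n}. \<exists>U W. U \<in> carrier (Hom D G H) \<and> W \<in> carrier (Hom D H G) \<and> x i = Comp D H G H U W"
    proof
      fix i assume "i \<in> {..<n}"
      then have "x i \<in> S" by (rule funcset_mem[OF x])
      then show "\<exists>U W. U \<in> carrier (Hom D G H) \<and> W \<in> carrier (Hom D H G) \<and> x i = Comp D H G H U W"
        unfolding S_def by blast
    qed
    then obtain U W where UW: "\<And>i. i < n \<Longrightarrow> U i \<in> carrier (Hom D G H)"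
        "\<And>i. i < n \<Longrightarrow> W i \<in> carrier (Hom D H G)" "\<And>i. i < n \<Longrightarrow> x i = Comp D H G H (U i) (W i)"
      by (metis lessThan_iff)
    have "finsum (Hom D H H) (\<lambda>i. c i \<odot>\<^bsub>Hom D H H\<^esub> x i) {..<n} =
      finsum (Hom D H H) (\<lambda>i. Comp D H G H (c i \<odot>\<^bsub>Hom D G H\<^esub> U i) (W i)) {..<n}"
      using UW G H linear_mapsD(3)[OF Comp_linear_left[OF H G H]] funcset_mem[OF c]
      by (intro HH.finsum_cong') (auto intro!: Comp_closed)
    moreover have "(\<lambda>i. c i \<odot>\<^bsub>Hom D G H\<^esub> U i) \<in> {..<n} \<rightarrow> carrier (Hom D G H)" "W \<in> {..<n} \<rightarrow> carrier (Hom D H G)"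
      using c UW by auto
    ultimately show ?thesis by blast
  qed
  show ?thesis
    unfolding S_def[symmetric]
  proof
    assume "linear_combinations k (Hom D H H) S = carrier (Hom D H H)"
    then have "Ident D H \<in> linear_combinations k (Hom D H H) S"
      using Ident_closed H by simp
    then obtain n :: nat and c x
      where e: "Ident D H = finsum (Hom D H H) (\<lambda>i. c i \<odot>\<^bsub>Hom D H H\<^esub> x i) {..<n}"
        and c: "c \<in> {..<n} \<rightarrow> carrier k" and x: "x \<in> {..<n} \<rightarrow> S"
      by (rule linear_combinationsE)
    from comb[OF c x] show "\<exists>n U W. identity_factors H G n U W"
      unfolding e[symmetric] identity_factors_def by (elim exE conjE) (rule exI, rule exI, rule exI, simp)
  next
    assume "\<exists>n U W. identity_factors H G n U W"
    then obtain n :: nat and U W where U: "U \<in> {..<n} \<rightarrow> carrier (Hom D G H)" and W: "W \<in> {..<n} \<rightarrow> carrier (Hom D H G)"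
      and e: "finsum (Hom D H H) (\<lambda>i. Comp D H G H (U i) (W i)) {..<n} = Ident D H"
      unfolding identity_factors_def by blast
    show "linear_combinations k (Hom D H H) S = carrier (Hom D H H)"
    proof
      show "linear_combinations k (Hom D H H) S \<subseteq> carrier (Hom D H H)"
        using S unfolding linear_combinations_def by (auto intro!: HH.finsum_closed)
    next
      show "carrier (Hom D H H) \<subseteq> linear_combinations k (Hom D H H) S"
      proof
        fix x assume x: "x \<in> carrier (Hom D H H)"
        \<comment> \<open>The terms of \<open>x\<close> composed with the factorisation of the
          identity, rebracketed so that \<open>x\<close> joins \<open>U i\<close>; each of them lies
          in \<open>S\<close>.\<close>
        let ?y = "\<lambda>i. Comp D H G H (Comp D G H H x (U i)) (W i)"
        have y: "?y \<in> {..<n} \<rightarrow> S"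
          using x U W G H by (auto simp: S_def intro!: Comp_closed)
        have yc: "?y \<in> {..<n} \<rightarrow> carrier (Hom D H H)"
          using y S by blast
        have "x = Comp D H H H x (finsum (Hom D H H) (\<lambda>i. Comp D H G H (U i) (W i)) {..<n})"
          using x H by (simp add: e Ident_right)
        also have "\<dots> = finsum (Hom D H H) (\<lambda>i. Comp D H H H x (Comp D H G H (U i) (W i))) {..<n}"
          using x G H U W
          by (intro linear_maps_finsum[OF Comp_linear_right] Hom_module) (auto intro!: Comp_closed)
        \<comment> \<open>Coefficients equal to one bring the sum into the shape of
          \<open>linear_combinations\<close>.\<close>
        also have "\<dots> = finsum (Hom D H H) (\<lambda>i. \<one>\<^bsub>k\<^esub> \<odot>\<^bsub>Hom D H H\<^esub> ?y i) {..<n}"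
          using x G H yc funcset_mem[OF U] funcset_mem[OF W]
          by (intro HH.finsum_cong') (auto simp: Comp_assoc Comp_closed)
        finally have e': "x = finsum (Hom D H H) (\<lambda>i. \<one>\<^bsub>k\<^esub> \<odot>\<^bsub>Hom D H H\<^esub> ?y i) {..<n}" .
        show "x \<in> linear_combinations k (Hom D H H) S"
          unfolding linear_combinations_def
          by (intro CollectI exI[of _ n] exI[of _ "\<lambda>_. \<one>\<^bsub>k\<^esub>"] exI[of _ ?y] conjI e' y) simp
      qed
    qed
  qed
qed

text \<open>Appending a pair of zeros changes nothing in the sum. This turns a factorisation of
  length 0 into one of positive length, as the exponent in the theorem must be at least 1.\<close>

lemma identity_factors_Suc:
  assumes G: "G \<in> Ob D" and H: "H \<in> Ob D" and "identity_factors H G n U W"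
  shows "\<exists>U W. identity_factors H G (Suc n) U W"
proof (intro exI)
  interpret HH: module k "Hom D H H" using Hom_module H H .
  interpret GH: module k "Hom D G H" using Hom_module G H .
  interpret HG: module k "Hom D H G" using Hom_module H G .
  let ?U = "U(n := \<zero>\<^bsub>Hom D G H\<^esub>)" and ?W = "W(n := \<zero>\<^bsub>Hom D H G\<^esub>)"
  have UW: "U \<in> {..<n} \<rightarrow> carrier (Hom D G H)" "W \<in> {..<n} \<rightarrow> carrier (Hom D H G)"
    using assms(3) unfolding identity_factors_def by auto
  have "Comp D H G H \<zero>\<^bsub>Hom D G H\<^esub> \<zero>\<^bsub>Hom D H G\<^esub> = \<zero>\<^bsub>Hom D H H\<^esub>"
    using linear_maps_zero[OF Comp_linear_left[OF H G H HG.zero_closed]] Hom_module G H by blast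
  then have "finsum (Hom D H H) (\<lambda>i. Comp D H G H (?U i) (?W i)) {..<Suc n} =
    finsum (Hom D H H) (\<lambda>i. Comp D H G H (?U i) (?W i)) {..<n}"
    unfolding lessThan_Suc using UW G H
    by (subst HH.finsum_insert) (auto intro!: Comp_closed HH.finsum_closed HH.l_zero)
  also have "\<dots> = finsum (Hom D H H) (\<lambda>i. Comp D H G H (U i) (W i)) {..<n}"
    using UW G H by (intro HH.finsum_cong') (auto intro!: Comp_closed)
  finally show "identity_factors H G (Suc n) ?U ?W"
    using assms(3) unfolding identity_factors_def by (auto simp: less_Suc_eq)
qed

theorem linear_combinations_eq_Hom_iff_direct_summand:
  assumes "G \<in> Ob D" "H \<in> Ob D"
  shows "linear_combinations k (Hom D H H)
      {Comp D H G H U W | U W. U \<in> carrier (Hom D G H) \<and> W \<in> carrier (Hom D H G)} = carrier (Hom D H H)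
    \<longleftrightarrow> (\<exists>n\<ge>1. direct_summand k D (yoneda D H) (functor_power (yoneda D G) n))"
  unfolding linear_combinations_eq_Hom_iff[OF assms]
proof
  assume "\<exists>n U W. identity_factors H G n U W"
  then show "\<exists>n\<ge>1. direct_summand k D (yoneda D H) (functor_power (yoneda D G) n)"
    by (metis assms identity_factors_Suc direct_summand_if_identity_factors Suc_le_mono le0 One_nat_def)
next
  assume "\<exists>n\<ge>1. direct_summand k D (yoneda D H) (functor_power (yoneda D G) n)"
  then show "\<exists>n U W. identity_factors H G n U W"
    using identity_factors_if_direct_summand[OF assms] by metis
qed

end

section \<open>Tensor products of bisets\<close>

lemma is_bisetD:
  assumes "is_biset G H U"
  shows "finite (carrier U)"
    and "g \<in> carrier G \<Longrightarrow> u \<in> carrier U \<Longrightarrow> lact U g u \<in> carrier U"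
    and "h \<in> carrier H \<Longrightarrow> u \<in> carrier U \<Longrightarrow> ract U u h \<in> carrier U"
    and "u \<in> carrier U \<Longrightarrow> lact U \<one>\<^bsub>G\<^esub> u = u"
    and "u \<in> carrier U \<Longrightarrow> ract U u \<one>\<^bsub>H\<^esub> = u"
    and "g \<in> carrier G \<Longrightarrow> g' \<in> carrier G \<Longrightarrow> u \<in> carrier U \<Longrightarrow>
      lact U (g \<otimes>\<^bsub>G\<^esub> g') u = lact U g (lact U g' u)"
    and "h \<in> carrier H \<Longrightarrow> h' \<in> carrier H \<Longrightarrow> u \<in> carrier U \<Longrightarrow>
      ract U u (h \<otimes>\<^bsub>H\<^esub> h') = ract U (ract U u h) h'"
    and "g \<in> carrier G \<Longrightarrow> h \<in> carrier H \<Longrightarrow> u \<in> carrier U \<Longrightarrow>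
      ract U (lact U g u) h = lact U g (ract U u h)"
  using assms unfolding is_biset_def by blast+

lemma is_bisetI:
  assumes "finite (carrier U)"
    and "\<And>g u. g \<in> carrier G \<Longrightarrow> u \<in> carrier U \<Longrightarrow> lact U g u \<in> carrier U"
    and "\<And>h u. h \<in> carrier H \<Longrightarrow> u \<in> carrier U \<Longrightarrow> ract U u h \<in> carrier U"
    and "\<And>u. u \<in> carrier U \<Longrightarrow> lact U \<one>\<^bsub>G\<^esub> u = u"
    and "\<And>u. u \<in> carrier U \<Longrightarrow> ract U u \<one>\<^bsub>H\<^esub> = u"
    and "\<And>g g' u. g \<in> carrier G \<Longrightarrow> g' \<in> carrier G \<Longrightarrow> u \<in> carrier U \<Longrightarrow>
      lact U (g \<otimes>\<^bsub>G\<^esub> g') u = lact U g (lact U g' u)"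
    and "\<And>h h' u. h \<in> carrier H \<Longrightarrow> h' \<in> carrier H \<Longrightarrow> u \<in> carrier U \<Longrightarrow>
      ract U u (h \<otimes>\<^bsub>H\<^esub> h') = ract U (ract U u h) h'"
    and "\<And>g h u. g \<in> carrier G \<Longrightarrow> h \<in> carrier H \<Longrightarrow> u \<in> carrier U \<Longrightarrow>
      ract U (lact U g u) h = lact U g (ract U u h)"
  shows "is_biset G H U"
  using assms unfolding is_biset_def by blast

section \<open>Isomorphism of bisets and copies on \<open>nat\<close>\<close>

lemma biset_isomorphic_refl: "biset_isomorphic G H U U"
  unfolding biset_isomorphic_def by (intro exI[of _ id]) simp

text \<open>The witness inside \<open>biset_isomorphic\<close> gets a name, so that the properties
  of a chosen map are available as rules.\<close>

definition biset_isomorphism ::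
  "'g monoid \<Rightarrow> 'h monoid \<Rightarrow> ('u, 'g, 'h) biset \<Rightarrow> ('v, 'g, 'h) biset \<Rightarrow> ('u \<Rightarrow> 'v) \<Rightarrow> bool" where
  "biset_isomorphism G H U V f \<longleftrightarrow> bij_betw f (carrier U) (carrier V) \<and>
     (\<forall>g\<in>carrier G. \<forall>u\<in>carrier U. f (lact U g u) = lact V g (f u)) \<and>
     (\<forall>h\<in>carrier H. \<forall>u\<in>carrier U. f (ract U u h) = ract V (f u) h)"

lemma biset_isomorphic_iff: "biset_isomorphic G H U V \<longleftrightarrow> (\<exists>f. biset_isomorphism G H U V f)"
  unfolding biset_isomorphic_def biset_isomorphism_def ..

lemma biset_isomorphismD:
  assumes "biset_isomorphism G H U V f"
  shows "bij_betw f (carrier U) (carrier V)"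
    and "g \<in> carrier G \<Longrightarrow> u \<in> carrier U \<Longrightarrow> f (lact U g u) = lact V g (f u)"
    and "h \<in> carrier H \<Longrightarrow> u \<in> carrier U \<Longrightarrow> f (ract U u h) = ract V (f u) h"
  using assms unfolding biset_isomorphism_def by blast+

text \<open>\<open>biset_isomorphic\<close> by itself does not say that the actions stay in the
  carriers. For \<open>U\<close> this comes from \<open>is_biset\<close>, and it is what allows the
  inverse map to cancel \<open>f\<close> on a translated point.\<close>

lemma biset_isomorphic_sym:
  assumes "biset_isomorphic G H U V" "is_biset G H U"
  shows "biset_isomorphic G H V U"
proof -
  obtain f where "biset_isomorphism G H U V f"
    using assms(1) by (auto simp: biset_isomorphic_iff)
  note f = biset_isomorphismD[OF this]
  let ?g = "inv_into (carrier U) f"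
  have g: "?g v \<in> carrier U" "f (?g v) = v" if "v \<in> carrier V" for v
    using f(1) that by (auto simp: bij_betw_def inv_into_into f_inv_into_f)
  have gf: "?g (f u) = u" if "u \<in> carrier U" for u
    using f(1) that by (simp add: bij_betw_def)
  have "?g (lact V a v) = lact U a (?g v)" if "a \<in> carrier G" "v \<in> carrier V" for a v
    using gf[of "lact U a (?g v)"] f(2)[of a "?g v"] g[OF that(2)] that is_bisetD(2)[OF assms(2)] by simp
  moreover have "?g (ract V v a) = ract U (?g v) a" if "a \<in> carrier H" "v \<in> carrier V" for a v
    using gf[of "ract U (?g v) a"] f(3)[of a "?g v"] g[OF that(2)] that is_bisetD(3)[OF assms(2)] by simp
  ultimately show ?thesis
    unfolding biset_isomorphic_def using bij_betw_inv_into[OF f(1)] by blast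
qed

lemma biset_isomorphic_trans:
  assumes "biset_isomorphic G H U V" "biset_isomorphic G H V W"
  shows "biset_isomorphic G H U W"
proof -
  obtain f where "biset_isomorphism G H U V f"
    using assms(1) by (auto simp: biset_isomorphic_iff)
  note f = biset_isomorphismD[OF this]
  obtain f' where "biset_isomorphism G H V W f'"
    using assms(2) by (auto simp: biset_isomorphic_iff)
  note f' = biset_isomorphismD[OF this]
  have "f u \<in> carrier V" if "u \<in> carrier U" for u
    using f(1) that by (rule bij_betwE[rule_format])
  then show ?thesis
    unfolding biset_isomorphic_def using bij_betw_trans[OF f(1) f'(1)] f(2,3) f'(2,3)
    by (intro exI[of _ "f' \<circ> f"]) simp
qed

text \<open>Two surjections from a common set \<open>X\<close> of representatives with the same
  fibres induce a bijection between their images, and equivariance may be checked on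
  representatives. The isomorphisms between tensor products below are all obtained in this way, so
  no map on a quotient has to be shown well defined.\<close>

lemma biset_isomorphic_if_surj:
  assumes p: "p ` X = carrier S" and q: "q ` X = carrier T"
    and eq: "\<And>x y. x \<in> X \<Longrightarrow> y \<in> X \<Longrightarrow> p x = p y \<longleftrightarrow> q x = q y"
    and l: "\<And>g x. g \<in> carrier G \<Longrightarrow> x \<in> X \<Longrightarrow> \<exists>y\<in>X. lact S g (p x) = p y \<and> lact T g (q x) = q y"
    and r: "\<And>h x. h \<in> carrier H \<Longrightarrow> x \<in> X \<Longrightarrow> \<exists>y\<in>X. ract S (p x) h = p y \<and> ract T (q x) h = q y"
  shows "biset_isomorphic G H S T"
proof -
  \<comment> \<open>Any preimage of \<open>s\<close> will do: by \<open>eq\<close> the value of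
    \<open>q\<close> depends only on that of \<open>p\<close>.\<close>
  define f where "f s = q (inv_into X p s)" for s
  have f: "f (p x) = q x" if "x \<in> X" for x
    using that eq[of "inv_into X p (p x)" x] by (simp add: f_def inv_into_into f_inv_into_f)
  have "bij_betw f (carrier S) (carrier T)"
    unfolding bij_betw_def inj_on_def p[symmetric] q[symmetric] by (auto simp: f eq image_image)
  moreover have "f (lact S g s) = lact T g (f s)" if g: "g \<in> carrier G" and s: "s \<in> carrier S" for g s
  proof -
    obtain x where x: "x \<in> X" "s = p x" using s p by auto
    then obtain y where "y \<in> X" "lact S g (p x) = p y" "lact T g (q x) = q y"
      using l g by blast
    then show ?thesis by (simp add: x f)
  qed
  moreover have "f (ract S s h) = ract T (f s) h" if h: "h \<in> carrier H" and s: "s \<in> carrier S" for h s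
  proof -
    obtain x where x: "x \<in> X" "s = p x" using s p by auto
    then obtain y where "y \<in> X" "ract S (p x) h = p y" "ract T (q x) h = q y"
      using r h by blast
    then show ?thesis by (simp add: x f)
  qed
  ultimately show ?thesis
    unfolding biset_isomorphic_def by blast
qed

text \<open>Transport of structure along an injection of the finite carrier into \<open>nat\<close>.
  Thus \<open>biset_class\<close> is nonempty for a biset on any type.\<close>

lemma nat_biset_exists:
  assumes "is_biset G H U"
  obtains V :: "(nat, 'g, 'h) biset" where "is_biset G H V" "biset_isomorphic G H U V"
proof -
  obtain f :: "'a \<Rightarrow> nat" where f: "inj_on f (carrier U)"
    using finite_imp_inj_to_nat_seg[OF is_bisetD(1)[OF assms]] by blast
  define V where "V = \<lparr>carrier = f ` carrier U, lact = \<lambda>g n. f (lact U g (inv_into (carrier U) f n)),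
    ract = \<lambda>n h. f (ract U (inv_into (carrier U) f n) h)\<rparr>"
  note D = is_bisetD[OF assms]
  have "is_biset G H V"
    by (rule is_bisetI) (auto simp: V_def f D)
  moreover have "biset_isomorphic G H U V"
    unfolding biset_isomorphic_def using f
    by (intro exI[of _ f]) (auto simp: V_def bij_betw_def)
  ultimately show thesis by (rule that)
qed

lemma biset_class_cong:
  fixes G :: "'g monoid" and H :: "'h monoid"
  assumes "biset_isomorphic G H U V" "is_biset G H U"
  shows "biset_class G H U = biset_class G H V"
proof -
  have "biset_isomorphic G H U W \<longleftrightarrow> biset_isomorphic G H V W" for W :: "(nat, 'g, 'h) biset"
    using biset_isomorphic_trans[OF biset_isomorphic_sym[OF assms], of W]
      biset_isomorphic_trans[OF assms(1), of W] by blast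
  then show ?thesis
    by (simp add: biset_class_def)
qed

text \<open>\<open>V\<close> lives on \<open>nat\<close> and so belongs to its own class; equality
  of the classes then makes it a member of the class of \<open>U\<close>.\<close>

lemma biset_class_eq_iff:
  assumes "is_biset G H U" "is_biset G H (V :: (nat, 'g, 'h) biset)"
  shows "biset_class G H U = biset_class G H V \<longleftrightarrow> biset_isomorphic G H U V"
proof
  assume "biset_class G H U = biset_class G H V"
  moreover have "V \<in> biset_class G H V"
    using assms(2) by (simp add: biset_class_def biset_isomorphic_refl)
  ultimately show "biset_isomorphic G H U V"
    by (auto simp: biset_class_def)
qed (rule biset_class_cong[OF _ assms(1)])

lemma is_biset_disjoint_union:
  assumes "is_biset G H U" "is_biset G H V"
  shows "is_biset G H (disjoint_union U V)"
  by (rule is_bisetI)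
    (auto simp: disjoint_union_def is_bisetD[OF assms(1)] is_bisetD[OF assms(2)])

lemma disjoint_union_cong:
  assumes "biset_isomorphic G H U U'" "biset_isomorphic G H V V'"
  shows "biset_isomorphic G H (disjoint_union U V) (disjoint_union U' V')"
proof -
  obtain f where "biset_isomorphism G H U U' f"
    using assms(1) by (auto simp: biset_isomorphic_iff)
  note f = biset_isomorphismD[OF this]
  obtain f' where "biset_isomorphism G H V V' f'"
    using assms(2) by (auto simp: biset_isomorphic_iff)
  note f' = biset_isomorphismD[OF this]
  have "bij_betw (map_sum f f') (carrier U <+> carrier V) (carrier U' <+> carrier V')"
  proof (rule bij_betw_imageI)
    show "inj_on (map_sum f f') (carrier U <+> carrier V)"
    proof (rule inj_onI)
      fix x y assume "x \<in> carrier U <+> carrier V" "y \<in> carrier U <+> carrier V"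
        and "map_sum f f' x = map_sum f f' y"
      then show "x = y"
        by (elim PlusE) (simp_all add: inj_on_eq_iff[OF bij_betw_imp_inj_on[OF f(1)]]
            inj_on_eq_iff[OF bij_betw_imp_inj_on[OF f'(1)]])
    qed
    show "map_sum f f' ` (carrier U <+> carrier V) = carrier U' <+> carrier V'"
      unfolding bij_betw_imp_surj_on[OF f(1), symmetric] bij_betw_imp_surj_on[OF f'(1), symmetric]
      by (simp add: Plus_def image_Un image_image)
  qed
  then show ?thesis
    unfolding biset_isomorphic_def using f(2,3) f'(2,3)
    by (intro exI[of _ "map_sum f f'"]) (auto simp: disjoint_union_def)
qed

lemma is_biset_group_biset: "group G \<Longrightarrow> finite (carrier G) \<Longrightarrow> is_biset G G (group_biset G)"
  by (rule is_bisetI) (auto simp: group_biset_def group.is_monoid monoid.m_assoc monoid.m_closed)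

section \<open>Elementary tensors and the actions on a tensor product\<close>

locale biset_pair =
  fixes G :: "'g monoid" and H :: "'h monoid" and L :: "'l monoid"
    and U :: "('u, 'g, 'h) biset" and W :: "('w, 'h, 'l) biset"
  assumes groups: "group G" "group H" "group L"
    and bisets: "is_biset G H U" "is_biset H L W"
begin

sublocale G: group G + H: group H + L: group L
  by (fact groups)+

lemmas UD = is_bisetD[OF bisets(1)] and WD = is_bisetD[OF bisets(2)]

text \<open>The elementary tensor of \<open>u\<close> and \<open>w\<close>. Once carrier and actions
  of the tensor product are described by it, all computations take place with
  representatives.\<close>

definition cls :: "'u \<Rightarrow> 'w \<Rightarrow> ('u \<times> 'w) set" where
  "cls u w = tensor_rel H U W `` {(u, w)}"

lemma tensor_rel_iff:
  "((u, w), (u', w')) \<in> tensor_rel H U W \<longleftrightarrow>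
     u' \<in> carrier U \<and> w \<in> carrier W \<and> (\<exists>h\<in>carrier H. u = ract U u' h \<and> w' = lact W h w)"
  unfolding tensor_rel_def by auto

text \<open>Inverses in \<open>H\<close> give symmetry and products give transitivity. Equality of
  elementary tensors is therefore witnessed by a single element of \<open>H\<close>, without chains
  of elementary steps.\<close>

lemma equiv_tensor_rel: "equiv (carrier U \<times> carrier W) (tensor_rel H U W)"
proof (rule equivI)
  show "tensor_rel H U W \<subseteq> (carrier U \<times> carrier W) \<times> (carrier U \<times> carrier W)"
    by (auto simp: tensor_rel_def UD WD)
  show "refl_on (carrier U \<times> carrier W) (tensor_rel H U W)"
    by (rule refl_onI) (auto simp: tensor_rel_iff UD WD intro!: bexI[of _ "\<one>\<^bsub>H\<^esub>"])
  show "sym (tensor_rel H U W)"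
  proof (rule symI, clarsimp simp: tensor_rel_iff)
    fix u w h assume *: "u \<in> carrier U" "w \<in> carrier W" "h \<in> carrier H"
    have "u = ract U (ract U u h) (inv\<^bsub>H\<^esub> h)" "w = lact W (inv\<^bsub>H\<^esub> h) (lact W h w)"
      using * UD(7)[of h "inv\<^bsub>H\<^esub> h" u] WD(6)[of "inv\<^bsub>H\<^esub> h" h w] by (simp_all add: UD WD)
    with * show "ract U u h \<in> carrier U \<and> lact W h w \<in> carrier W \<and>
        (\<exists>h'\<in>carrier H. u = ract U (ract U u h) h' \<and> w = lact W h' (lact W h w))"
      by (auto simp: UD WD intro!: bexI[of _ "inv\<^bsub>H\<^esub> h"])
  qed
  show "trans (tensor_rel H U W)"
  proof (rule transI, clarsimp simp: tensor_rel_iff)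
    fix u w h h' assume "u \<in> carrier U" "w \<in> carrier W" "h \<in> carrier H" "h' \<in> carrier H"
    then show "\<exists>h''\<in>carrier H. ract U (ract U u h') h = ract U u h'' \<and> lact W h' (lact W h w) = lact W h'' w"
      by (intro bexI[of _ "h' \<otimes>\<^bsub>H\<^esub> h"]) (simp_all add: UD WD)
  qed
qed

lemma cls_eq_iff:
  assumes "u \<in> carrier U" "w \<in> carrier W" "u' \<in> carrier U" "w' \<in> carrier W"
  shows "cls u w = cls u' w' \<longleftrightarrow> (\<exists>h\<in>carrier H. u = ract U u' h \<and> w' = lact W h w)"
  using eq_equiv_class_iff[OF equiv_tensor_rel, of "(u, w)" "(u', w')"] assms
  by (simp add: cls_def tensor_rel_iff)

lemma carrier_tensor: "carrier (biset_tensor H U W) = (\<lambda>(u, w). cls u w) ` (carrier U \<times> carrier W)"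
  unfolding biset_tensor_def quotient_def cls_def by auto

text \<open>The action on a class is an image of sets, so two inclusions are required. For the
  second one, the translation is undone with the inverse of \<open>g\<close>: a pair
  \<open>(a, b)\<close> comes from \<open>(g^{-1} a, b)\<close>.\<close>

lemma lact_tensor:
  assumes "g \<in> carrier G" "u \<in> carrier U" "w \<in> carrier W"
  shows "lact (biset_tensor H U W) g (cls u w) = cls (lact U g u) w"
proof -
  have "(\<lambda>(u, w). (lact U g u, w)) ` cls u w = cls (lact U g u) w"
  proof
    show "(\<lambda>(u, w). (lact U g u, w)) ` cls u w \<subseteq> cls (lact U g u) w"
      using assms by (auto simp: cls_def tensor_rel_iff UD)
    show "cls (lact U g u) w \<subseteq> (\<lambda>(u, w). (lact U g u, w)) ` cls u w"
    proof clarify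
      fix a b assume "(a, b) \<in> cls (lact U g u) w"
      then obtain h where h: "h \<in> carrier H" "lact U g u = ract U a h" "b = lact W h w" and a: "a \<in> carrier U"
        by (auto simp: cls_def tensor_rel_iff)
      have "u = lact U (inv\<^bsub>G\<^esub> g) (lact U g u)"
        using assms UD(6)[of "inv\<^bsub>G\<^esub> g" g u] by (simp add: UD)
      also have "\<dots> = ract U (lact U (inv\<^bsub>G\<^esub> g) a) h"
        using assms h a by (simp add: UD)
      finally have "u = ract U (lact U (inv\<^bsub>G\<^esub> g) a) h" .
      moreover have "lact U g (lact U (inv\<^bsub>G\<^esub> g) a) = a"
        using assms a UD(6)[of g "inv\<^bsub>G\<^esub> g" a] by (simp add: UD)
      ultimately show "(a, b) \<in> (\<lambda>(u, w). (lact U g u, w)) ` cls u w"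
        using assms h a
        by (intro image_eqI[of _ _ "(lact U (inv\<^bsub>G\<^esub> g) a, b)"]) (auto simp: cls_def tensor_rel_iff UD)
    qed
  qed
  then show ?thesis by (simp add: biset_tensor_def)
qed

lemma ract_tensor:
  assumes "l \<in> carrier L" "u \<in> carrier U" "w \<in> carrier W"
  shows "ract (biset_tensor H U W) (cls u w) l = cls u (ract W w l)"
proof -
  have "(\<lambda>(u, w). (u, ract W w l)) ` cls u w = cls u (ract W w l)"
  proof
    show "(\<lambda>(u, w). (u, ract W w l)) ` cls u w \<subseteq> cls u (ract W w l)"
    proof clarify
      fix a b assume "(a, b) \<in> cls u w"
      then obtain h where "h \<in> carrier H" "u = ract U a h" "b = lact W h w" "a \<in> carrier U"
        by (auto simp: cls_def tensor_rel_iff)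
      with assms show "(a, ract W b l) \<in> cls u (ract W w l)"
        by (auto simp: cls_def tensor_rel_iff WD intro!: bexI[of _ h])
    qed
    show "cls u (ract W w l) \<subseteq> (\<lambda>(u, w). (u, ract W w l)) ` cls u w"
    proof clarify
      fix a b assume "(a, b) \<in> cls u (ract W w l)"
      then obtain h where h: "h \<in> carrier H" "u = ract U a h" "b = lact W h (ract W w l)" and a: "a \<in> carrier U"
        by (auto simp: cls_def tensor_rel_iff)
      \<comment> \<open>Since \<open>h (w l) = (h w) l\<close>, the pair \<open>(a, b)\<close> is
        the translate of \<open>(a, h w)\<close>.\<close>
      with assms show "(a, b) \<in> (\<lambda>(u, w). (u, ract W w l)) ` cls u w"
        by (intro image_eqI[of _ _ "(a, lact W h w)"]) (auto simp: cls_def tensor_rel_iff WD intro!: bexI[of _ h])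
    qed
  qed
  then show ?thesis by (simp add: biset_tensor_def)
qed

lemma cls_mem: "u \<in> carrier U \<Longrightarrow> w \<in> carrier W \<Longrightarrow> cls u w \<in> carrier (biset_tensor H U W)"
  by (auto simp: carrier_tensor)

lemma is_biset_tensor: "is_biset G L (biset_tensor H U W)"
  by (rule is_bisetI)
    (auto simp: carrier_tensor lact_tensor ract_tensor UD WD intro!: image_eqI)

end

text \<open>Both quotients are parametrised by \<open>carrier U \<times> carrier W\<close>, the
  second one through \<open>f\<close> and \<open>f'\<close>. The fibres agree because these maps are
  injective and commute with the action of \<open>H\<close>.\<close>

lemma biset_tensor_cong:
  assumes g: "group G" "group H" "group L"
    and U: "is_biset G H U" "is_biset G H U'" and W: "is_biset H L W" "is_biset H L W'"
    and iso: "biset_isomorphic G H U U'" "biset_isomorphic H L W W'"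
  shows "biset_isomorphic G L (biset_tensor H U W) (biset_tensor H U' W')"
proof -
  interpret T: biset_pair G H L U W by (intro biset_pair.intro g U W)
  interpret T': biset_pair G H L U' W' by (intro biset_pair.intro g U W)
  obtain f where "biset_isomorphism G H U U' f"
    using iso(1) by (auto simp: biset_isomorphic_iff)
  note f = biset_isomorphismD[OF this]
  obtain f' where "biset_isomorphism H L W W' f'"
    using iso(2) by (auto simp: biset_isomorphic_iff)
  note f' = biset_isomorphismD[OF this]
  have m: "u \<in> carrier U \<Longrightarrow> f u \<in> carrier U'" "w \<in> carrier W \<Longrightarrow> f' w \<in> carrier W'" for u w
    using f(1) f'(1) by (auto simp: bij_betw_def)
  have inj: "f u = f u' \<longleftrightarrow> u = u'" if "u \<in> carrier U" "u' \<in> carrier U" for u u'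
    using f(1) that by (auto simp: bij_betw_def inj_on_def)
  have inj': "f' u = f' u' \<longleftrightarrow> u = u'" if "u \<in> carrier W" "u' \<in> carrier W" for u u'
    using f'(1) that by (auto simp: bij_betw_def inj_on_def)
  show ?thesis
  proof (rule biset_isomorphic_if_surj)
    show "(\<lambda>(u, w). T.cls u w) ` (carrier U \<times> carrier W) = carrier (biset_tensor H U W)"
      by (simp add: T.carrier_tensor)
    have "carrier U' \<times> carrier W' = map_prod f f' ` (carrier U \<times> carrier W)"
      using f(1) f'(1) by (simp add: bij_betw_imp_surj_on map_prod_surj_on)
    then show "(\<lambda>(u, w). T'.cls (f u) (f' w)) ` (carrier U \<times> carrier W) = carrier (biset_tensor H U' W')"
      by (simp add: T'.carrier_tensor image_image case_prod_beta)
    fix x assume x: "x \<in> carrier U \<times> carrier W"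
    then show "(case x of (u, w) \<Rightarrow> T.cls u w) = (case y of (u, w) \<Rightarrow> T.cls u w) \<longleftrightarrow>
        (case x of (u, w) \<Rightarrow> T'.cls (f u) (f' w)) = (case y of (u, w) \<Rightarrow> T'.cls (f u) (f' w))"
      if "y \<in> carrier U \<times> carrier W" for y
      using that x by (clarsimp simp: T.cls_eq_iff T'.cls_eq_iff m f(3)[symmetric] f'(2)[symmetric]
          inj inj' T.UD T.WD cong: bex_cong)
    show "\<exists>y\<in>carrier U \<times> carrier W. lact (biset_tensor H U W) g (case x of (u, w) \<Rightarrow> T.cls u w) =
        (case y of (u, w) \<Rightarrow> T.cls u w) \<and>
        lact (biset_tensor H U' W') g (case x of (u, w) \<Rightarrow> T'.cls (f u) (f' w)) =
        (case y of (u, w) \<Rightarrow> T'.cls (f u) (f' w))" if "g \<in> carrier G" for g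
      using that x by (intro bexI[of _ "map_prod (lact U g) id x"])
        (auto simp: T.lact_tensor T'.lact_tensor m f(2) T.UD)
    show "\<exists>y\<in>carrier U \<times> carrier W. ract (biset_tensor H U W) (case x of (u, w) \<Rightarrow> T.cls u w) l =
        (case y of (u, w) \<Rightarrow> T.cls u w) \<and>
        ract (biset_tensor H U' W') (case x of (u, w) \<Rightarrow> T'.cls (f u) (f' w)) l =
        (case y of (u, w) \<Rightarrow> T'.cls (f u) (f' w))" if "l \<in> carrier L" for l
      using that x by (intro bexI[of _ "map_prod id (\<lambda>w. ract W w l) x"])
        (auto simp: T.ract_tensor T'.ract_tensor m f'(3) T.WD)
  qed
qed

section \<open>Distributivity over disjoint unions\<close>

lemma disjoint_union_simps:
  "carrier (disjoint_union U V) = carrier U <+> carrier V"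
  "lact (disjoint_union U V) g (Inl u) = Inl (lact U g u)"
  "lact (disjoint_union U V) g (Inr v) = Inr (lact V g v)"
  "ract (disjoint_union U V) (Inl u) h = Inl (ract U u h)"
  "ract (disjoint_union U V) (Inr v) h = Inr (ract V v h)"
  by (simp_all add: disjoint_union_def)

text \<open>The actions preserve both parts of a disjoint union, so no elementary tensor over the
  first part is identified with one over the second.\<close>

lemma biset_tensor_union_left:
  assumes g: "group G" "group H" "group L"
    and U: "is_biset G H U" and V: "is_biset G H V" and W: "is_biset H L W"
  shows "biset_isomorphic G L (biset_tensor H (disjoint_union U V) W)
    (disjoint_union (biset_tensor H U W) (biset_tensor H V W))"
proof -
  interpret T: biset_pair G H L "disjoint_union U V" W
    by (intro biset_pair.intro g is_biset_disjoint_union U V W)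
  interpret U: biset_pair G H L U W by (intro biset_pair.intro g U W)
  interpret V: biset_pair G H L V W by (intro biset_pair.intro g V W)
  let ?X = "(carrier U <+> carrier V) \<times> carrier W"
  let ?q = "\<lambda>(x, w). map_sum (\<lambda>u. U.cls u w) (\<lambda>v. V.cls v w) x"
  show ?thesis
  proof (rule biset_isomorphic_if_surj)
    show "(\<lambda>(x, w). T.cls x w) ` ?X = carrier (biset_tensor H (disjoint_union U V) W)"
      by (simp add: T.carrier_tensor disjoint_union_simps)
    show "?q ` ?X = carrier (disjoint_union (biset_tensor H U W) (biset_tensor H V W))"
      by (auto simp: disjoint_union_simps U.carrier_tensor V.carrier_tensor Plus_def image_iff bex_Un; blast)
    fix x assume x: "x \<in> ?X"
    show "(case x of (x, w) \<Rightarrow> T.cls x w) = (case y of (x, w) \<Rightarrow> T.cls x w) \<longleftrightarrow> ?q x = ?q y"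
      if "y \<in> ?X" for y
      using that x by (elim SigmaE PlusE) (simp_all add: T.cls_eq_iff U.cls_eq_iff V.cls_eq_iff disjoint_union_simps InlI InrI cong: bex_cong)
    show "\<exists>y\<in>?X. lact (biset_tensor H (disjoint_union U V) W) g (case x of (x, w) \<Rightarrow> T.cls x w) =
        (case y of (x, w) \<Rightarrow> T.cls x w) \<and>
        lact (disjoint_union (biset_tensor H U W) (biset_tensor H V W)) g (?q x) = ?q y"
      if "g \<in> carrier G" for g
      using that x by (intro bexI[of _ "map_prod (lact (disjoint_union U V) g) id x"])
        (auto simp: T.lact_tensor U.lact_tensor V.lact_tensor disjoint_union_simps InlI InrI U.UD V.UD)
    show "\<exists>y\<in>?X. ract (biset_tensor H (disjoint_union U V) W) (case x of (x, w) \<Rightarrow> T.cls x w) l =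
        (case y of (x, w) \<Rightarrow> T.cls x w) \<and>
        ract (disjoint_union (biset_tensor H U W) (biset_tensor H V W)) (?q x) l = ?q y"
      if "l \<in> carrier L" for l
      using that x by (intro bexI[of _ "map_prod id (\<lambda>w. ract W w l) x"])
        (auto simp: T.ract_tensor U.ract_tensor V.ract_tensor disjoint_union_simps InlI InrI U.WD)
  qed
qed

lemma biset_tensor_union_right:
  assumes g: "group G" "group H" "group L"
    and U: "is_biset G H U" and V: "is_biset H L V" and W: "is_biset H L W"
  shows "biset_isomorphic G L (biset_tensor H U (disjoint_union V W))
    (disjoint_union (biset_tensor H U V) (biset_tensor H U W))"
proof -
  interpret T: biset_pair G H L U "disjoint_union V W"
    by (intro biset_pair.intro g is_biset_disjoint_union U V W)
  interpret V: biset_pair G H L U V by (intro biset_pair.intro g U V)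
  interpret W: biset_pair G H L U W by (intro biset_pair.intro g U W)
  let ?X = "carrier U \<times> (carrier V <+> carrier W)"
  let ?q = "\<lambda>(u, x). map_sum (\<lambda>v. V.cls u v) (\<lambda>w. W.cls u w) x"
  show ?thesis
  proof (rule biset_isomorphic_if_surj)
    show "(\<lambda>(u, x). T.cls u x) ` ?X = carrier (biset_tensor H U (disjoint_union V W))"
      by (simp add: T.carrier_tensor disjoint_union_simps)
    show "?q ` ?X = carrier (disjoint_union (biset_tensor H U V) (biset_tensor H U W))"
      by (auto simp: disjoint_union_simps W.carrier_tensor V.carrier_tensor Plus_def image_iff bex_Un; blast)
    fix x assume x: "x \<in> ?X"
    show "(case x of (u, x) \<Rightarrow> T.cls u x) = (case y of (u, x) \<Rightarrow> T.cls u x) \<longleftrightarrow> ?q x = ?q y"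
      if "y \<in> ?X" for y
      using that x by (elim SigmaE PlusE) (simp_all add: T.cls_eq_iff W.cls_eq_iff V.cls_eq_iff disjoint_union_simps InlI InrI cong: bex_cong)
    show "\<exists>y\<in>?X. lact (biset_tensor H U (disjoint_union V W)) g (case x of (u, x) \<Rightarrow> T.cls u x) =
        (case y of (u, x) \<Rightarrow> T.cls u x) \<and>
        lact (disjoint_union (biset_tensor H U V) (biset_tensor H U W)) g (?q x) = ?q y"
      if "g \<in> carrier G" for g
      using that x by (intro bexI[of _ "map_prod (lact U g) id x"])
        (auto simp: T.lact_tensor W.lact_tensor V.lact_tensor disjoint_union_simps InlI InrI T.UD)
    show "\<exists>y\<in>?X. ract (biset_tensor H U (disjoint_union V W)) (case x of (u, x) \<Rightarrow> T.cls u x) l =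
        (case y of (u, x) \<Rightarrow> T.cls u x) \<and>
        ract (disjoint_union (biset_tensor H U V) (biset_tensor H U W)) (?q x) l = ?q y"
      if "l \<in> carrier L" for l
      using that x by (intro bexI[of _ "map_prod id (\<lambda>w. ract (disjoint_union V W) w l) x"])
        (auto simp: T.ract_tensor W.ract_tensor V.ract_tensor disjoint_union_simps InlI InrI W.WD V.WD)
  qed
qed

text \<open>Both sides are quotients of \<open>U \<times> V \<times> W\<close> by the same
  identifications: \<open>(u, v, w)\<close> and \<open>(u', v', w')\<close> have the same image iff
  some \<open>h\<close> and \<open>k\<close> satisfy \<open>u = u' h\<close>,
  \<open>v' k = h v\<close> and \<open>w' = k w\<close>.\<close>

lemma biset_tensor_assoc:
  assumes g: "group G" "group H" "group K" "group L"
    and U: "is_biset G H U" and V: "is_biset H K V" and W: "is_biset K L W"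
  shows "biset_isomorphic G L (biset_tensor K (biset_tensor H U V) W) (biset_tensor H U (biset_tensor K V W))"
proof -
  interpret UV: biset_pair G H K U V by (intro biset_pair.intro g U V)
  interpret VW: biset_pair H K L V W by (intro biset_pair.intro g V W)
  interpret S: biset_pair G K L "biset_tensor H U V" W
    by (intro biset_pair.intro g UV.is_biset_tensor W)
  interpret T: biset_pair G H L U "biset_tensor K V W"
    by (intro biset_pair.intro g VW.is_biset_tensor U)
  let ?X = "carrier U \<times> carrier V \<times> carrier W"
  let ?p = "\<lambda>(u, v, w). S.cls (UV.cls u v) w" and ?q = "\<lambda>(u, v, w). T.cls u (VW.cls v w)"
  show ?thesis
  proof (rule biset_isomorphic_if_surj)
    show "?p ` ?X = carrier (biset_tensor K (biset_tensor H U V) W)"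
      unfolding S.carrier_tensor UV.carrier_tensor by (force simp: image_iff)
    show "?q ` ?X = carrier (biset_tensor H U (biset_tensor K V W))"
      unfolding T.carrier_tensor VW.carrier_tensor by (force simp: image_iff)
    fix x assume "x \<in> ?X"
    then obtain u v w where x: "x = (u, v, w)" "u \<in> carrier U" "v \<in> carrier V" "w \<in> carrier W"
      by auto
    show "?p x = ?p y \<longleftrightarrow> ?q x = ?q y" if "y \<in> ?X" for y
    proof -
      obtain u' v' w' where y: "y = (u', v', w')" "u' \<in> carrier U" "v' \<in> carrier V" "w' \<in> carrier W"
        using \<open>y \<in> ?X\<close> by (cases y) auto
      have "?p x = ?p y \<longleftrightarrow> (\<exists>k\<in>carrier K. UV.cls u v = UV.cls u' (ract V v' k) \<and> w' = lact W k w)"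
        using x y by (simp add: S.cls_eq_iff UV.cls_mem UV.ract_tensor cong: bex_cong)
      \<comment> \<open>This form favours neither bracketing; the rest of the chain folds it up
        again on the other side.\<close>
      also have "\<dots> \<longleftrightarrow> (\<exists>k\<in>carrier K. \<exists>h\<in>carrier H.
          u = ract U u' h \<and> ract V v' k = lact V h v \<and> w' = lact W k w)"
        using x y by (simp add: UV.cls_eq_iff VW.UD cong: bex_cong) blast
      also have "\<dots> \<longleftrightarrow> (\<exists>h\<in>carrier H. u = ract U u' h \<and> VW.cls (lact V h v) w = VW.cls v' w')"
        using x y by (simp add: VW.cls_eq_iff VW.UD cong: bex_cong) metis
      also have "\<dots> \<longleftrightarrow> ?q x = ?q y"
        using x y by (simp add: T.cls_eq_iff VW.cls_mem VW.lact_tensor cong: bex_cong) metis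
      finally show ?thesis .
    qed
    show "\<exists>y\<in>?X. lact (biset_tensor K (biset_tensor H U V) W) g (?p x) = ?p y \<and>
        lact (biset_tensor H U (biset_tensor K V W)) g (?q x) = ?q y" if "g \<in> carrier G" for g
      using that x by (intro bexI[of _ "(lact U g u, v, w)"])
        (auto simp: S.lact_tensor T.lact_tensor UV.lact_tensor UV.cls_mem VW.cls_mem UV.UD)
    show "\<exists>y\<in>?X. ract (biset_tensor K (biset_tensor H U V) W) (?p x) l = ?p y \<and>
        ract (biset_tensor H U (biset_tensor K V W)) (?q x) l = ?q y" if "l \<in> carrier L" for l
      using that x by (intro bexI[of _ "(u, v, ract W w l)"])
        (auto simp: S.ract_tensor T.ract_tensor VW.ract_tensor UV.cls_mem VW.cls_mem VW.WD)
  qed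
qed

text \<open>The fibres of \<open>(a, u)\<close> to \<open>a u\<close> are the elementary tensors: if
  \<open>a u = b v\<close>, then \<open>h = b^{-1} a\<close> satisfies \<open>a = b h\<close> and
  \<open>v = h u\<close>.\<close>

lemma biset_tensor_group_left:
  assumes g: "group G" "group H" and fin: "finite (carrier G)" and U: "is_biset G H U"
  shows "biset_isomorphic G H (biset_tensor G (group_biset G) U) U"
proof -
  interpret T: biset_pair G G H "group_biset G" U
    by (intro biset_pair.intro g is_biset_group_biset fin U)
  have gb: "carrier (group_biset G) = carrier G" "lact (group_biset G) a b = a \<otimes>\<^bsub>G\<^esub> b"
    "ract (group_biset G) a b = a \<otimes>\<^bsub>G\<^esub> b" for a b
    by (simp_all add: group_biset_def)
  let ?X = "carrier G \<times> carrier U"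
  show ?thesis
  proof (rule biset_isomorphic_if_surj)
    show "(\<lambda>(a, u). T.cls a u) ` ?X = carrier (biset_tensor G (group_biset G) U)"
      by (simp add: T.carrier_tensor gb)
    show "(\<lambda>(a, u). lact U a u) ` ?X = carrier U"
    proof
      show "carrier U \<subseteq> (\<lambda>(a, u). lact U a u) ` ?X"
        by (auto simp: T.WD intro!: image_eqI[of _ _ "(\<one>\<^bsub>G\<^esub>, u)" for u])
    qed (auto simp: T.WD)
    fix x assume "x \<in> ?X"
    then obtain a u where x: "x = (a, u)" "a \<in> carrier G" "u \<in> carrier U" by auto
    show "(case x of (a, u) \<Rightarrow> T.cls a u) = (case y of (a, u) \<Rightarrow> T.cls a u) \<longleftrightarrow>
        (case x of (a, u) \<Rightarrow> lact U a u) = (case y of (a, u) \<Rightarrow> lact U a u)" if "y \<in> ?X" for y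
    proof -
      obtain b v where y: "y = (b, v)" "b \<in> carrier G" "v \<in> carrier U"
        using \<open>y \<in> ?X\<close> by (cases y) auto
      have "lact U a u = lact U b v \<longleftrightarrow> (\<exists>h\<in>carrier G. a = b \<otimes>\<^bsub>G\<^esub> h \<and> v = lact U h u)"
      proof
        assume e: "lact U a u = lact U b v"
        have "v = lact U (inv\<^bsub>G\<^esub> b) (lact U b v)"
          using y T.WD(6)[of "inv\<^bsub>G\<^esub> b" b v] by (simp add: T.WD)
        also have "\<dots> = lact U (inv\<^bsub>G\<^esub> b \<otimes>\<^bsub>G\<^esub> a) u"
          using x y by (simp add: e[symmetric] T.WD)
        finally show "\<exists>h\<in>carrier G. a = b \<otimes>\<^bsub>G\<^esub> h \<and> v = lact U h u"
          using x y by (intro bexI[of _ "inv\<^bsub>G\<^esub> b \<otimes>\<^bsub>G\<^esub> a"]) (auto simp: T.G.m_assoc[symmetric])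
      qed (use x y in \<open>auto simp: T.WD\<close>)
      then show ?thesis
        using x y by (simp add: T.cls_eq_iff gb)
    qed
    show "\<exists>y\<in>?X. lact (biset_tensor G (group_biset G) U) b (case x of (a, u) \<Rightarrow> T.cls a u) =
        (case y of (a, u) \<Rightarrow> T.cls a u) \<and>
        lact U b (case x of (a, u) \<Rightarrow> lact U a u) = (case y of (a, u) \<Rightarrow> lact U a u)"
      if "b \<in> carrier G" for b
      using that x by (intro bexI[of _ "(b \<otimes>\<^bsub>G\<^esub> a, u)"]) (auto simp: T.lact_tensor gb T.WD)
    show "\<exists>y\<in>?X. ract (biset_tensor G (group_biset G) U) (case x of (a, u) \<Rightarrow> T.cls a u) h =
        (case y of (a, u) \<Rightarrow> T.cls a u) \<and>
        ract U (case x of (a, u) \<Rightarrow> lact U a u) h = (case y of (a, u) \<Rightarrow> lact U a u)"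
      if "h \<in> carrier H" for h
      using that x by (intro bexI[of _ "(a, ract U u h)"]) (auto simp: T.ract_tensor gb T.WD)
  qed
qed

text \<open>The mirror image: \<open>u a = v b\<close> is witnessed by \<open>h = b a^{-1}\<close>,
  with \<open>u = v h\<close> and \<open>b = h a\<close>.\<close>

lemma biset_tensor_group_right:
  assumes g: "group G" "group H" and fin: "finite (carrier H)" and U: "is_biset G H U"
  shows "biset_isomorphic G H (biset_tensor H U (group_biset H)) U"
proof -
  interpret T: biset_pair G H H U "group_biset H"
    by (intro biset_pair.intro g is_biset_group_biset fin U)
  have gb: "carrier (group_biset H) = carrier H" "lact (group_biset H) a b = a \<otimes>\<^bsub>H\<^esub> b"
    "ract (group_biset H) a b = a \<otimes>\<^bsub>H\<^esub> b" for a b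
    by (simp_all add: group_biset_def)
  let ?X = "carrier U \<times> carrier H"
  show ?thesis
  proof (rule biset_isomorphic_if_surj)
    show "(\<lambda>(u, a). T.cls u a) ` ?X = carrier (biset_tensor H U (group_biset H))"
      by (simp add: T.carrier_tensor gb)
    show "(\<lambda>(u, a). ract U u a) ` ?X = carrier U"
    proof
      show "carrier U \<subseteq> (\<lambda>(u, a). ract U u a) ` ?X"
        by (auto simp: T.UD intro!: image_eqI[of _ _ "(u, \<one>\<^bsub>H\<^esub>)" for u])
    qed (auto simp: T.UD)
    fix x assume "x \<in> ?X"
    then obtain a u where x: "x = (u, a)" "a \<in> carrier H" "u \<in> carrier U" by auto
    show "(case x of (u, a) \<Rightarrow> T.cls u a) = (case y of (u, a) \<Rightarrow> T.cls u a) \<longleftrightarrow>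
        (case x of (u, a) \<Rightarrow> ract U u a) = (case y of (u, a) \<Rightarrow> ract U u a)" if "y \<in> ?X" for y
    proof -
      obtain b v where y: "y = (v, b)" "b \<in> carrier H" "v \<in> carrier U"
        using \<open>y \<in> ?X\<close> by (cases y) auto
      have "ract U u a = ract U v b \<longleftrightarrow> (\<exists>h\<in>carrier H. u = ract U v h \<and> b = h \<otimes>\<^bsub>H\<^esub> a)"
      proof
        assume e: "ract U u a = ract U v b"
        have "u = ract U (ract U u a) (inv\<^bsub>H\<^esub> a)"
          using x T.UD(7)[of a "inv\<^bsub>H\<^esub> a" u] by (simp add: T.UD)
        also have "\<dots> = ract U v (b \<otimes>\<^bsub>H\<^esub> inv\<^bsub>H\<^esub> a)"
          using x y by (simp add: e T.UD)
        finally show "\<exists>h\<in>carrier H. u = ract U v h \<and> b = h \<otimes>\<^bsub>H\<^esub> a"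
          using x y by (intro bexI[of _ "b \<otimes>\<^bsub>H\<^esub> inv\<^bsub>H\<^esub> a"]) (auto simp: T.H.m_assoc)
      qed (use x y in \<open>auto simp: T.UD\<close>)
      then show ?thesis
        using x y by (simp add: T.cls_eq_iff gb)
    qed
    show "\<exists>y\<in>?X. lact (biset_tensor H U (group_biset H)) b (case x of (u, a) \<Rightarrow> T.cls u a) =
        (case y of (u, a) \<Rightarrow> T.cls u a) \<and>
        lact U b (case x of (u, a) \<Rightarrow> ract U u a) = (case y of (u, a) \<Rightarrow> ract U u a)"
      if "b \<in> carrier G" for b
      using that x by (intro bexI[of _ "(lact U b u, a)"]) (auto simp: T.lact_tensor gb T.UD)
    show "\<exists>y\<in>?X. ract (biset_tensor H U (group_biset H)) (case x of (u, a) \<Rightarrow> T.cls u a) h =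
        (case y of (u, a) \<Rightarrow> T.cls u a) \<and>
        ract U (case x of (u, a) \<Rightarrow> ract U u a) h = (case y of (u, a) \<Rightarrow> ract U u a)"
      if "h \<in> carrier H" for h
      using that x by (intro bexI[of _ "(u, a \<otimes>\<^bsub>H\<^esub> h)"]) (auto simp: T.ract_tensor gb T.UD)
  qed
qed

section \<open>Abelian groups with generators and relations\<close>

text \<open>Formal sums are computed with additively while the target group is multiplicative. The
  keys have to lie in \<open>S\<close> because \<open>h\<close> is a homomorphism on the carrier
  only.\<close>

lemma hom_frag_diff_group:
  assumes "h \<in> hom (free_Abelian_group S) A" "group A" "Poly_Mapping.keys x \<subseteq> S" "Poly_Mapping.keys y \<subseteq> S"
  shows "h (x - y) = h x \<otimes>\<^bsub>A\<^esub> inv\<^bsub>A\<^esub> h y"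
proof -
  interpret h: group_hom "free_Abelian_group S" A h
    using assms by (simp add: group_hom_def group_hom_axioms_def)
  show ?thesis
    using h.hom_mult[of x "- y"] h.hom_inv[of y] assms(3,4) by (simp add: keys_minus)
qed

text \<open>A relator \<open>a - b - c\<close> encodes the equation \<open>a = b c\<close>. The
  relators of the Burnside group and those of the tensor product all have this shape.\<close>

lemma hom_frag_relation:
  assumes "h \<in> hom (free_Abelian_group S) A" "comm_group A" "a \<in> S" "b \<in> S" "c \<in> S"
    and "h (frag_of a) = h (frag_of b) \<otimes>\<^bsub>A\<^esub> h (frag_of c)"
  shows "h (frag_of a - frag_of b - frag_of c) = \<one>\<^bsub>A\<^esub>"
proof -
  interpret A: comm_group A by fact
  have "h (frag_of x) \<in> carrier A" if "x \<in> S" for x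
    using hom_in_carrier[OF assms(1)] that by simp
  moreover have "Poly_Mapping.keys (frag_of a - frag_of b) \<subseteq> S"
    using assms(3,4) keys_diff[of "frag_of a" "frag_of b"] by auto
  ultimately show ?thesis
    using assms(3-6) A.m_comm[of "h (frag_of b)" "h (frag_of c)"]
    by (simp add: hom_frag_diff_group[OF assms(1) A.is_group] A.m_assoc)
qed

text \<open>The way back from a relator with trivial image to the equation that it encodes.\<close>

lemma (in comm_group) eq_mult_if_div_div:
  assumes "a \<in> carrier G" "b \<in> carrier G" "c \<in> carrier G" "a \<otimes> inv b \<otimes> inv c = \<one>"
  shows "a = b \<otimes> c"
proof -
  have "a \<otimes> inv b = c"
    using assms inv_solve_right'[of \<one> "a \<otimes> inv b" c] by simp
  then have "a = c \<otimes> b"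
    using assms inv_solve_right'[of c a b] by simp
  with assms show ?thesis by (simp add: m_comm)
qed

text \<open>The abelian group with generators \<open>S\<close> and relators \<open>R\<close>. The
  Burnside group and its scalar extension are both of this kind, so quotients are handled here once
  for both.\<close>

locale presented_group =
  fixes S :: "'s set" and R :: "('s \<Rightarrow>\<^sub>0 int) set"
  assumes relations: "R \<subseteq> carrier (free_Abelian_group S)"
begin

abbreviation "F \<equiv> free_Abelian_group S"
abbreviation "N \<equiv> generate F R"
abbreviation "Q \<equiv> F Mod N"
abbreviation "q x \<equiv> N #>\<^bsub>F\<^esub> x"

sublocale F: comm_group F
  by (rule abelian_free_Abelian_group)

lemma subgroup_N: "subgroup N F"
  using F.generate_is_subgroup relations by blast

sublocale N: normal N F
  using F.subgroup_imp_normal subgroup_N .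

sublocale Q: comm_group Q
  using F.abelian_FactGroup subgroup_N .

lemma q_hom: "(\<lambda>x. q x) \<in> hom F Q"
  by (rule N.r_coset_hom_Mod)

sublocale q: group_hom F Q "\<lambda>x. q x"
  by (rule group_hom.intro) (auto simp: group_hom_axioms_def q_hom)

lemma carrier_Q: "carrier Q = (\<lambda>x. q x) ` carrier F"
  by (rule carrier_FactGroup)

lemma q_eq_one: "x \<in> N \<Longrightarrow> q x = \<one>\<^bsub>Q\<^esub>"
  using F.coset_join2[OF _ subgroup_N] subgroup.subset[OF subgroup_N] by auto

lemma q_relation:
  assumes "frag_of a - frag_of b - frag_of c \<in> R" "a \<in> S" "b \<in> S" "c \<in> S"
  shows "q (frag_of a) = q (frag_of b) \<otimes>\<^bsub>Q\<^esub> q (frag_of c)"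
proof -
  have m: "q (frag_of x) \<in> carrier Q" if "x \<in> S" for x
    using that by (intro q.hom_closed) simp
  have "Poly_Mapping.keys (frag_of a - frag_of b) \<subseteq> S"
    using assms(2,3) keys_diff[of "frag_of a" "frag_of b"] by auto
  then have "q (frag_of a) \<otimes>\<^bsub>Q\<^esub> inv\<^bsub>Q\<^esub> q (frag_of b) \<otimes>\<^bsub>Q\<^esub> inv\<^bsub>Q\<^esub> q (frag_of c) = \<one>\<^bsub>Q\<^esub>"
    using q_eq_one[of "frag_of a - frag_of b - frag_of c"] assms generate.incl[of _ R F]
    by (simp only: hom_frag_diff_group[OF q_hom Q.is_group] keys_frag_of empty_subsetI insert_subset simp_thms)
  then show ?thesis
    by (intro Q.eq_mult_if_div_div m assms(2-4))
qed

text \<open>Subtraction suffices as the inductive step, since every formal sum is built from zero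
  and generators by differences.\<close>

lemma induct [consumes 1, case_names one gen diff]:
  assumes "X \<in> carrier Q" and "P \<one>\<^bsub>Q\<^esub>" and "\<And>a. a \<in> S \<Longrightarrow> P (q (frag_of a))"
    and "\<And>X Y. X \<in> carrier Q \<Longrightarrow> Y \<in> carrier Q \<Longrightarrow> P X \<Longrightarrow> P Y \<Longrightarrow> P (X \<otimes>\<^bsub>Q\<^esub> inv\<^bsub>Q\<^esub> Y)"
  shows "P X"
proof -
  obtain x where x: "Poly_Mapping.keys x \<subseteq> S" "X = q x"
    using assms(1) carrier_Q by auto
  have "P (q x)"
  proof (rule free_Abelian_group_induct[OF x(1)])
    show "P (q 0)"
      using q.hom_one assms(2) by simp
    show "P (q (x - y))" if "Poly_Mapping.keys x \<subseteq> S" "Poly_Mapping.keys y \<subseteq> S" "P (q x)" "P (q y)" for x y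
      using assms(4)[of "q x" "q y"] q.hom_closed[of x] q.hom_closed[of y] that
      by (simp only: hom_frag_diff_group[OF q_hom Q.is_group] carrier_free_Abelian_group_iff)
  qed (use assms(3) in blast)
  with x show ?thesis by simp
qed

lemma hom_eqI:
  assumes "f \<in> hom Q A" "g \<in> hom Q A" "group A" "\<And>a. a \<in> S \<Longrightarrow> f (q (frag_of a)) = g (q (frag_of a))"
    and "X \<in> carrier Q"
  shows "f X = g X"
proof -
  interpret f: group_hom Q A f
    using assms by (simp add: group_hom_def group_hom_axioms_def)
  interpret g: group_hom Q A g
    using assms by (simp add: group_hom_def group_hom_axioms_def)
  show ?thesis
    using assms(5)
  proof (induction X rule: induct)
    case one
    show ?case using f.hom_one g.hom_one by metis
  next
    case (diff X Y)
    then show ?case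
      using f.hom_mult f.hom_inv g.hom_mult g.hom_inv Q.inv_closed by metis
  qed (fact assms(4))
qed

text \<open>The extension \<open>h\<close> of \<open>f\<close> to formal sums is known only through
  its values on generators, hence relators are tested on an arbitrary such \<open>h\<close>. Its
  kernel then contains the subgroup generated by \<open>R\<close>, and \<open>h\<close> factors
  through the quotient.\<close>

lemma universal:
  assumes "comm_group A" "f ` S \<subseteq> carrier A"
    and "\<And>h r. h \<in> hom F A \<Longrightarrow> (\<And>x. x \<in> S \<Longrightarrow> h (frag_of x) = f x) \<Longrightarrow> r \<in> R \<Longrightarrow> h r = \<one>\<^bsub>A\<^esub>"
  obtains g where "g \<in> hom Q A" "\<And>x. x \<in> S \<Longrightarrow> g (q (frag_of x)) = f x"
proof -
  interpret A: comm_group A by fact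
  obtain h where h: "h \<in> hom F A" "\<And>x. x \<in> S \<Longrightarrow> h (frag_of x) = f x"
    using A.free_Abelian_group_universal[OF assms(2)] by blast
  interpret h: group_hom F A h
    using h(1) by (simp add: group_hom_def group_hom_axioms_def A.is_group)
  have "R \<subseteq> kernel F A h"
    using assms(3)[OF h] relations unfolding kernel_def by blast
  then have "N \<subseteq> kernel F A h"
    using F.generate_subgroup_incl h.subgroup_kernel by blast
  then obtain g where "g \<in> hom Q A" "\<And>x. x \<in> carrier F \<Longrightarrow> g (q x) = h x"
    using h.FactGroup_universal_kernel[OF N.normal_axioms] by blast
  with h(2) show thesis
    using that by (metis frag_of_in_free_Abelian_group)
qed

end

section \<open>Extension of scalars\<close>

lemma keys_frag_relation:
  assumes "a \<in> S" "b \<in> S" "c \<in> S"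
  shows "frag_of a - frag_of b - frag_of c \<in> carrier (free_Abelian_group S)"
  using assms keys_diff[of "frag_of a - frag_of b" "frag_of c"] keys_diff[of "frag_of a" "frag_of b"]
  by auto

text \<open>The generating set inside \<open>tensor_relations\<close>, named so that the tensor
  product becomes an instance of \<open>presented_group\<close>.\<close>

definition tensor_relators :: "'k ring \<Rightarrow> 'b monoid \<Rightarrow> ('k \<times> 'b \<Rightarrow>\<^sub>0 int) set" where
  "tensor_relators k A =
     {frag_of (r \<oplus>\<^bsub>k\<^esub> s, a) - frag_of (r, a) - frag_of (s, a) | r s a.
         r \<in> carrier k \<and> s \<in> carrier k \<and> a \<in> carrier A} \<union>
     {frag_of (r, a \<otimes>\<^bsub>A\<^esub> b) - frag_of (r, a) - frag_of (r, b) | r a b.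
         r \<in> carrier k \<and> a \<in> carrier A \<and> b \<in> carrier A}"

lemma tensor_relations_eq:
  "tensor_relations k A = generate (free_Abelian_group (carrier k \<times> carrier A)) (tensor_relators k A)"
  by (simp add: tensor_relations_def tensor_free_def tensor_relators_def)

locale scalar_extension_of_group =
  fixes k :: "'k ring" and A :: "'b monoid"
  assumes cring_k: "cring k" and comm_group_A: "comm_group A"
begin

sublocale k: cring k by (rule cring_k)
sublocale A: comm_group A by (rule comm_group_A)

sublocale T: presented_group "carrier k \<times> carrier A" "tensor_relators k A"
proof
  show "tensor_relators k A \<subseteq> carrier (free_Abelian_group (carrier k \<times> carrier A))"
    unfolding tensor_relators_def by (safe; intro keys_frag_relation) auto
qed

abbreviation "M \<equiv> scalar_extension k A"
abbreviation "pure \<equiv> pure_tensor k A"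

lemma M_simps: "carrier M = carrier T.Q" "\<zero>\<^bsub>M\<^esub> = \<one>\<^bsub>T.Q\<^esub>" "X \<oplus>\<^bsub>M\<^esub> Y = X \<otimes>\<^bsub>T.Q\<^esub> Y"
  by (simp_all add: scalar_extension_def Let_def tensor_relations_eq tensor_free_def)

lemma pure_eq: "pure r a = T.q (frag_of (r, a))"
  by (simp add: pure_tensor_def tensor_relations_eq tensor_free_def)

lemma pure_closed: "r \<in> carrier k \<Longrightarrow> a \<in> carrier A \<Longrightarrow> pure r a \<in> carrier M"
  unfolding pure_eq M_simps by (intro T.q.hom_closed) simp

lemma pure_add_left:
  assumes "r \<in> carrier k" "s \<in> carrier k" "a \<in> carrier A"
  shows "pure (r \<oplus>\<^bsub>k\<^esub> s) a = pure r a \<oplus>\<^bsub>M\<^esub> pure s a"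
  unfolding pure_eq M_simps
proof (rule T.q_relation)
  show "frag_of (r \<oplus>\<^bsub>k\<^esub> s, a) - frag_of (r, a) - frag_of (s, a) \<in> tensor_relators k A"
    unfolding tensor_relators_def using assms by blast
qed (use assms in auto)

lemma pure_add_right:
  assumes "r \<in> carrier k" "a \<in> carrier A" "b \<in> carrier A"
  shows "pure r (a \<otimes>\<^bsub>A\<^esub> b) = pure r a \<oplus>\<^bsub>M\<^esub> pure r b"
  unfolding pure_eq M_simps
proof (rule T.q_relation)
  show "frag_of (r, a \<otimes>\<^bsub>A\<^esub> b) - frag_of (r, a) - frag_of (r, b) \<in> tensor_relators k A"
    unfolding tensor_relators_def using assms by blast
qed (use assms in auto)

text \<open>The universal property of the tensor product among abelian groups: each of the two kinds
  of relators is killed by additivity in one variable.\<close>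

lemma biadditive_universal:
  assumes "comm_group B"
    and closed: "\<And>r a. r \<in> carrier k \<Longrightarrow> a \<in> carrier A \<Longrightarrow> f r a \<in> carrier B"
    and left: "\<And>r s a. r \<in> carrier k \<Longrightarrow> s \<in> carrier k \<Longrightarrow> a \<in> carrier A \<Longrightarrow>
      f (r \<oplus>\<^bsub>k\<^esub> s) a = f r a \<otimes>\<^bsub>B\<^esub> f s a"
    and right: "\<And>r a b. r \<in> carrier k \<Longrightarrow> a \<in> carrier A \<Longrightarrow> b \<in> carrier A \<Longrightarrow>
      f r (a \<otimes>\<^bsub>A\<^esub> b) = f r a \<otimes>\<^bsub>B\<^esub> f r b"
  obtains g where "g \<in> hom T.Q B" "\<And>r a. r \<in> carrier k \<Longrightarrow> a \<in> carrier A \<Longrightarrow> g (pure r a) = f r a"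
proof (rule T.universal[OF assms(1), of "\<lambda>(r, a). f r a"])
  show "(\<lambda>(r, a). f r a) ` (carrier k \<times> carrier A) \<subseteq> carrier B"
    using closed by auto
  fix h x assume h: "h \<in> hom T.F B" "\<And>x. x \<in> carrier k \<times> carrier A \<Longrightarrow> h (frag_of x) = (case x of (r, a) \<Rightarrow> f r a)"
    and "x \<in> tensor_relators k A"
  then consider (left) r s a where "x = frag_of (r \<oplus>\<^bsub>k\<^esub> s, a) - frag_of (r, a) - frag_of (s, a)"
      "r \<in> carrier k" "s \<in> carrier k" "a \<in> carrier A"
    | (right) r a b where "x = frag_of (r, a \<otimes>\<^bsub>A\<^esub> b) - frag_of (r, a) - frag_of (r, b)"
      "r \<in> carrier k" "a \<in> carrier A" "b \<in> carrier A"
    unfolding tensor_relators_def by blast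
  then show "h x = \<one>\<^bsub>B\<^esub>"
  proof cases
    case left
    show ?thesis unfolding left(1)
      by (rule hom_frag_relation[OF h(1) assms(1)]) (use left in \<open>auto simp: h(2) assms(3)\<close>)
  next
    case right
    show ?thesis unfolding right(1)
      by (rule hom_frag_relation[OF h(1) assms(1)]) (use right in \<open>auto simp: h(2) assms(4)\<close>)
  qed
next
  fix g assume "g \<in> hom T.Q B" "\<And>x. x \<in> carrier k \<times> carrier A \<Longrightarrow> g (T.q (frag_of x)) = (case x of (r, a) \<Rightarrow> f r a)"
  then show thesis by (intro that[of g]) (auto simp: pure_eq)
qed

text \<open>The action of \<open>r\<close> is defined as a union over all representatives of a
  coset. It is identified with the homomorphism \<open>g\<close> that multiplies the first tensor
  factor by \<open>r\<close>, whose existence is a case of the universal property.\<close>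

lemma smult_properties:
  assumes r: "r \<in> carrier k"
  shows "(\<lambda>X. r \<odot>\<^bsub>M\<^esub> X) \<in> hom T.Q T.Q"
    and "s \<in> carrier k \<Longrightarrow> a \<in> carrier A \<Longrightarrow> r \<odot>\<^bsub>M\<^esub> pure s a = pure (r \<otimes>\<^bsub>k\<^esub> s) a"
proof -
  let ?E = "frag_extend (\<lambda>(s, a). frag_of (r \<otimes>\<^bsub>k\<^esub> s, a))"
  obtain g where g: "g \<in> hom T.Q T.Q"
    and g_pure: "\<And>s a. s \<in> carrier k \<Longrightarrow> a \<in> carrier A \<Longrightarrow> g (pure s a) = pure (r \<otimes>\<^bsub>k\<^esub> s) a"
  proof (rule biadditive_universal[OF T.Q.comm_group_axioms, of "\<lambda>s a. pure (r \<otimes>\<^bsub>k\<^esub> s) a"])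
  qed (use r in \<open>auto simp: pure_closed[unfolded M_simps] pure_add_left[unfolded M_simps]
      pure_add_right[unfolded M_simps] k.r_distr\<close>)
  \<comment> \<open>Scaling formal sums by \<open>?E\<close> lifts \<open>g\<close> to the free
    group.\<close>
  have qE: "T.q (?E x) = g (T.q x)" "Poly_Mapping.keys (?E x) \<subseteq> carrier k \<times> carrier A"
    if "Poly_Mapping.keys x \<subseteq> carrier k \<times> carrier A" for x
  proof -
    interpret g: group_hom T.Q T.Q g
      using g by (simp add: group_hom_def group_hom_axioms_def T.Q.is_group)
    have "T.q (?E x) = g (T.q x) \<and> Poly_Mapping.keys (?E x) \<subseteq> carrier k \<times> carrier A"
    proof (rule free_Abelian_group_induct[OF that])
      show "T.q (?E 0) = g (T.q 0) \<and> Poly_Mapping.keys (?E 0) \<subseteq> carrier k \<times> carrier A"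
        using T.q.hom_one g.hom_one by simp
    next
      fix x y assume x: "Poly_Mapping.keys x \<subseteq> carrier k \<times> carrier A"
        "T.q (?E x) = g (T.q x) \<and> Poly_Mapping.keys (?E x) \<subseteq> carrier k \<times> carrier A"
        and y: "Poly_Mapping.keys y \<subseteq> carrier k \<times> carrier A"
        "T.q (?E y) = g (T.q y) \<and> Poly_Mapping.keys (?E y) \<subseteq> carrier k \<times> carrier A"
      have "T.q x \<in> carrier T.Q" "T.q y \<in> carrier T.Q"
        using x y by (auto intro!: T.q.hom_closed)
      then show "T.q (?E (x - y)) = g (T.q (x - y)) \<and> Poly_Mapping.keys (?E (x - y)) \<subseteq> carrier k \<times> carrier A"
        using x y keys_diff[of "?E x" "?E y"]
        by (simp only: frag_extend_diff hom_frag_diff_group[OF T.q_hom T.Q.is_group] g.hom_mult g.hom_inv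
            T.Q.inv_closed) blast
    next
      fix p assume "p \<in> carrier k \<times> carrier A"
      then show "T.q (?E (frag_of p)) = g (T.q (frag_of p)) \<and>
          Poly_Mapping.keys (?E (frag_of p)) \<subseteq> carrier k \<times> carrier A"
        using g_pure r by (auto simp: pure_eq)
    qed
    then show "T.q (?E x) = g (T.q x)" "Poly_Mapping.keys (?E x) \<subseteq> carrier k \<times> carrier A" by auto
  qed
  have smult: "r \<odot>\<^bsub>M\<^esub> X = g X" if X: "X \<in> carrier T.Q" for X
  proof -
    obtain x where x: "x \<in> carrier T.F" "X = T.q x"
      using X T.carrier_Q by auto
    \<comment> \<open>Every representative \<open>y\<close> of the nonempty coset \<open>X\<close>
      yields the same coset \<open>g X\<close>, so the union over \<open>X\<close> collapses to
      it.\<close>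
    have "T.q (?E y) = g X" if "y \<in> X" for y
    proof -
      have "y \<in> carrier T.F"
        using that x T.F.r_coset_subset_G[OF subgroup.subset[OF T.subgroup_N]] by blast
      moreover have "T.q y = X"
        using T.F.repr_independence[OF _ x(1) T.subgroup_N] that x(2) by simp
      ultimately show ?thesis using qE(1)[of y] by simp
    qed
    moreover have "x \<in> X"
      using T.F.rcos_self[OF x(1) T.subgroup_N] x(2) by simp
    ultimately have "(\<Union>y\<in>X. T.q (?E y)) = g X"
      by blast
    then show ?thesis
      by (simp add: scalar_extension_def Let_def tensor_relations_eq tensor_free_def)
  qed
  show "(\<lambda>X. r \<odot>\<^bsub>M\<^esub> X) \<in> hom T.Q T.Q"
    using g T.Q.m_closed unfolding hom_def Pi_iff mem_Collect_eq by (metis (no_types, lifting) smult)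
  show "r \<odot>\<^bsub>M\<^esub> pure s a = pure (r \<otimes>\<^bsub>k\<^esub> s) a" if "s \<in> carrier k" "a \<in> carrier A"
    using smult[of "pure s a"] g_pure that pure_closed[of s a] by (simp add: M_simps)
qed

text \<open>Hence tensors with first factor one span the module, and linear maps need to be compared
  only there.\<close>

lemma smult_pure_one: "r \<in> carrier k \<Longrightarrow> a \<in> carrier A \<Longrightarrow> r \<odot>\<^bsub>M\<^esub> pure \<one>\<^bsub>k\<^esub> a = pure r a"
  using smult_properties(2)[of r "\<one>\<^bsub>k\<^esub>" a] by simp

lemma hom_eqI:
  assumes "f \<in> hom T.Q B" "g \<in> hom T.Q B" "group B"
    and "\<And>r a. r \<in> carrier k \<Longrightarrow> a \<in> carrier A \<Longrightarrow> f (pure r a) = g (pure r a)"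
    and "X \<in> carrier M"
  shows "f X = g X"
  by (rule T.hom_eqI[OF assms(1-3)]) (use assms(4,5) in \<open>auto simp: pure_eq M_simps\<close>)

text \<open>Needed for the action of a sum of two scalars. The pointwise product is a homomorphism
  because \<open>B\<close> is commutative.\<close>

lemma hom_mult_pointwise:
  assumes "comm_group B" "f \<in> hom T.Q B" "g \<in> hom T.Q B"
  shows "(\<lambda>X. f X \<otimes>\<^bsub>B\<^esub> g X) \<in> hom T.Q B"
proof -
  interpret B: comm_group B by fact
  show ?thesis
    using hom_in_carrier[OF assms(2)] hom_in_carrier[OF assms(3)]
    by (intro homI) (auto simp: hom_mult[OF assms(2)] hom_mult[OF assms(3)] B.m_ac
        simp del: mult_FactGroup)
qed

text \<open>The laws for sums, products and the unit of scalars compare two homomorphisms in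
  \<open>X\<close>. They are verified on pure tensors, where they become laws of
  \<open>k\<close>.\<close>

lemma module_M: "module k M"
proof (rule moduleI)
  show "cring k" by (rule cring_k)
  show "abelian_group M"
  proof (rule abelian_groupI)
    fix X assume "X \<in> carrier M"
    then show "\<exists>Y\<in>carrier M. Y \<oplus>\<^bsub>M\<^esub> X = \<zero>\<^bsub>M\<^esub>"
      unfolding M_simps using T.Q.l_inv T.Q.inv_closed by blast
  next
    show "X \<oplus>\<^bsub>M\<^esub> Y = Y \<oplus>\<^bsub>M\<^esub> X" if "X \<in> carrier M" "Y \<in> carrier M" for X Y
      using that unfolding M_simps by (rule T.Q.m_comm)
  qed (simp_all only: M_simps T.Q.m_closed T.Q.one_closed T.Q.m_assoc T.Q.l_one)
next
  fix r X assume "r \<in> carrier k" "X \<in> carrier M"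
  then show "r \<odot>\<^bsub>M\<^esub> X \<in> carrier M"
    using hom_in_carrier[OF smult_properties(1)] by (simp add: M_simps)
next
  fix r s X assume *: "r \<in> carrier k" "s \<in> carrier k" "X \<in> carrier M"
  have "(\<lambda>X. (r \<oplus>\<^bsub>k\<^esub> s) \<odot>\<^bsub>M\<^esub> X) \<in> hom T.Q T.Q" "(\<lambda>X. (r \<odot>\<^bsub>M\<^esub> X) \<otimes>\<^bsub>T.Q\<^esub> (s \<odot>\<^bsub>M\<^esub> X)) \<in> hom T.Q T.Q"
    using * by (intro smult_properties(1) hom_mult_pointwise[OF T.Q.comm_group_axioms]; simp)+
  then show "(r \<oplus>\<^bsub>k\<^esub> s) \<odot>\<^bsub>M\<^esub> X = r \<odot>\<^bsub>M\<^esub> X \<oplus>\<^bsub>M\<^esub> s \<odot>\<^bsub>M\<^esub> X"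
    unfolding M_simps(3)
    by (rule hom_eqI) (use * in \<open>auto simp: smult_properties(2) T.Q.is_group k.l_distr
        pure_add_left[unfolded M_simps] simp del: mult_FactGroup\<close>)
next
  fix r X Y assume "r \<in> carrier k" "X \<in> carrier M" "Y \<in> carrier M"
  then show "r \<odot>\<^bsub>M\<^esub> (X \<oplus>\<^bsub>M\<^esub> Y) = r \<odot>\<^bsub>M\<^esub> X \<oplus>\<^bsub>M\<^esub> r \<odot>\<^bsub>M\<^esub> Y"
    unfolding M_simps using hom_mult[OF smult_properties(1)] by blast
next
  fix r s X assume *: "r \<in> carrier k" "s \<in> carrier k" "X \<in> carrier M"
  have "(\<lambda>X. (r \<otimes>\<^bsub>k\<^esub> s) \<odot>\<^bsub>M\<^esub> X) \<in> hom T.Q T.Q" "(\<lambda>X. r \<odot>\<^bsub>M\<^esub> (s \<odot>\<^bsub>M\<^esub> X)) \<in> hom T.Q T.Q"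
    using * smult_properties(1) hom_compose[OF smult_properties(1) smult_properties(1), of s r] by (auto simp: comp_def)
  then show "(r \<otimes>\<^bsub>k\<^esub> s) \<odot>\<^bsub>M\<^esub> X = r \<odot>\<^bsub>M\<^esub> (s \<odot>\<^bsub>M\<^esub> X)"
    by (rule hom_eqI) (use * in \<open>auto simp: smult_properties(2) T.Q.is_group k.m_assoc\<close>)
next
  fix X assume *: "X \<in> carrier M"
  have "(\<lambda>X. \<one>\<^bsub>k\<^esub> \<odot>\<^bsub>M\<^esub> X) \<in> hom T.Q T.Q" "(\<lambda>X. X) \<in> hom T.Q T.Q"
    by (auto intro!: smult_properties homI)
  then show "\<one>\<^bsub>k\<^esub> \<odot>\<^bsub>M\<^esub> X = X"
    by (rule hom_eqI) (use * in \<open>auto simp: smult_properties(2) T.Q.is_group\<close>)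
qed

lemma linear_maps_hom: "f \<in> linear_maps k M P \<Longrightarrow> f \<in> hom T.Q (add_monoid P)"
  unfolding hom_def using linear_mapsD(1,2)[of f k M P] by (auto simp: M_simps simp del: mult_FactGroup)

lemma linear_maps_eqI:
  assumes "f \<in> linear_maps k M P" "g \<in> linear_maps k M P" "module k P"
    and "\<And>a. a \<in> carrier A \<Longrightarrow> f (pure \<one>\<^bsub>k\<^esub> a) = g (pure \<one>\<^bsub>k\<^esub> a)" and "X \<in> carrier M"
  shows "f X = g X"
proof -
  interpret P: module k P by fact
  show ?thesis
  proof (rule hom_eqI[OF linear_maps_hom[OF assms(1)] linear_maps_hom[OF assms(2)] P.add.is_group _ assms(5)])
    fix r a assume "r \<in> carrier k" "a \<in> carrier A"
    then show "f (pure r a) = g (pure r a)"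
      using linear_mapsD(3)[OF assms(1), of r "pure \<one>\<^bsub>k\<^esub> a"] linear_mapsD(3)[OF assms(2), of r "pure \<one>\<^bsub>k\<^esub> a"]
      by (simp add: smult_pure_one pure_closed assms(4))
  qed
qed

text \<open>The extension sends the tensor of \<open>r\<close> and \<open>a\<close> to
  \<open>r\<close> times \<open>\<phi> a\<close>. Its homogeneity is again a comparison of
  homomorphisms on pure tensors.\<close>

lemma linear_universal:
  assumes P: "module k P" and \<phi>: "\<phi> \<in> hom A (add_monoid P)"
  obtains f where "f \<in> linear_maps k M P" "\<And>a. a \<in> carrier A \<Longrightarrow> f (pure \<one>\<^bsub>k\<^esub> a) = \<phi> a"
proof -
  interpret P: module k P by fact
  have \<phi>_closed: "\<phi> a \<in> carrier P" if "a \<in> carrier A" for a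
    using hom_in_carrier[OF \<phi> that] by simp
  have \<phi>_add: "\<phi> (a \<otimes>\<^bsub>A\<^esub> b) = \<phi> a \<oplus>\<^bsub>P\<^esub> \<phi> b" if "a \<in> carrier A" "b \<in> carrier A" for a b
    using hom_mult[OF \<phi> that] by simp
  obtain f where f: "f \<in> hom T.Q (add_monoid P)"
    and f_pure: "\<And>r a. r \<in> carrier k \<Longrightarrow> a \<in> carrier A \<Longrightarrow> f (pure r a) = r \<odot>\<^bsub>P\<^esub> \<phi> a"
    by (rule biadditive_universal[OF P.a_comm_group, of "\<lambda>r a. r \<odot>\<^bsub>P\<^esub> \<phi> a"])
      (auto simp: \<phi>_closed \<phi>_add P.smult_l_distr P.smult_r_distr)
  have "f \<in> linear_maps k M P"
  proof (rule linear_mapsI)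
    show "f X \<in> carrier P" if "X \<in> carrier M" for X
      using hom_in_carrier[OF f, of X] that by (simp add: M_simps)
    show "f (X \<oplus>\<^bsub>M\<^esub> Y) = f X \<oplus>\<^bsub>P\<^esub> f Y" if "X \<in> carrier M" "Y \<in> carrier M" for X Y
      using hom_mult[OF f, of X Y] that by (simp add: M_simps del: mult_FactGroup)
    fix r X assume r: "r \<in> carrier k" and X: "X \<in> carrier M"
    have "(\<lambda>Y. r \<odot>\<^bsub>P\<^esub> Y) \<in> hom (add_monoid P) (add_monoid P)"
      using r by (intro homI) (auto simp: P.smult_r_distr)
    from hom_compose[OF f this] hom_compose[OF smult_properties(1)[OF r] f]
    have "(\<lambda>X. r \<odot>\<^bsub>P\<^esub> f X) \<in> hom T.Q (add_monoid P)" "(\<lambda>X. f (r \<odot>\<^bsub>M\<^esub> X)) \<in> hom T.Q (add_monoid P)"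
      by (auto simp: comp_def)
    from hom_eqI[OF this(2,1) P.add.is_group _ X] show "f (r \<odot>\<^bsub>M\<^esub> X) = r \<odot>\<^bsub>P\<^esub> f X"
      using r by (simp add: smult_properties(2) f_pure \<phi>_closed P.smult_assoc1)
  qed
  then show thesis
    by (rule that) (simp add: f_pure \<phi>_closed)
qed

end

section \<open>The Burnside group\<close>

text \<open>The generating set inside \<open>union_relations\<close>, named to obtain a
  \<open>presented_group\<close> once more.\<close>

definition union_relators :: "'g monoid \<Rightarrow> 'h monoid \<Rightarrow> ((nat, 'g, 'h) biset set \<Rightarrow>\<^sub>0 int) set" where
  "union_relators G H =
     {frag_of (biset_class G H (disjoint_union U V))
        - frag_of (biset_class G H U) - frag_of (biset_class G H V) |
       (U :: (nat, 'g, 'h) biset) (V :: (nat, 'g, 'h) biset).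
      is_biset G H U \<and> is_biset G H V}"

abbreviation biset_classes :: "'g monoid \<Rightarrow> 'h monoid \<Rightarrow> (nat, 'g, 'h) biset set set" where
  "biset_classes G H \<equiv> biset_class G H ` {U :: (nat, 'g, 'h) biset. is_biset G H U}"

lemma biset_class_in_biset_classes:
  fixes G :: "'g monoid" and H :: "'h monoid" and U :: "('u, 'g, 'h) biset"
  assumes U: "is_biset G H U"
  shows "biset_class G H U \<in> biset_classes G H"
proof -
  obtain V :: "(nat, 'g, 'h) biset" where "is_biset G H V" "biset_isomorphic G H U V"
    using nat_biset_exists[OF U] by blast
  then show ?thesis
    using biset_class_cong[OF _ U, of V] by blast
qed

lemma presented_group_burnside: "presented_group (biset_classes G H) (union_relators G H)"
proof
  show "union_relators G H \<subseteq> carrier (free_Abelian_group (biset_classes G H))"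
    unfolding union_relators_def
    by (safe; intro keys_frag_relation biset_class_in_biset_classes is_biset_disjoint_union)
qed

lemma union_relations_eq: "union_relations G H = generate (free_Abelian_group (biset_classes G H)) (union_relators G H)"
  by (simp add: union_relations_def biset_free_def union_relators_def)

lemma burnside_eq: "burnside G H =
    free_Abelian_group (biset_classes G H) Mod generate (free_Abelian_group (biset_classes G H)) (union_relators G H)"
  by (simp add: burnside_def union_relations_eq biset_free_def)

lemma burnside_class_eq: "burnside_class G H U =
    generate (free_Abelian_group (biset_classes G H)) (union_relators G H)
      #>\<^bsub>free_Abelian_group (biset_classes G H)\<^esub> frag_of (biset_class G H U)"
  by (simp add: burnside_class_def union_relations_eq biset_free_def)

lemma comm_group_burnside: "comm_group (burnside G H)"
proof -
  interpret B: presented_group "biset_classes G H" "union_relators G H"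
    by (rule presented_group_burnside)
  show ?thesis
    unfolding burnside_eq by (rule B.Q.comm_group_axioms)
qed

lemma burnside_class_closed:
  assumes "is_biset G H U"
  shows "burnside_class G H U \<in> carrier (burnside G H)"
proof -
  interpret B: presented_group "biset_classes G H" "union_relators G H"
    by (rule presented_group_burnside)
  show ?thesis
    unfolding burnside_eq burnside_class_eq
    using biset_class_in_biset_classes[OF assms] by (intro B.q.hom_closed) simp
qed

lemma burnside_class_cong:
  "biset_isomorphic G H U V \<Longrightarrow> is_biset G H U \<Longrightarrow> burnside_class G H U = burnside_class G H V"
  unfolding burnside_class_def using biset_class_cong by metis

text \<open>The relators speak of bisets on \<open>nat\<close> only, so \<open>U\<close> and
  \<open>V\<close> are first replaced by copies there.\<close>

lemma burnside_class_disjoint_union: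
  fixes G :: "'g monoid" and H :: "'h monoid" and U :: "('u, 'g, 'h) biset" and V :: "('v, 'g, 'h) biset"
  assumes U: "is_biset G H U" and V: "is_biset G H V"
  shows "burnside_class G H (disjoint_union U V) =
    burnside_class G H U \<otimes>\<^bsub>burnside G H\<^esub> burnside_class G H V"
proof -
  interpret B: presented_group "biset_classes G H" "union_relators G H"
    by (rule presented_group_burnside)
  obtain U' :: "(nat, 'g, 'h) biset" where U': "is_biset G H U'" "biset_isomorphic G H U U'"
    using nat_biset_exists[OF U] by blast
  obtain V' :: "(nat, 'g, 'h) biset" where V': "is_biset G H V'" "biset_isomorphic G H V V'"
    using nat_biset_exists[OF V] by blast
  have "burnside_class G H (disjoint_union U' V') =
      burnside_class G H U' \<otimes>\<^bsub>burnside G H\<^esub> burnside_class G H V'"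
    unfolding burnside_eq burnside_class_eq
    by (rule B.q_relation)
      (use U'(1) V'(1) in \<open>auto simp: union_relators_def intro!: biset_class_in_biset_classes is_biset_disjoint_union\<close>)
  moreover have "burnside_class G H (disjoint_union U V) = burnside_class G H (disjoint_union U' V')"
    by (intro burnside_class_cong disjoint_union_cong is_biset_disjoint_union U V U' V')
  moreover have "burnside_class G H U = burnside_class G H U'" "burnside_class G H V = burnside_class G H V'"
    by (rule burnside_class_cong, fact, fact)+
  ultimately show ?thesis by simp
qed

lemma burnside_hom_eqI:
  assumes "f \<in> hom (burnside G H) A" "g \<in> hom (burnside G H) A" "group A"
    and "\<And>U :: (nat, 'g, 'h) biset. is_biset G H U \<Longrightarrow> f (burnside_class G H U) = g (burnside_class G H U)"
    and "X \<in> carrier (burnside (G :: 'g monoid) (H :: 'h monoid))"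
  shows "f X = g X"
proof -
  interpret B: presented_group "biset_classes G H" "union_relators G H"
    by (rule presented_group_burnside)
  show ?thesis
    by (rule B.hom_eqI[OF assms(1-3)[unfolded burnside_eq] _ assms(5)[unfolded burnside_eq]])
      (auto simp: assms(4)[unfolded burnside_class_eq])
qed

text \<open>A disjoint union of bisets on \<open>nat\<close> lives on a sum type, outside the domain
  of \<open>\<phi>\<close>. Additivity is therefore stated for every \<open>W\<close> on
  \<open>nat\<close> that is isomorphic to the union.\<close>

lemma burnside_universal:
  fixes G :: "'g monoid" and H :: "'h monoid" and \<phi> :: "(nat, 'g, 'h) biset \<Rightarrow> 'a"
  assumes A: "comm_group A"
    and closed: "\<And>U. is_biset G H U \<Longrightarrow> \<phi> U \<in> carrier A"
    and cong: "\<And>U V. is_biset G H U \<Longrightarrow> is_biset G H V \<Longrightarrow> biset_isomorphic G H U V \<Longrightarrow> \<phi> U = \<phi> V"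
    and union: "\<And>U V W. is_biset G H U \<Longrightarrow> is_biset G H V \<Longrightarrow> is_biset G H W \<Longrightarrow>
      biset_isomorphic G H (disjoint_union U V) W \<Longrightarrow> \<phi> W = \<phi> U \<otimes>\<^bsub>A\<^esub> \<phi> V"
  obtains f where "f \<in> hom (burnside G H) A" "\<And>U. is_biset G H U \<Longrightarrow> f (burnside_class G H U) = \<phi> U"
proof -
  interpret B: presented_group "biset_classes G H" "union_relators G H"
    by (rule presented_group_burnside)
  \<comment> \<open>Generators are classes while \<open>\<phi>\<close> takes bisets. A
    representative is chosen, and by \<open>cong\<close> the choice does not matter.\<close>
  define \<phi>' where "\<phi>' c = \<phi> (SOME U. is_biset G H U \<and> biset_class G H U = c)" for c
  have \<phi>': "\<phi>' (biset_class G H U) = \<phi> U" if U: "is_biset G H U" for U :: "(nat, 'g, 'h) biset"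
  proof -
    let ?V = "SOME V :: (nat, 'g, 'h) biset. is_biset G H V \<and> biset_class G H V = biset_class G H U"
    have "is_biset G H ?V \<and> biset_class G H ?V = biset_class G H U"
      by (rule someI[of _ U]) (simp add: U)
    then show ?thesis
      using cong[of ?V U] U biset_class_eq_iff[of G H ?V U] by (simp add: \<phi>'_def)
  qed
  obtain f where "f \<in> hom B.Q A" "\<And>c. c \<in> biset_classes G H \<Longrightarrow> f (B.q (frag_of c)) = \<phi>' c"
  proof (rule B.universal[OF A, of \<phi>'])
    show "\<phi>' ` biset_classes G H \<subseteq> carrier A"
      using closed by (auto simp: \<phi>')
    fix h r assume h: "h \<in> hom B.F A" "\<And>c. c \<in> biset_classes G H \<Longrightarrow> h (frag_of c) = \<phi>' c"
      and "r \<in> union_relators G H"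
    then obtain U V :: "(nat, 'g, 'h) biset" where U: "is_biset G H U" and V: "is_biset G H V"
      and r: "r = frag_of (biset_class G H (disjoint_union U V))
        - frag_of (biset_class G H U) - frag_of (biset_class G H V)"
      unfolding union_relators_def by blast
    have UV: "is_biset G H (disjoint_union U V)"
      by (rule is_biset_disjoint_union[OF U V])
    obtain W :: "(nat, 'g, 'h) biset" where W: "is_biset G H W" "biset_isomorphic G H (disjoint_union U V) W"
      using nat_biset_exists[OF UV] by blast
    note mem = biset_class_in_biset_classes
    show "h r = \<one>\<^bsub>A\<^esub>"
      unfolding r
    proof (rule hom_frag_relation[OF h(1) A mem[OF UV] mem[OF U] mem[OF V]])
      show "h (frag_of (biset_class G H (disjoint_union U V))) =
          h (frag_of (biset_class G H U)) \<otimes>\<^bsub>A\<^esub> h (frag_of (biset_class G H V))"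
        unfolding biset_class_cong[OF W(2) UV] h(2)[OF mem[OF W(1)]] h(2)[OF mem[OF U]] h(2)[OF mem[OF V]]
        using U V W union by (simp add: \<phi>')
    qed
  qed blast
  then show thesis
    by (intro that[of f]) (auto simp: burnside_eq burnside_class_eq \<phi>')
qed

section \<open>The modules \<open>kB\<close> and linear maps out of them\<close>

lemma scalar_extension_burnside: "cring k \<Longrightarrow> scalar_extension_of_group k (burnside G H)"
  by (simp add: scalar_extension_of_group_def comm_group_burnside)

lemma module_kB: "cring k \<Longrightarrow> module k (kB k G H)"
  unfolding kB_def by (rule scalar_extension_of_group.module_M[OF scalar_extension_burnside])

lemma kB_class_closed:
  assumes "cring k" "is_biset G H U"
  shows "kB_class k G H U \<in> carrier (kB k G H)"
proof -
  interpret E: scalar_extension_of_group k "burnside G H"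
    by (rule scalar_extension_burnside[OF assms(1)])
  show ?thesis
    unfolding kB_class_def kB_def by (intro E.pure_closed E.k.one_closed burnside_class_closed assms(2))
qed

lemma kB_class_cong:
  "biset_isomorphic G H U V \<Longrightarrow> is_biset G H U \<Longrightarrow> kB_class k G H U = kB_class k G H V"
  unfolding kB_class_def using burnside_class_cong by metis

lemma kB_class_disjoint_union:
  assumes "cring k" "is_biset G H U" "is_biset G H V"
  shows "kB_class k G H (disjoint_union U V) = kB_class k G H U \<oplus>\<^bsub>kB k G H\<^esub> kB_class k G H V"
proof -
  interpret E: scalar_extension_of_group k "burnside G H"
    by (rule scalar_extension_burnside[OF assms(1)])
  show ?thesis
    unfolding kB_class_def kB_def burnside_class_disjoint_union[OF assms(2,3)]
    by (intro E.pure_add_right E.k.one_closed burnside_class_closed assms(2,3))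
qed

text \<open>Classes of bisets span: tensors with first factor one span the scalar extension, and
  classes of bisets generate the Burnside group.\<close>

lemma kB_linear_eqI:
  fixes G :: "'g monoid" and H :: "'h monoid"
  assumes k: "cring k" and f: "f \<in> linear_maps k (kB k G H) M" and g: "g \<in> linear_maps k (kB k G H) M"
    and M: "module k M"
    and eq: "\<And>U :: (nat, 'g, 'h) biset. is_biset G H U \<Longrightarrow> f (kB_class k G H U) = g (kB_class k G H U)"
    and X: "X \<in> carrier (kB k G H)"
  shows "f X = g X"
proof -
  interpret E: scalar_extension_of_group k "burnside G H"
    by (rule scalar_extension_burnside[OF k])
  interpret M: module k M by (rule M)
  \<comment> \<open>On tensors with first factor one, a linear map restricts to a homomorphism from
    the Burnside group.\<close>
  have hom: "(\<lambda>a. h (E.pure \<one>\<^bsub>k\<^esub> a)) \<in> hom (burnside G H) (add_monoid M)"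
    if "h \<in> linear_maps k (kB k G H) M" for h
    using linear_mapsD(1,2)[OF that] E.pure_closed E.pure_add_right
    by (intro homI) (auto simp: kB_def)
  show ?thesis
  proof (rule E.linear_maps_eqI[OF f[unfolded kB_def] g[unfolded kB_def] M _ X[unfolded kB_def]])
    show "f (E.pure \<one>\<^bsub>k\<^esub> a) = g (E.pure \<one>\<^bsub>k\<^esub> a)" if "a \<in> carrier (burnside G H)" for a
      by (rule burnside_hom_eqI[OF hom[OF f] hom[OF g] M.add.is_group _ that])
        (rule eq[unfolded kB_class_def])
  qed
qed

text \<open>The universal property of the Burnside group followed by that of the scalar
  extension.\<close>

lemma kB_universal:
  fixes G :: "'g monoid" and H :: "'h monoid" and \<phi> :: "(nat, 'g, 'h) biset \<Rightarrow> 'a"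
  assumes k: "cring k" and M: "module k M"
    and closed: "\<And>U. is_biset G H U \<Longrightarrow> \<phi> U \<in> carrier M"
    and cong: "\<And>U V. is_biset G H U \<Longrightarrow> is_biset G H V \<Longrightarrow> biset_isomorphic G H U V \<Longrightarrow> \<phi> U = \<phi> V"
    and union: "\<And>U V W. is_biset G H U \<Longrightarrow> is_biset G H V \<Longrightarrow> is_biset G H W \<Longrightarrow>
      biset_isomorphic G H (disjoint_union U V) W \<Longrightarrow> \<phi> W = \<phi> U \<oplus>\<^bsub>M\<^esub> \<phi> V"
  obtains f where "f \<in> linear_maps k (kB k G H) M" "\<And>U. is_biset G H U \<Longrightarrow> f (kB_class k G H U) = \<phi> U"
proof -
  interpret E: scalar_extension_of_group k "burnside G H"
    by (rule scalar_extension_burnside[OF k])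
  interpret M: module k M by (rule M)
  obtain f where f: "f \<in> hom (burnside G H) (add_monoid M)"
    and f_class: "\<And>U. is_biset G H U \<Longrightarrow> f (burnside_class G H U) = \<phi> U"
  proof (rule burnside_universal[OF M.a_comm_group, of G H \<phi>])
  qed (use closed cong union in auto)
  obtain f' where "f' \<in> linear_maps k E.M M"
    and "\<And>a. a \<in> carrier (burnside G H) \<Longrightarrow> f' (E.pure \<one>\<^bsub>k\<^esub> a) = f a"
    using E.linear_universal[OF M f] by blast
  then show thesis
    by (intro that[of f']) (simp_all add: kB_def kB_class_def f_class burnside_class_closed)
qed

section \<open>Composition in the biset category\<close>

text \<open>Linearity in the first variable is used with a class of a biset in the second; then the
  second variable is freed. Extensionality turns agreement on the carriers into equality of
  functions, as uniqueness in a definite description demands.\<close>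

lemma kB_bilinear_eqI:
  fixes G :: "'g monoid" and H :: "'h monoid" and K :: "'l monoid"
  assumes k: "cring k" and P: "module k P"
    and f: "f \<in> bilinear_maps k (kB k G H) (kB k H K) P"
    and g: "g \<in> bilinear_maps k (kB k G H) (kB k H K) P"
    and eq: "\<And>(U :: (nat, 'g, 'h) biset) (W :: (nat, 'h, 'l) biset). is_biset G H U \<Longrightarrow> is_biset H K W \<Longrightarrow>
      f (kB_class k G H U, kB_class k H K W) = g (kB_class k G H U, kB_class k H K W)"
  shows "f = g"
proof (rule extensionalityI)
  show "f \<in> extensional (carrier (kB k G H) \<times> carrier (kB k H K))"
    "g \<in> extensional (carrier (kB k G H) \<times> carrier (kB k H K))"
    using f g by (auto simp: bilinear_maps_def)
  fix z assume "z \<in> carrier (kB k G H) \<times> carrier (kB k H K)"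
  then obtain x y where z: "z = (x, y)" and x: "x \<in> carrier (kB k G H)" and y: "y \<in> carrier (kB k H K)"
    by blast
  have left: "(\<lambda>x. h (x, y)) \<in> linear_maps k (kB k G H) P"
    if "h \<in> bilinear_maps k (kB k G H) (kB k H K) P" "y \<in> carrier (kB k H K)" for h y
    using that by (auto simp: bilinear_maps_def)
  have right: "(\<lambda>y. h (x, y)) \<in> linear_maps k (kB k H K) P"
    if "h \<in> bilinear_maps k (kB k G H) (kB k H K) P" for h
    using that x by (auto simp: bilinear_maps_def)
  have "f (x, kB_class k H K W) = g (x, kB_class k H K W)" if W: "is_biset H K W" for W :: "(nat, 'h, 'l) biset"
    by (rule kB_linear_eqI[OF k left[OF f] left[OF g] P _ x]) (intro kB_class_closed k W eq | assumption)+
  then show "f z = g z"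
    unfolding z by (rule kB_linear_eqI[OF k right[OF f] right[OF g] P _ y])
qed

text \<open>Two linear extensions in turn: for each biset \<open>W\<close>, tensoring with
  \<open>W\<close> extends to a linear map \<open>\<Lambda> W\<close> in the first variable; for
  each \<open>x\<close>, the assignment of \<open>\<Lambda> W x\<close> to \<open>W\<close> extends
  to a linear map \<open>P x\<close> in the second.\<close>

lemma kB_comp_exists:
  fixes G :: "'g monoid" and H :: "'h monoid" and K :: "'l monoid"
  assumes k: "cring k" and grp: "group G" "group H" "group K"
  shows "\<exists>f \<in> bilinear_maps k (kB k G H) (kB k H K) (kB k G K).
    \<forall>(U :: (nat, 'g, 'h) biset) (W :: (nat, 'h, 'l) biset). is_biset G H U \<longrightarrow> is_biset H K W \<longrightarrow>
      f (kB_class k G H U, kB_class k H K W) = kB_class k G K (biset_tensor H U W)"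
proof -
  note modules = module_kB[OF k]
  interpret GH: module k "kB k G H" by (rule modules)
  interpret HK: module k "kB k H K" by (rule modules)
  interpret GK: module k "kB k G K" by (rule modules)
  have tensor: "is_biset G K (biset_tensor H U W)"
    if "is_biset G H U" "is_biset H K W" for U :: "('u, 'g, 'h) biset" and W :: "('w, 'h, 'l) biset"
    using biset_pair.is_biset_tensor[OF biset_pair.intro[OF grp that]] .
  have "\<exists>f. f \<in> linear_maps k (kB k G H) (kB k G K) \<and> (\<forall>U :: (nat, 'g, 'h) biset.
      is_biset G H U \<longrightarrow> f (kB_class k G H U) = kB_class k G K (biset_tensor H U W))"
    if W: "is_biset H K W" for W :: "(nat, 'h, 'l) biset"
  proof -
    obtain f where "f \<in> linear_maps k (kB k G H) (kB k G K)"
      "\<And>U :: (nat, 'g, 'h) biset. is_biset G H U \<Longrightarrow> f (kB_class k G H U) = kB_class k G K (biset_tensor H U W)"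
    proof (rule kB_universal[OF k modules])
      fix U :: "(nat, 'g, 'h) biset" assume U: "is_biset G H U"
      show "kB_class k G K (biset_tensor H U W) \<in> carrier (kB k G K)"
        by (intro kB_class_closed k tensor U W)
      fix V :: "(nat, 'g, 'h) biset" assume V: "is_biset G H V"
      show "kB_class k G K (biset_tensor H U W) = kB_class k G K (biset_tensor H V W)"
        if "biset_isomorphic G H U V"
        by (intro kB_class_cong biset_tensor_cong biset_isomorphic_refl tensor grp U V W that)
      fix T :: "(nat, 'g, 'h) biset" assume T: "is_biset G H T"
        and iso: "biset_isomorphic G H (disjoint_union U V) T"
      have UV: "is_biset G H (disjoint_union U V)"
        by (rule is_biset_disjoint_union[OF U V])
      have "kB_class k G K (biset_tensor H T W) = kB_class k G K (biset_tensor H (disjoint_union U V) W)"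
        by (rule kB_class_cong[symmetric])
          (intro biset_tensor_cong biset_isomorphic_refl tensor grp UV T W iso)+
      also have "\<dots> = kB_class k G K (disjoint_union (biset_tensor H U W) (biset_tensor H V W))"
        by (intro kB_class_cong biset_tensor_union_left tensor grp UV U V W)
      also have "\<dots> = kB_class k G K (biset_tensor H U W) \<oplus>\<^bsub>kB k G K\<^esub> kB_class k G K (biset_tensor H V W)"
        by (intro kB_class_disjoint_union k tensor U V W)
      finally show "kB_class k G K (biset_tensor H T W) =
        kB_class k G K (biset_tensor H U W) \<oplus>\<^bsub>kB k G K\<^esub> kB_class k G K (biset_tensor H V W)" .
    qed blast
    then show ?thesis by blast
  qed
  then obtain \<Lambda> where \<Lambda>: "\<And>W :: (nat, 'h, 'l) biset. is_biset H K W \<Longrightarrow> \<Lambda> W \<in> linear_maps k (kB k G H) (kB k G K)"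
    and \<Lambda>_class: "\<And>(W :: (nat, 'h, 'l) biset) (U :: (nat, 'g, 'h) biset). is_biset H K W \<Longrightarrow> is_biset G H U \<Longrightarrow>
      \<Lambda> W (kB_class k G H U) = kB_class k G K (biset_tensor H U W)"
    by metis
  \<comment> \<open>Invariance and additivity in \<open>W\<close> are equations between linear maps
    in \<open>x\<close>. So \<open>x\<close> may be taken to be the class of a biset, where they are
    properties of the tensor product.\<close>
  have "\<exists>f. f \<in> linear_maps k (kB k H K) (kB k G K) \<and> (\<forall>W :: (nat, 'h, 'l) biset.
      is_biset H K W \<longrightarrow> f (kB_class k H K W) = \<Lambda> W x)" if x: "x \<in> carrier (kB k G H)" for x
  proof -
    obtain f where "f \<in> linear_maps k (kB k H K) (kB k G K)"
      "\<And>W :: (nat, 'h, 'l) biset. is_biset H K W \<Longrightarrow> f (kB_class k H K W) = \<Lambda> W x"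
    proof (rule kB_universal[OF k modules])
      fix W :: "(nat, 'h, 'l) biset" assume W: "is_biset H K W"
      show "\<Lambda> W x \<in> carrier (kB k G K)"
        by (rule linear_mapsD(1)[OF \<Lambda>[OF W] x])
      fix V :: "(nat, 'h, 'l) biset" assume V: "is_biset H K V"
      show "\<Lambda> W x = \<Lambda> V x" if iso: "biset_isomorphic H K W V"
      proof (rule kB_linear_eqI[OF k \<Lambda>[OF W] \<Lambda>[OF V] modules _ x])
        fix U :: "(nat, 'g, 'h) biset" assume U: "is_biset G H U"
        have "kB_class k G K (biset_tensor H U W) = kB_class k G K (biset_tensor H U V)"
          by (intro kB_class_cong biset_tensor_cong biset_isomorphic_refl tensor grp U V W iso)
        then show "\<Lambda> W (kB_class k G H U) = \<Lambda> V (kB_class k G H U)"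
          by (simp add: \<Lambda>_class U V W)
      qed
      fix T :: "(nat, 'h, 'l) biset" assume T: "is_biset H K T"
        and iso: "biset_isomorphic H K (disjoint_union W V) T"
      have WV: "is_biset H K (disjoint_union W V)"
        by (rule is_biset_disjoint_union[OF W V])
      show "\<Lambda> T x = \<Lambda> W x \<oplus>\<^bsub>kB k G K\<^esub> \<Lambda> V x"
      proof (rule kB_linear_eqI[OF k \<Lambda>[OF T] linear_maps_add[OF \<Lambda>[OF W] \<Lambda>[OF V] modules] modules _ x])
        fix U :: "(nat, 'g, 'h) biset" assume U: "is_biset G H U"
        have "kB_class k G K (biset_tensor H U T) = kB_class k G K (biset_tensor H U (disjoint_union W V))"
          by (rule kB_class_cong[symmetric])
            (intro biset_tensor_cong biset_isomorphic_refl tensor grp WV T U iso)+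
        also have "\<dots> = kB_class k G K (disjoint_union (biset_tensor H U W) (biset_tensor H U V))"
          by (intro kB_class_cong biset_tensor_union_right tensor grp WV U V W)
        also have "\<dots> = kB_class k G K (biset_tensor H U W) \<oplus>\<^bsub>kB k G K\<^esub> kB_class k G K (biset_tensor H U V)"
          by (intro kB_class_disjoint_union k tensor U V W)
        finally show "\<Lambda> T (kB_class k G H U) =
            \<Lambda> W (kB_class k G H U) \<oplus>\<^bsub>kB k G K\<^esub> \<Lambda> V (kB_class k G H U)"
          by (simp add: \<Lambda>_class U V W T)
      qed
    qed blast
    then show ?thesis by blast
  qed
  then obtain P where P: "\<And>x. x \<in> carrier (kB k G H) \<Longrightarrow> P x \<in> linear_maps k (kB k H K) (kB k G K)"
    and P_class: "\<And>x (W :: (nat, 'h, 'l) biset). x \<in> carrier (kB k G H) \<Longrightarrow> is_biset H K W \<Longrightarrow>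
      P x (kB_class k H K W) = \<Lambda> W x"
    by metis
  \<comment> \<open>Restricted to the carriers, since \<open>bilinear_maps\<close> consists of
    extensional functions.\<close>
  define f where "f = restrict (\<lambda>(x, y). P x y) (carrier (kB k G H) \<times> carrier (kB k H K))"
  have f: "f (x, y) = P x y" if "x \<in> carrier (kB k G H)" "y \<in> carrier (kB k H K)" for x y
    using that by (simp add: f_def)
  have "f \<in> bilinear_maps k (kB k G H) (kB k H K) (kB k G K)"
    unfolding bilinear_maps_def
  proof (intro CollectI conjI ballI)
    show "f \<in> extensional (carrier (kB k G H) \<times> carrier (kB k H K))"
      by (simp add: f_def)
  next
    fix y assume y: "y \<in> carrier (kB k H K)"
    show "(\<lambda>x. f (x, y)) \<in> linear_maps k (kB k G H) (kB k G K)"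
    proof (rule linear_mapsI)
      fix x assume "x \<in> carrier (kB k G H)"
      then show "f (x, y) \<in> carrier (kB k G K)"
        using y by (simp add: f linear_mapsD(1)[OF P])
    next
      fix x x' assume x: "x \<in> carrier (kB k G H)" "x' \<in> carrier (kB k G H)"
      then have xx': "x \<oplus>\<^bsub>kB k G H\<^esub> x' \<in> carrier (kB k G H)" by blast
      \<comment> \<open>Additivity in \<open>x\<close> is visible when \<open>y\<close> is the class
        of a biset \<open>W\<close>, where \<open>P x y\<close> is \<open>\<Lambda> W x\<close>.
        Both sides are linear in \<open>y\<close>, so this is enough; homogeneity is treated in the
        same way.\<close>
      have "P (x \<oplus>\<^bsub>kB k G H\<^esub> x') y = P x y \<oplus>\<^bsub>kB k G K\<^esub> P x' y"
        by (rule kB_linear_eqI[OF k P[OF xx'] linear_maps_add[OF P[OF x(1)] P[OF x(2)] modules] modules _ y])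
          (simp add: P_class x xx' linear_mapsD(2)[OF \<Lambda>])
      then show "f (x \<oplus>\<^bsub>kB k G H\<^esub> x', y) = f (x, y) \<oplus>\<^bsub>kB k G K\<^esub> f (x', y)"
        by (simp add: f x xx' y)
    next
      fix r x assume r: "r \<in> carrier k" and x: "x \<in> carrier (kB k G H)"
      then have rx: "r \<odot>\<^bsub>kB k G H\<^esub> x \<in> carrier (kB k G H)" by blast
      have "P (r \<odot>\<^bsub>kB k G H\<^esub> x) y = r \<odot>\<^bsub>kB k G K\<^esub> P x y"
        by (rule kB_linear_eqI[OF k P[OF rx] linear_maps_smult[OF P[OF x] modules r] modules _ y])
          (simp add: P_class x r rx linear_mapsD(3)[OF \<Lambda>])
      then show "f (r \<odot>\<^bsub>kB k G H\<^esub> x, y) = r \<odot>\<^bsub>kB k G K\<^esub> f (x, y)"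
        by (simp add: f x rx y)
    qed
  next
    fix x assume x: "x \<in> carrier (kB k G H)"
    show "(\<lambda>y. f (x, y)) \<in> linear_maps k (kB k H K) (kB k G K)"
      by (rule linear_maps_cong[OF P[OF x] modules]) (simp add: f x)
  qed
  moreover have "f (kB_class k G H U, kB_class k H K W) = kB_class k G K (biset_tensor H U W)"
    if "is_biset G H U" "is_biset H K W" for U :: "(nat, 'g, 'h) biset" and W :: "(nat, 'h, 'l) biset"
    using that by (simp add: f P_class \<Lambda>_class kB_class_closed k)
  ultimately show ?thesis by blast
qed

lemma kB_comp_properties:
  fixes G :: "'g monoid" and H :: "'h monoid" and K :: "'l monoid"
  assumes k: "cring k" and grp: "group G" "group H" "group K"
  shows "kB_comp k G H K \<in> bilinear_maps k (kB k G H) (kB k H K) (kB k G K) \<and>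
    (\<forall>(U :: (nat, 'g, 'h) biset) (W :: (nat, 'h, 'l) biset). is_biset G H U \<longrightarrow> is_biset H K W \<longrightarrow>
      kB_comp k G H K (kB_class k G H U, kB_class k H K W) = kB_class k G K (biset_tensor H U W))"
proof -
  obtain f where f: "f \<in> bilinear_maps k (kB k G H) (kB k H K) (kB k G K) \<and>
    (\<forall>(U :: (nat, 'g, 'h) biset) (W :: (nat, 'h, 'l) biset). is_biset G H U \<longrightarrow> is_biset H K W \<longrightarrow>
      f (kB_class k G H U, kB_class k H K W) = kB_class k G K (biset_tensor H U W))"
    using kB_comp_exists[OF assms] by blast
  have "\<exists>!f. f \<in> bilinear_maps k (kB k G H) (kB k H K) (kB k G K) \<and>
    (\<forall>(U :: (nat, 'g, 'h) biset) (W :: (nat, 'h, 'l) biset). is_biset G H U \<longrightarrow> is_biset H K W \<longrightarrow>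
      f (kB_class k G H U, kB_class k H K W) = kB_class k G K (biset_tensor H U W))"
  proof (rule ex1I)
    fix g assume g: "g \<in> bilinear_maps k (kB k G H) (kB k H K) (kB k G K) \<and>
      (\<forall>(U :: (nat, 'g, 'h) biset) (W :: (nat, 'h, 'l) biset). is_biset G H U \<longrightarrow> is_biset H K W \<longrightarrow>
        g (kB_class k G H U, kB_class k H K W) = kB_class k G K (biset_tensor H U W))"
    show "g = f"
      using f g by (intro kB_bilinear_eqI[OF k module_kB[OF k], of g G H K G K f]) simp_all
  qed (rule f)
  from theI'[OF this] show ?thesis
    unfolding kB_comp_def .
qed

text \<open>The definite description speaks of bisets on \<open>nat\<close>, whereas a tensor
  product lives on sets of pairs. Passing to copies on \<open>nat\<close> on both sides is what
  allows composites of classes to be iterated.\<close>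

lemma kB_comp_class:
  fixes G :: "'g monoid" and H :: "'h monoid" and K :: "'l monoid"
    and U :: "('u, 'g, 'h) biset" and W :: "('w, 'h, 'l) biset"
  assumes k: "cring k" and grp: "group G" "group H" "group K"
    and U: "is_biset G H U" and W: "is_biset H K W"
  shows "kB_comp k G H K (kB_class k G H U, kB_class k H K W) = kB_class k G K (biset_tensor H U W)"
proof -
  obtain U' :: "(nat, 'g, 'h) biset" where U': "is_biset G H U'" "biset_isomorphic G H U U'"
    using nat_biset_exists[OF U] by blast
  obtain W' :: "(nat, 'h, 'l) biset" where W': "is_biset H K W'" "biset_isomorphic H K W W'"
    using nat_biset_exists[OF W] by blast
  have "kB_comp k G H K (kB_class k G H U', kB_class k H K W') = kB_class k G K (biset_tensor H U' W')"
    using kB_comp_properties[OF k grp] U' W' by blast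
  moreover have "kB_class k G K (biset_tensor H U W) = kB_class k G K (biset_tensor H U' W')"
    by (intro kB_class_cong biset_tensor_cong grp U W U' W' biset_pair.is_biset_tensor[OF biset_pair.intro])
  moreover have "kB_class k G H U = kB_class k G H U'" "kB_class k H K W = kB_class k H K W'"
    by (rule kB_class_cong, fact, fact)+
  ultimately show ?thesis by simp
qed

lemma kB_comp_linear:
  assumes "cring k" "group G" "group H" "group K"
  shows "y \<in> carrier (kB k H K) \<Longrightarrow> (\<lambda>x. kB_comp k G H K (x, y)) \<in> linear_maps k (kB k G H) (kB k G K)"
    and "x \<in> carrier (kB k G H) \<Longrightarrow> (\<lambda>y. kB_comp k G H K (x, y)) \<in> linear_maps k (kB k H K) (kB k G K)"
  using kB_comp_properties[OF assms] unfolding bilinear_maps_def by blast+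

lemma kB_comp_closed:
  assumes "cring k" "group G" "group H" "group K" "x \<in> carrier (kB k G H)" "y \<in> carrier (kB k H K)"
  shows "kB_comp k G H K (x, y) \<in> carrier (kB k G K)"
  using linear_mapsD(1)[OF kB_comp_linear(1)[OF assms(1-4,6)] assms(5)] .

text \<open>Starting from three bisets, the variables \<open>x\<close>, \<open>y\<close> and
  \<open>z\<close> are freed in this order. At each stage both sides are linear in the variable
  being freed.\<close>

lemma kB_comp_assoc:
  fixes G :: "'g monoid" and H :: "'h monoid" and K :: "'l monoid" and L :: "'m monoid"
  assumes k: "cring k" and grp: "group G" "group H" "group K" "group L"
    and x: "x \<in> carrier (kB k G H)" and y: "y \<in> carrier (kB k H K)" and z: "z \<in> carrier (kB k K L)"
  shows "kB_comp k G K L (kB_comp k G H K (x, y), z) = kB_comp k G H L (x, kB_comp k H K L (y, z))"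
proof -
  note modules = module_kB[OF k]
  note lin = kB_comp_linear[OF k]
  note tensor = biset_pair.is_biset_tensor[OF biset_pair.intro]
  note closed = kB_class_closed[OF k]
  have 1: "kB_comp k G K L (kB_comp k G H K (kB_class k G H U, kB_class k H K V), kB_class k K L W) =
      kB_comp k G H L (kB_class k G H U, kB_comp k H K L (kB_class k H K V, kB_class k K L W))"
    if U: "is_biset G H U" and V: "is_biset H K V" and W: "is_biset K L W"
    for U :: "(nat, 'g, 'h) biset" and V :: "(nat, 'h, 'l) biset" and W :: "(nat, 'l, 'm) biset"
  proof -
    have "kB_class k G L (biset_tensor K (biset_tensor H U V) W) =
        kB_class k G L (biset_tensor H U (biset_tensor K V W))"
      by (intro kB_class_cong biset_tensor_assoc tensor grp U V W)
    then show ?thesis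
      by (simp add: kB_comp_class k grp U V W tensor)
  qed
  have 2: "kB_comp k G K L (kB_comp k G H K (x, kB_class k H K V), kB_class k K L W) =
      kB_comp k G H L (x, kB_comp k H K L (kB_class k H K V, kB_class k K L W))"
    if V: "is_biset H K V" and W: "is_biset K L W" for V :: "(nat, 'h, 'l) biset" and W :: "(nat, 'l, 'm) biset"
    by (rule kB_linear_eqI[OF k linear_maps_compose[OF lin(1)[OF grp(1-3) closed[OF V]] lin(1)[OF grp(1,3,4) closed[OF W]]]
        lin(1)[OF grp(1,2,4) kB_comp_closed[OF k grp(2-4) closed[OF V] closed[OF W]]] modules 1[OF _ V W] x])
  have 3: "kB_comp k G K L (kB_comp k G H K (x, y), kB_class k K L W) =
      kB_comp k G H L (x, kB_comp k H K L (y, kB_class k K L W))"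
    if W: "is_biset K L W" for W :: "(nat, 'l, 'm) biset"
    by (rule kB_linear_eqI[OF k linear_maps_compose[OF lin(2)[OF grp(1-3) x] lin(1)[OF grp(1,3,4) closed[OF W]]]
        linear_maps_compose[OF lin(1)[OF grp(2-4) closed[OF W]] lin(2)[OF grp(1,2,4) x]] modules 2[OF _ W] y])
  show ?thesis
    by (rule kB_linear_eqI[OF k lin(2)[OF grp(1,3,4) kB_comp_closed[OF k grp(1-3) x y]]
        linear_maps_compose[OF lin(2)[OF grp(2-4) y] lin(2)[OF grp(1,2,4) x]] modules 3 z])
qed

section \<open>Unit laws and the linear category of bisets\<close>

lemma linear_maps_id: "(\<lambda>x. x) \<in> linear_maps k M M"
  by (rule linear_mapsI) simp_all

lemma kB_comp_ident_left:
  fixes G :: "'g monoid" and H :: "'h monoid"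
  assumes k: "cring k" and grp: "group G" "group H" and fin: "finite (carrier G)"
    and x: "x \<in> carrier (kB k G H)"
  shows "kB_comp k G G H (kB_class k G G (group_biset G), x) = x"
proof (rule kB_linear_eqI[OF k _ linear_maps_id module_kB[OF k] _ x])
  note gb = is_biset_group_biset[OF grp(1) fin]
  show "(\<lambda>x. kB_comp k G G H (kB_class k G G (group_biset G), x)) \<in> linear_maps k (kB k G H) (kB k G H)"
    by (intro kB_comp_linear kB_class_closed k grp gb)
  show "kB_comp k G G H (kB_class k G G (group_biset G), kB_class k G H U) = kB_class k G H U"
    if U: "is_biset G H U" for U :: "(nat, 'g, 'h) biset"
    unfolding kB_comp_class[OF k grp(1,1,2) gb U]
    by (intro kB_class_cong biset_tensor_group_left biset_pair.is_biset_tensor[OF biset_pair.intro] grp fin gb U)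
qed

lemma kB_comp_ident_right:
  fixes G :: "'g monoid" and H :: "'h monoid"
  assumes k: "cring k" and grp: "group G" "group H" and fin: "finite (carrier H)"
    and x: "x \<in> carrier (kB k G H)"
  shows "kB_comp k G H H (x, kB_class k H H (group_biset H)) = x"
proof (rule kB_linear_eqI[OF k _ linear_maps_id module_kB[OF k] _ x])
  note gb = is_biset_group_biset[OF grp(2) fin]
  show "(\<lambda>x. kB_comp k G H H (x, kB_class k H H (group_biset H))) \<in> linear_maps k (kB k G H) (kB k G H)"
    by (intro kB_comp_linear kB_class_closed k grp gb)
  show "kB_comp k G H H (kB_class k G H U, kB_class k H H (group_biset H)) = kB_class k G H U"
    if U: "is_biset G H U" for U :: "(nat, 'g, 'h) biset"
    unfolding kB_comp_class[OF k grp(1,2,2) U gb]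
    by (intro kB_class_cong biset_tensor_group_right biset_pair.is_biset_tensor[OF biset_pair.intro] grp fin gb U)
qed

text \<open>As \<open>Hom D X Y\<close> is \<open>kB k Y X\<close>, the factors of
  \<open>Comp D X Y Z g f\<close> appear in \<open>kB_comp\<close> in the same order, and the laws
  of \<open>kB_comp\<close> carry over without interchanging left and right.\<close>

lemma linear_category_full_subcategory:
  fixes k :: "'k ring" and D :: "('a monoid, 'k, ('k, 'a, 'a) kB_elt) lin_cat"
  assumes k: "cring k" and D: "full_subcategory D (biset_category k)"
  shows "linear_category k D"
proof -
  have Ob: "group X" "finite (carrier X)" if "X \<in> Ob D" for X
    using D that by (auto simp: full_subcategory_def biset_category_def)
  have D_simps: "X \<in> Ob D \<Longrightarrow> Y \<in> Ob D \<Longrightarrow> Hom D X Y = kB k Y X"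
    "X \<in> Ob D \<Longrightarrow> Y \<in> Ob D \<Longrightarrow> Z \<in> Ob D \<Longrightarrow> Comp D X Y Z = (\<lambda>\<beta> \<alpha>. kB_comp k Z Y X (\<beta>, \<alpha>))"
    "X \<in> Ob D \<Longrightarrow> Ident D X = kB_class k X X (group_biset X)" for X Y Z
    using D by (simp_all add: full_subcategory_def biset_category_def)
  show ?thesis
    by (rule linear_category.intro)
      (simp_all add: D_simps Ob k module_kB kB_comp_linear kB_comp_assoc kB_class_closed
        is_biset_group_biset kB_comp_ident_left kB_comp_ident_right)
qed

theorem lemma4p6:
  fixes k :: "'k ring"
    and D :: "('a monoid, 'k, ('k, 'a, 'a) kB_elt) lin_cat"
    and G H :: "'a monoid"
  assumes "field k"
    and "full_subcategory D (biset_category k)"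
    and "G \<in> Ob D" and "H \<in> Ob D"
  shows "k_generated k H G \<longleftrightarrow>
    (\<exists>n::nat. n \<ge> 1 \<and> direct_summand k D (yoneda D H) (functor_power (yoneda D G) n))"
proof -
  have "cring k"
    using assms(1) by (simp add: field_def domain_def)
  then interpret linear_category k D
    using assms(2) by (rule linear_category_full_subcategory)
  have "Hom D X Y = kB k Y X" "Comp D X Y Z = (\<lambda>\<beta> \<alpha>. kB_comp k Z Y X (\<beta>, \<alpha>))"
    if "X \<in> Ob D" "Y \<in> Ob D" "Z \<in> Ob D" for X Y Z
    using assms(2) that by (simp_all add: full_subcategory_def biset_category_def)
  \<comment> \<open>The products in \<open>k_generated\<close>, with \<open>U\<close> in
    \<open>kB k H G\<close> and \<open>W\<close> in \<open>kB k G H\<close>, are exactly the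
    composites from \<open>H\<close> through \<open>G\<close> to \<open>H\<close> of the abstract
    equivalence.\<close>
  with linear_combinations_eq_Hom_iff_direct_summand[OF assms(3,4)] assms(3,4)
  show ?thesis
    by (simp add: k_generated_def)
qed

end
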